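(* Let $X$ be a compact abelian topological group and let $H = \bigcup_{n \in \omega} F_n$, where each $F_n$ is a closed subgroup of $X$ and $F_n \subsetneq F_{n+1}$ for each $n$. Then the following are equivalent: (a) $H = \mathcal{C}_B(X)$ for some countably infinite $B \subseteq \widehat{X}$. (b) $H = s_{\underline{u}}(X)$ for some sequence $\underline{u} : \omega \to \widehat{X}$. (c) For some $m$: $X/F_m$ is metrizable and the index $|F_{n+1} : F_n|$ is finite for all $n \ge m$.
   Context: All topological groups are Hausdorff; abelian groups are written additively. $\omega$ is the set of natural numbers (including $0$), and $\mathbb{T} = \mathbb{R}/\mathbb{Z}$. For a topological abelian group $X$, $\widehat{X}$ is the group of continuous homomorphisms $X \to \mathbb{T}$. For a sequence $\underline{u} = \langle u_n : n \in \omega\rangle$ in $\widehat{X}$, $s_{\underline{u}}(X) = \{x \in X : u_n(x) \to 0 \text{ in } \mathbb{T}\}$. For a countably infinite set $B \subseteq \widehat{X}$, $\mathcal{C}_B(X)$ is the set of all $x \in X$ such that $\langle \varphi(x) : \varphi \in B\rangle$ converges to $0$ in $\mathbb{T}$, i.e., for every neighborhood $U$ of $0$ in $\mathbb{T}$, $\varphi(x) \in U$ for all but finitely many $\varphi \in B$. *)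

theory Defs
  imports "HOL-Analysis.Analysis"
begin

section \<open>The circle group \<open>\<real>/\<int>\<close>\<close>

quotient_type circle = real / "\<lambda>x y. x - y \<in> \<int>"
  morphisms rep_circle to_circle
proof (rule equivpI)
  show "reflp (\<lambda>x y::real. x - y \<in> \<int>)"
    by (simp add: reflp_def)
  show "symp (\<lambda>x y::real. x - y \<in> \<int>)"
    unfolding symp_def using Ints_minus by fastforce
  show "transp (\<lambda>x y::real. x - y \<in> \<int>)"
    unfolding transp_def
  proof (intro allI impI)
    fix x y z :: real
    assume "x - y \<in> \<int>" "y - z \<in> \<int>"
    from Ints_add[OF this] show "x - z \<in> \<int>"
      by simp
  qed
qed

lemma to_circle_eq_iff: "to_circle x = to_circle y \<longleftrightarrow> x - y \<in> \<int>"
  by (simp add: circle.abs_eq_iff)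

lemma to_circle_cases: obtains x where "a = to_circle x"
  by (metis Quotient3_abs_rep[OF Quotient3_circle])

instantiation circle :: ab_group_add
begin

lift_definition zero_circle :: circle is 0 .

lift_definition plus_circle :: "circle \<Rightarrow> circle \<Rightarrow> circle" is "(+)"
proof -
  fix a b c d :: real
  assume "a - b \<in> \<int>" "c - d \<in> \<int>"
  from Ints_add[OF this] show "(a + c) - (b + d) \<in> \<int>"
    by (simp add: algebra_simps)
qed

lift_definition uminus_circle :: "circle \<Rightarrow> circle" is uminus
proof -
  fix a b :: real
  assume "a - b \<in> \<int>"
  from Ints_minus[OF this] show "- a - - b \<in> \<int>"
    by simp
qed

lift_definition minus_circle :: "circle \<Rightarrow> circle \<Rightarrow> circle" is "(-)"
proof -
  fix a b c d :: real
  assume "a - b \<in> \<int>" "c - d \<in> \<int>"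
  from Ints_diff[OF this] show "(a - c) - (b - d) \<in> \<int>"
    by (simp add: algebra_simps)
qed

instance
  by standard (transfer; simp add: algebra_simps)+

end

text \<open>The quotient topology along the projection \<^term>\<open>to_circle\<close>.\<close>

instantiation circle :: topological_space
begin

definition open_circle :: "circle set \<Rightarrow> bool" where
  "open U \<longleftrightarrow> open (to_circle -` U)"

instance
  by standard (auto simp: open_circle_def vimage_Int vimage_Union)

end

lemma open_to_circle_image:
  assumes "open S"
  shows "open (to_circle ` S)"
proof -
  have "to_circle -` (to_circle ` S) = (\<Union>k\<in>\<int>. (+) k ` S)"
  proof (intro set_eqI iffI)
    fix x assume "x \<in> to_circle -` (to_circle ` S)"
    then obtain y where "y \<in> S" "x - y \<in> \<int>"
      by (auto simp: to_circle_eq_iff)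
    then show "x \<in> (\<Union>k\<in>\<int>. (+) k ` S)"
      by (auto intro!: bexI[of _ "x - y"] image_eqI[of _ _ y])
  next
    fix x assume "x \<in> (\<Union>k\<in>\<int>. (+) k ` S)"
    then obtain k y where "k \<in> \<int>" "y \<in> S" "x = k + y"
      by blast
    then have "to_circle x = to_circle y"
      by (simp add: to_circle_eq_iff)
    with \<open>y \<in> S\<close> show "x \<in> to_circle -` (to_circle ` S)"
      by simp
  qed
  then show ?thesis
    using assms by (auto simp: open_circle_def intro: open_translation)
qed

lemma continuous_to_circle: "continuous_on UNIV to_circle"
  by (auto simp: continuous_on_open_vimage open_circle_def)

lemma nhds_to_circle: "nhds (to_circle x) = filtermap to_circle (nhds x)"
proof (rule antisym)
  show "nhds (to_circle x) \<le> filtermap to_circle (nhds x)"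
  proof (rule filter_leI)
    fix P assume "eventually P (filtermap to_circle (nhds x))"
    then obtain S where "open S" "x \<in> S" "\<forall>y\<in>S. P (to_circle y)"
      by (auto simp: eventually_filtermap eventually_nhds)
    then show "eventually P (nhds (to_circle x))"
      using open_to_circle_image[of S] by (auto simp: eventually_nhds)
  qed
  have "isCont to_circle x"
    using continuous_to_circle by (simp add: continuous_on_eq_continuous_at)
  then have "(to_circle \<longlongrightarrow> to_circle x) (nhds x)"
    unfolding isCont_def by (simp only: tendsto_at_iff_tendsto_nhds)
  then show "filtermap to_circle (nhds x) \<le> nhds (to_circle x)"
    by (simp only: filterlim_def)
qed

instance circle :: topological_ab_group_add
proof
  fix a b :: circle
  obtain x y where ab: "a = to_circle x" "b = to_circle y"
    by (metis to_circle_cases)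
  have lim: "(to_circle \<longlongrightarrow> to_circle z) (nhds z)" for z
    by (simp add: filterlim_def nhds_to_circle)
  have "((\<lambda>p. to_circle (fst p + snd p)) \<longlongrightarrow> to_circle (x + y)) (nhds x \<times>\<^sub>F nhds y)"
    by (rule filterlim_compose[OF lim tendsto_add_Pair])
  then have "((\<lambda>p. to_circle (fst p) + to_circle (snd p)) \<longlongrightarrow> a + b) (nhds x \<times>\<^sub>F nhds y)"
    by (simp add: ab plus_circle.abs_eq)
  moreover have "nhds a \<times>\<^sub>F nhds b =
      filtermap (\<lambda>p. (to_circle (fst p), to_circle (snd p))) (nhds x \<times>\<^sub>F nhds y)"
    by (simp add: ab nhds_to_circle prod_filtermap1 prod_filtermap2 filtermap_filtermap
        apfst_def apsnd_def map_prod_def case_prod_unfold)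
  ultimately show "LIM p nhds a \<times>\<^sub>F nhds b. fst p + snd p :> nhds (a + b)"
    by (simp add: filterlim_filtermap)
  have "((\<lambda>z. to_circle (- z)) \<longlongrightarrow> to_circle (- x)) (nhds x)"
    by (rule filterlim_compose[OF lim tendsto_uminus_nhds])
  then have "((\<lambda>z. - to_circle z) \<longlongrightarrow> - a) (nhds x)"
    by (simp add: ab uminus_circle.abs_eq)
  then show "(uminus \<longlongrightarrow> - a) (nhds a)"
    unfolding ab nhds_to_circle[of x] by (simp only: filterlim_filtermap)
qed

instance circle :: t2_space
proof
  fix a b :: circle
  assume "a \<noteq> b"
  moreover obtain x y where ab: "a = to_circle x" "b = to_circle y"
    by (metis to_circle_cases)
  ultimately have "x - y \<in> - \<int>"
    by (auto simp: to_circle_eq_iff)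
  moreover have "open (- \<int> :: real set)"
    by (simp add: open_Compl)
  ultimately obtain e where e: "e > 0" "ball (x - y) e \<subseteq> - \<int>"
    by (meson open_contains_ball)
  define U V where "U = to_circle ` ball x (e/2)" and "V = to_circle ` ball y (e/2)"
  have "U \<inter> V = {}"
  proof (rule ccontr)
    assume "U \<inter> V \<noteq> {}"
    then obtain s t where "dist x s < e/2" "dist y t < e/2" "s - t \<in> \<int>"
      by (auto simp: U_def V_def to_circle_eq_iff)
    moreover from this have "s - t \<in> ball (x - y) e"
      by (simp add: dist_real_def) argo
    ultimately show False
      using e by auto
  qed
  moreover have "open U" "open V" "a \<in> U" "b \<in> V"
    using e by (auto simp: U_def V_def ab open_to_circle_image)
  ultimately show "\<exists>U V. open U \<and> open V \<and> a \<in> U \<and> b \<in> V \<and> U \<inter> V = {}"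
    by blast
qed

section \<open>Characters, subgroups and quotients\<close>

definition characters :: "('a::topological_ab_group_add \<Rightarrow> circle) set" where
  "characters = {\<phi>. continuous_on UNIV \<phi> \<and> (\<forall>x y. \<phi> (x + y) = \<phi> x + \<phi> y)}"

definition char_seq_set :: "(nat \<Rightarrow> 'a::topological_ab_group_add \<Rightarrow> circle) \<Rightarrow> 'a set" where
  "char_seq_set u = {x. (\<lambda>n. u n x) \<longlonglongrightarrow> 0}"

definition char_conv_set :: "('a::topological_ab_group_add \<Rightarrow> circle) set \<Rightarrow> 'a set" where
  "char_conv_set B = {x. \<forall>U. open U \<and> 0 \<in> U \<longrightarrow> finite {\<phi> \<in> B. \<phi> x \<notin> U}}"

definition add_subgroup :: "'a::ab_group_add set \<Rightarrow> bool" where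
  "add_subgroup K \<longleftrightarrow> 0 \<in> K \<and> (\<forall>x\<in>K. \<forall>y\<in>K. x + y \<in> K) \<and> (\<forall>x\<in>K. - x \<in> K)"

definition coset :: "'a::ab_group_add set \<Rightarrow> 'a \<Rightarrow> 'a set" where
  "coset K x = (+) x ` K"

definition finite_index :: "'a::ab_group_add set \<Rightarrow> 'a set \<Rightarrow> bool" where
  "finite_index G K \<longleftrightarrow> finite (coset K ` G)"

text \<open>The quotient \<open>X/K\<close>: the set of cosets, with the quotient topology along the projection
  \<^term>\<open>coset K\<close>.\<close>

definition quotient_space :: "'a::topological_ab_group_add set \<Rightarrow> 'a set topology" where
  "quotient_space K = topology (\<lambda>V. V \<subseteq> range (coset K) \<and> open (coset K -` V))"

lemma openin_quotient_space:
  "openin (quotient_space K) V \<longleftrightarrow> V \<subseteq> range (coset K) \<and> open (coset K -` V)"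
proof -
  have "istopology (\<lambda>V. V \<subseteq> range (coset K) \<and> open (coset K -` V))"
    by (auto simp: istopology_def vimage_Int vimage_Union)
  then show ?thesis
    by (simp add: quotient_space_def topology_inverse')
qed

lemma topspace_quotient_space: "topspace (quotient_space K) = range (coset K)"
proof
  show "topspace (quotient_space K) \<subseteq> range (coset K)"
    using openin_topspace[of "quotient_space K"] by (simp only: openin_quotient_space)
  have "coset K -` range (coset K) = UNIV"
    by blast
  then have "openin (quotient_space K) (range (coset K))"
    by (simp add: openin_quotient_space)
  then show "range (coset K) \<subseteq> topspace (quotient_space K)"
    by (rule openin_subset)
qed

lemma quotient_map_coset: "quotient_map euclidean (quotient_space K) (coset K)"
  by (auto simp: quotient_map_def topspace_quotient_space openin_quotient_space vimage_def)

end

(* The substance of (c) ==> (b) is that characters of X vanishing on a closed subgroup F separate the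
   points outside F.  There is an invariant mean on the continuous functions on X: averages over
   finitely many translates have arbitrarily small oscillation.  Convolution with a suitable
   F-invariant function then has an eigenvalue l other than 0, and the autocorrelation of a unit
   eigenfunction h, x |-> <h(. + x), h>, is a character if h maximises its norm.

   (c) ==> (b): pick finite sets S_n of characters vanishing on F_n such that every x on which S_n is
   uniformly close to 0 lies in F_n + U_n, where the neighbourhoods U_n shrink to F_m and satisfy
   (U_n - U_n) \<inter> F_(n+1) \<subseteq> F_m.  If the concatenated sequence converges to 0 at x, then
   x = f_n + e_n with f_n in F_n and e_n in U_n for large n, the f_n agree modulo F_m, and
   hence x lies in H.

   (b) ==> (c): by the Baire category theorem some F_m contains all x in H at which all u_n are
   uniformly small.  On the compact group F_n, n >= m, a second category argument shows that these x
   form a neighbourhood of 0, so F_m has finite index in F_n.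

   (b) ==> (a): if u has finite range then H is closed, which contradicts the strict increase of the
   F_n; otherwise repetitions in u can be removed. *)
theory Submission
  imports Defs "HOL-Complex_Analysis.Great_Picard" "HOL-Library.Real_Mod"
begin

section \<open>Topological groups\<close>

text \<open>The group need not be metrizable, and no measure is constructed on it. The mean is
  reached through commuting averaging operators, so invariance, positivity and Fubini reduce to
  statements about finite averages; it coincides with the Haar integral of a continuous function.
  The spectral argument stays among continuous functions, where the mean-square norm is incomplete.
  This does no harm: convolution turns a mean-square bound into uniform boundedness and
  equicontinuity, so sequences converge uniformly after convolution, and an eigenfunction is its own
  convolution up to the factor \<open>1 / l\<close>. Heuristically, the autocorrelation of a unit
  \<open>h\<close> is a convex combination of the characters in the spectrum of \<open>h\<close>.
  Its mean-square norm is the sum of the squared weights, which is largest when only one weight is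
  left. The bound 1 on \<open>norm (circle_exp (\<phi> x) - 1)\<close> describes an arc that
  contains no subgroup except the trivial one. Multiples of a character therefore leave it, and one
  bound serves all \<open>F n\<close> at once.\<close>

instance prod :: (topological_monoid_add, topological_monoid_add) topological_monoid_add
proof
  fix a b :: "'a \<times> 'b"
  have "((\<lambda>p. (fst (fst p) + fst (snd p), snd (fst p) + snd (snd p))) \<longlongrightarrow>
      (fst a + fst b, snd a + snd b)) (nhds a \<times>\<^sub>F nhds b)"
    by (intro tendsto_intros tendsto_fst tendsto_snd filterlim_fst filterlim_snd)
  then show "LIM p nhds a \<times>\<^sub>F nhds b. fst p + snd p :> nhds (a + b)"
    by (simp add: plus_prod_def)
qed

instance prod :: (topological_comm_monoid_add, topological_comm_monoid_add)
  topological_comm_monoid_add ..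

text \<open>A kernel in two variables is later treated as one function on a compact product group,
  so that uniform continuity and the mean apply to it directly.\<close>

instance prod :: (topological_group_add, topological_group_add) topological_group_add
proof
  fix a :: "'a \<times> 'b"
  have "((\<lambda>p. (- fst p, - snd p)) \<longlongrightarrow> (- fst a, - snd a)) (nhds a)"
    by (intro tendsto_intros tendsto_fst tendsto_snd filterlim_ident)
  then show "(uminus \<longlongrightarrow> - a) (nhds a)"
    by (simp add: uminus_prod_def[abs_def])
qed

instance prod :: (topological_ab_group_add, topological_ab_group_add) topological_ab_group_add ..

lemma continuous_translation [continuous_intros]:
  fixes f :: "'a::topological_ab_group_add \<Rightarrow> 'b::topological_space"
  assumes "continuous_on UNIV f"
  shows "continuous_on UNIV (\<lambda>x. f (x + a))" "continuous_on UNIV (\<lambda>x. f (x - a))"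
    "continuous_on UNIV (\<lambda>x. f (- x))" "continuous_on UNIV (\<lambda>x. f (a - x))"
    "continuous_on UNIV (\<lambda>x. f (a + x))"
proof -
  have minus: "continuous_on UNIV (\<lambda>x::'a. - x)"
    by (simp add: continuous_on_def tendsto_uminus_nhds tendsto_minus)
  have add: "continuous_on UNIV (\<lambda>x::'a. x + b)" for b
    by (intro continuous_intros)
  have neg: "continuous_on UNIV (\<lambda>x::'a. a - x)"
    using continuous_on_compose2[OF add[of a] minus] by (simp add: algebra_simps)
  have comp: "continuous_on UNIV (\<lambda>x. f (g x))" if "continuous_on UNIV g" for g :: "'a \<Rightarrow> 'a"
    by (rule continuous_on_compose2[OF assms that]) simp
  show "continuous_on UNIV (\<lambda>x. f (x + a))" "continuous_on UNIV (\<lambda>x. f (x - a))"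
    "continuous_on UNIV (\<lambda>x. f (- x))" "continuous_on UNIV (\<lambda>x. f (a - x))"
    "continuous_on UNIV (\<lambda>x. f (a + x))"
    using comp[OF add[of a]] comp[OF add[of "-a"]] comp[OF minus] comp[OF neg]
    by (simp_all add: add.commute)
qed

lemma open_translate:
  fixes S :: "'a::topological_ab_group_add set"
  assumes "open S"
  shows "open ((+) a ` S)"
proof -
  have "(+) a ` S = (\<lambda>x. x - a) -` S"
    by (force simp: image_iff algebra_simps)
  moreover have "continuous_on UNIV (\<lambda>x. x - a)"
    by (rule continuous_translation(2)[OF continuous_on_id])
  ultimately show ?thesis
    using open_vimage[OF assms] by simp
qed

lemma nbhd_add:
  fixes U :: "'a::topological_ab_group_add set"
  assumes "open U" "0 \<in> U"
  obtains V where "open V" "0 \<in> V" "\<And>x y. x \<in> V \<Longrightarrow> y \<in> V \<Longrightarrow> x + y \<in> U"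
    "\<And>x y. x \<in> V \<Longrightarrow> y \<in> V \<Longrightarrow> x - y \<in> U"
proof -
  have c: "continuous_on UNIV (\<lambda>p::'a\<times>'a. fst p + snd p)"
    by (intro continuous_intros)
  have m: "continuous_on UNIV (\<lambda>p::'a\<times>'a. fst p + - snd p)"
    unfolding continuous_on_def by (intro ballI tendsto_intros tendsto_fst tendsto_snd)
  have *: "open ((\<lambda>p::'a\<times>'a. fst p + snd p) -` U \<inter> (\<lambda>p::'a\<times>'a. fst p + - snd p) -` U)"
    using open_vimage[OF assms(1) c] open_vimage[OF assms(1) m] by blast
  have "(0, 0) \<in> (\<lambda>p::'a\<times>'a. fst p + snd p) -` U \<inter> (\<lambda>p::'a\<times>'a. fst p + - snd p) -` U"
    using assms(2) by simp
  then obtain A B where AB: "open A" "open B" "(0, 0) \<in> A \<times> B"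
    "A \<times> B \<subseteq> (\<lambda>p::'a\<times>'a. fst p + snd p) -` U \<inter> (\<lambda>p::'a\<times>'a. fst p + - snd p) -` U"
    by (rule open_prod_elim[OF *])
  show ?thesis
  proof (rule that[of "A \<inter> B"])
    show "x + y \<in> U" "x - y \<in> U" if "x \<in> A \<inter> B" "y \<in> A \<inter> B" for x y
      using AB(4) that by auto
  qed (use AB in auto)
qed

lemma uniformly_continuous_on_compact_group:
  fixes f :: "'a::topological_ab_group_add \<Rightarrow> 'b::metric_space"
  assumes cpt: "compact (UNIV :: 'a set)" and f: "continuous_on UNIV f" and e: "e > 0"
  obtains U where "open U" "0 \<in> U" "\<And>x d. d \<in> U \<Longrightarrow> dist (f (x + d)) (f x) < e"
proof -
  \<comment> \<open>Two increments are allowed: \<open>a\<close> carries \<open>x\<close> to an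
    arbitrary point of its covering set, and \<open>b\<close> is the increment \<open>d\<close> of
    the statement.\<close>
  have "\<exists>V. open V \<and> 0 \<in> V \<and> (\<forall>a\<in>V. \<forall>b\<in>V. dist (f (x + (a + b))) (f x) < e/2)" for x
  proof -
    have "open ((\<lambda>z. f (x + z)) -` ball (f x) (e/2))"
      by (rule open_vimage[OF _ continuous_translation(5)[OF f]]) simp
    moreover have "0 \<in> (\<lambda>z. f (x + z)) -` ball (f x) (e/2)"
      using e by simp
    ultimately obtain V where "open V" "0 \<in> V"
      "\<And>a b. a \<in> V \<Longrightarrow> b \<in> V \<Longrightarrow> a + b \<in> (\<lambda>z. f (x + z)) -` ball (f x) (e/2)"
      by (rule nbhd_add) blast
    then show ?thesis
      by (auto simp: dist_commute)
  qed
  then obtain V where V: "\<And>x. open (V x)" "\<And>x. 0 \<in> V x"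
    "\<And>x a b. a \<in> V x \<Longrightarrow> b \<in> V x \<Longrightarrow> dist (f (x + (a + b))) (f x) < e/2"
    by metis
  have "UNIV \<subseteq> (\<Union>x. (+) x ` V x)"
    using V(2) by (force intro!: image_eqI[of _ _ 0])
  then obtain D where D: "finite D" "UNIV \<subseteq> (\<Union>x\<in>D. (+) x ` V x)"
    using compactE_image[OF cpt, of UNIV "\<lambda>x. (+) x ` V x"] open_translate[OF V(1)]
    by (metis top_greatest)
  show ?thesis
  proof (rule that[of "\<Inter>x\<in>D. V x"])
    show "open (\<Inter>x\<in>D. V x)"
      using D(1) V(1) by blast
    show "0 \<in> (\<Inter>x\<in>D. V x)"
      using V(2) by blast
    fix y d assume d: "d \<in> (\<Inter>x\<in>D. V x)"
    obtain x a where x: "x \<in> D" "a \<in> V x" "y = x + a"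
      using D(2) by blast
    have "dist (f (y + d)) (f x) < e/2" "dist (f (x + (a + 0))) (f x) < e/2"
      using V(3)[of a x d] V(3)[of a x 0] V(2) x d by (auto simp: add.assoc)
    then show "dist (f (y + d)) (f y) < e"
      using x(3) dist_triangle_half_r[of "f x" "f (y + d)" e "f y"] by (simp add: dist_commute)
  qed
qed

text \<open>The weak inequality matters: bounds on means, suprema and limits are obtained only in
  non-strict form.\<close>

lemma continuous_on_if_uniform:
  fixes g :: "'a::topological_ab_group_add \<Rightarrow> 'b::metric_space"
  assumes "\<And>e. e > 0 \<Longrightarrow> \<exists>U. open U \<and> 0 \<in> U \<and> (\<forall>x. \<forall>d\<in>U. dist (g (x + d)) (g x) \<le> e)"
  shows "continuous_on UNIV g"
  unfolding continuous_on_def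
proof
  fix x :: 'a
  show "(g \<longlongrightarrow> g x) (at x)"
  proof (rule tendstoI)
    fix e :: real assume "e > 0"
    then obtain U where U: "open U" "0 \<in> U" "\<forall>x. \<forall>d\<in>U. dist (g (x + d)) (g x) \<le> e/2"
      using assms[of "e/2"] by auto
    have "\<forall>y\<in>(+) x ` U. dist (g y) (g x) < e"
      using U(3) \<open>e > 0\<close> by (auto intro: order.strict_trans1[of _ "e/2"])
    moreover have "x \<in> (+) x ` U"
      using U(2) by force
    ultimately show "\<forall>\<^sub>F y in at x. dist (g y) (g x) < e"
      using open_translate[OF U(1), of x] by (auto simp: eventually_at_topological)
  qed
qed

lemma finite_translate_cover:
  fixes U :: "'a::topological_ab_group_add set"
  assumes "compact (UNIV :: 'a set)" "open U" "0 \<in> U"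
  obtains D where "D \<noteq> []" "\<And>x. \<exists>d\<in>set D. x - d \<in> U"
proof -
  have "UNIV \<subseteq> (\<Union>x. (+) x ` U)"
    using assms(3) by (force intro!: image_eqI[of _ _ 0])
  then obtain D where D: "finite D" "UNIV \<subseteq> (\<Union>x\<in>D. (+) x ` U)"
    using compactE_image[OF assms(1), of UNIV "\<lambda>x. (+) x ` U"] open_translate[OF assms(2)]
    by (metis top_greatest)
  obtain xs where xs: "set xs = D"
    using finite_list[OF D(1)] by blast
  show ?thesis
  proof (rule that[of xs])
    show "xs \<noteq> []"
      using D(2) xs by auto
    show "\<exists>d\<in>set xs. x - d \<in> U" for x
      using D(2) xs by (auto simp: subset_iff image_iff) (metis add_diff_cancel_left')
  qed
qed

section \<open>The invariant mean\<close>

definition avg :: "'a::ab_group_add list \<Rightarrow> ('a \<Rightarrow> 'b::real_vector) \<Rightarrow> 'a \<Rightarrow> 'b" where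
  "avg xs f x = (\<Sum>a\<leftarrow>xs. f (x + a)) /\<^sub>R real (length xs)"

text \<open>All pairwise sums with multiplicity. Lists instead of sets make averages closed under
  composition, since a sum may arise in several ways.\<close>

definition list_plus :: "'a::ab_group_add list \<Rightarrow> 'a list \<Rightarrow> 'a list" where
  "list_plus xs ys = concat (map (\<lambda>a. map ((+) a) ys) xs)"

lemma length_list_plus: "length (list_plus xs ys) = length xs * length ys"
  by (induction xs) (auto simp: list_plus_def)

lemma sum_list_scaleR: "(\<Sum>a\<leftarrow>xs. c *\<^sub>R f a) = c *\<^sub>R (\<Sum>a\<leftarrow>xs. f a :: 'b::real_vector)"
  by (induction xs) (auto simp: scaleR_right_distrib)

lemma avg_avg: "avg xs (avg ys f) = avg (list_plus xs ys) f"
proof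
  fix x
  have "(\<Sum>a\<leftarrow>xs. \<Sum>b\<leftarrow>ys. f (x + a + b)) = (\<Sum>a\<leftarrow>list_plus xs ys. f (x + a))"
    by (induction xs) (simp_all add: list_plus_def comp_def add.assoc)
  then show "avg xs (avg ys f) x = avg (list_plus xs ys) f x"
    by (simp add: avg_def sum_list_scaleR length_list_plus)
qed

text \<open>Commutativity of the group enters the theory of the mean here; it yields uniqueness and
  lets two averages be refined to a common one.\<close>

lemma avg_commute: "avg xs (avg ys f) = avg ys (avg xs f)"
proof
  fix x
  have "(\<Sum>a\<leftarrow>xs. \<Sum>b\<leftarrow>ys. f (x + a + b)) = (\<Sum>b\<leftarrow>ys. \<Sum>a\<leftarrow>xs. f (x + b + a))"
    by (induction xs) (simp_all add: sum_list_addf ac_simps)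
  then show "avg xs (avg ys f) x = avg ys (avg xs f) x"
    by (simp add: avg_def sum_list_scaleR mult.commute)
qed

lemma avg_shift: "avg xs (\<lambda>x. f (x + z)) x = avg xs f (x + z)"
  by (simp add: avg_def ac_simps)

lemma avg_add: "avg xs (\<lambda>x. f x + g x) x = avg xs f x + avg xs g x"
  by (simp add: avg_def sum_list_addf scaleR_right_distrib)

lemma avg_linear:
  assumes "linear h"
  shows "avg xs (\<lambda>x. h (f x)) x = h (avg xs f x)"
proof -
  have "(\<Sum>a\<leftarrow>ys. h (f (x + a))) = h (\<Sum>a\<leftarrow>ys. f (x + a))" for ys
    by (induction ys) (simp_all add: linear_0[OF assms] linear_add[OF assms])
  then show ?thesis
    by (simp add: avg_def linear_scale[OF assms])
qed

lemma avg_const: "xs \<noteq> [] \<Longrightarrow> avg xs (\<lambda>_. c) x = c"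
proof -
  have "(\<Sum>a\<leftarrow>xs. c) = real (length xs) *\<^sub>R c"
    by (induction xs) (auto simp: algebra_simps)
  then show "xs \<noteq> [] \<Longrightarrow> avg xs (\<lambda>_. c) x = c"
    by (simp add: avg_def)
qed

lemma norm_avg_le:
  fixes f :: "'a::ab_group_add \<Rightarrow> 'b::real_normed_vector"
  assumes "xs \<noteq> []" "\<And>x. norm (f x) \<le> e"
  shows "norm (avg xs f x) \<le> e"
proof -
  have "norm (\<Sum>a\<leftarrow>ys. f (x + a)) \<le> real (length ys) * e" for ys
  proof (induction ys)
    case (Cons y ys)
    then show ?case
      using norm_triangle_le[OF add_mono[OF assms(2)[of "x + y"] Cons]] by (simp add: algebra_simps)
  qed simp
  from this[of xs] show ?thesis
    using assms(1) by (simp add: avg_def field_simps)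
qed

lemma avg_diff: "avg xs (\<lambda>x. f x - g x) x = avg xs f x - avg xs g x"
  using avg_add[of xs f "\<lambda>x. - g x"] avg_linear[of uminus xs g] linear_uminus by (simp add: module_hom_uminus)

lemma norm_avg_diff_le:
  fixes f :: "'a::ab_group_add \<Rightarrow> 'b::real_normed_vector"
  assumes "xs \<noteq> []" "\<And>x. norm (f x - g x) \<le> e"
  shows "norm (avg xs f x - avg xs g x) \<le> e"
  using norm_avg_le[of xs "\<lambda>x. f x - g x", OF assms] by (simp add: avg_diff)

lemma norm_avg_const_le:
  fixes f :: "'a::ab_group_add \<Rightarrow> 'b::real_normed_vector"
  assumes "xs \<noteq> []" "\<And>x. norm (f x - c) \<le> e"
  shows "norm (avg xs f x - c) \<le> e"
  using norm_avg_diff_le[of xs f "\<lambda>_. c", OF assms] avg_const[OF assms(1), of c] by simp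

text \<open>Von Neumann's mean: \<open>c\<close> is a constant in the uniform closure of the
  averages of translates of \<open>f\<close>.\<close>

definition is_mean :: "('a::ab_group_add \<Rightarrow> 'b::real_normed_vector) \<Rightarrow> 'b \<Rightarrow> bool" where
  "is_mean f c \<longleftrightarrow> (\<forall>e>0. \<exists>xs. xs \<noteq> [] \<and> (\<forall>x. norm (avg xs f x - c) \<le> e))"

text \<open>Applying both averages in succession gives one value that is close to \<open>c\<close>
  and, after exchanging the order, close to \<open>d\<close>.\<close>

lemma avg_close:
  fixes f :: "'a::ab_group_add \<Rightarrow> 'b::real_normed_vector"
  assumes "xs \<noteq> []" "\<And>x. norm (avg xs f x - c) \<le> e" "ys \<noteq> []" "\<And>x. norm (avg ys f x - d) \<le> e'"
  shows "norm (c - d) \<le> e + e'"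
proof -
  have "norm (avg ys (avg xs f) 0 - c) \<le> e"
    using norm_avg_const_le[OF assms(3)] assms(2) by blast
  moreover have "norm (avg ys (avg xs f) 0 - d) \<le> e'"
    using norm_avg_const_le[OF assms(1)] assms(4) avg_commute by metis
  ultimately show ?thesis
    by norm
qed

lemma is_mean_unique:
  assumes "is_mean f c" "is_mean f d"
  shows "c = d"
proof (rule ccontr)
  assume "c \<noteq> d"
  define e where "e = norm (c - d) / 3"
  have "e > 0"
    using \<open>c \<noteq> d\<close> by (simp add: e_def)
  then obtain xs ys where "xs \<noteq> []" "\<And>x. norm (avg xs f x - c) \<le> e" "ys \<noteq> []"
    "\<And>x. norm (avg ys f x - d) \<le> e"
    using assms unfolding is_mean_def by meson
  from avg_close[OF this] show False
    using \<open>e > 0\<close> by (simp add: e_def)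
qed

definition mean :: "('a::ab_group_add \<Rightarrow> 'b::real_normed_vector) \<Rightarrow> 'b" where
  "mean f = (THE c. is_mean f c)"

lemma mean_eqI: "is_mean f c \<Longrightarrow> mean f = c"
  unfolding mean_def using is_mean_unique by blast

lemma is_mean_const: "is_mean (\<lambda>_. c) c"
  unfolding is_mean_def by (metis avg_const cancel_comm_monoid_add_class.diff_cancel less_imp_le norm_zero list.distinct(1))

text \<open>A function uniformly close to a constant stays so under further averaging. Hence the
  composition of a good average for \<open>f\<close> with a good one for \<open>g\<close> is good
  for both.\<close>

lemma is_mean_add:
  assumes "is_mean f c" "is_mean g d"
  shows "is_mean (\<lambda>x. f x + g x) (c + d)"
  unfolding is_mean_def
proof (intro allI impI)
  fix e :: real assume "e > 0"
  then obtain xs ys where xy: "xs \<noteq> []" "\<And>x. norm (avg xs f x - c) \<le> e/2" "ys \<noteq> []"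
    "\<And>x. norm (avg ys g x - d) \<le> e/2"
    using assms unfolding is_mean_def by (meson half_gt_zero)
  have "norm (avg (list_plus xs ys) (\<lambda>x. f x + g x) x - (c + d)) \<le> e" for x
  proof -
    have "norm (avg ys (avg xs f) x - c) \<le> e/2"
      using norm_avg_const_le[OF xy(3,2)] .
    moreover have "norm (avg xs (avg ys g) x - d) \<le> e/2"
      using norm_avg_const_le[OF xy(1,4)] .
    moreover have "avg (list_plus xs ys) (\<lambda>x. f x + g x) x = avg ys (avg xs f) x + avg xs (avg ys g) x"
      unfolding avg_add avg_commute[of ys xs] unfolding avg_avg ..
    ultimately show ?thesis
      using norm_triangle_mono[of "avg ys (avg xs f) x - c" "e/2" "avg xs (avg ys g) x - d" "e/2"]
      by (simp add: algebra_simps)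
  qed
  moreover have "list_plus xs ys \<noteq> []"
    using xy by (metis length_0_conv length_list_plus mult_eq_0_iff)
  ultimately show "\<exists>xs. xs \<noteq> [] \<and> (\<forall>x. norm (avg xs (\<lambda>x. f x + g x) x - (c + d)) \<le> e)"
    by blast
qed

lemma is_mean_linear:
  assumes "is_mean f c" "bounded_linear h"
  shows "is_mean (\<lambda>x. h (f x)) (h c)"
  unfolding is_mean_def
proof (intro allI impI)
  interpret h: bounded_linear h by fact
  fix e :: real assume "e > 0"
  obtain K where K: "K > 0" "\<And>x. norm (h x) \<le> norm x * K"
    using h.pos_bounded by blast
  obtain xs where xs: "xs \<noteq> []" "\<And>x. norm (avg xs f x - c) \<le> e / K"
    using assms(1) \<open>e > 0\<close> \<open>K > 0\<close> unfolding is_mean_def by (meson divide_pos_pos)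
  have "norm (avg xs (\<lambda>x. h (f x)) x - h c) \<le> e" for x
  proof -
    have "norm (h (avg xs f x - c)) \<le> e / K * K"
      using K(2)[of "avg xs f x - c"] mult_right_mono[OF xs(2)[of x], of K] K(1) by linarith
    then show ?thesis
      using K(1) by (simp add: avg_linear[OF h.linear] h.diff)
  qed
  with xs(1) show "\<exists>xs. xs \<noteq> [] \<and> (\<forall>x. norm (avg xs (\<lambda>x. h (f x)) x - h c) \<le> e)"
    by blast
qed

lemma is_mean_shift: "is_mean f c \<Longrightarrow> is_mean (\<lambda>x. f (x + z)) c"
  unfolding is_mean_def avg_shift by blast

lemma norm_is_mean_le:
  assumes "is_mean f c" "\<And>x. norm (f x - d) \<le> e"
  shows "norm (c - d) \<le> e"
proof (rule field_le_epsilon)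
  fix r :: real assume "r > 0"
  then obtain xs where xs: "xs \<noteq> []" "\<And>x. norm (avg xs f x - c) \<le> r"
    using assms(1) unfolding is_mean_def by blast
  then show "norm (c - d) \<le> e + r"
    using norm_avg_const_le[of xs f d e 0, OF xs(1) assms(2)]
      norm_triangle_mono[of "avg xs f 0 - d" e "c - avg xs f 0" r]
    by (simp add: norm_minus_commute)
qed

text \<open>The second part is quantitative: one summand lying \<open>r\<close> below the bound
  lowers the whole average by its share. It drives both the decrease of oscillation and the strict
  positivity of the mean.\<close>

lemma avg_mono_bounds:
  fixes f :: "'a::ab_group_add \<Rightarrow> real"
  assumes "xs \<noteq> []" "\<And>x. f x \<le> C"
  shows "avg xs f x \<le> C" "b \<in> set xs \<Longrightarrow> f (x + b) \<le> C - r \<Longrightarrow> avg xs f x \<le> C - r / length xs"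
proof -
  have *: "(\<Sum>a\<leftarrow>ys. f (x + a)) \<le> real (length ys) * C" for ys
    by (induction ys) (auto simp: algebra_simps intro: add_mono assms(2))
  from *[of xs] show "avg xs f x \<le> C"
    using assms(1) by (simp add: avg_def field_simps)
  assume b: "b \<in> set xs" "f (x + b) \<le> C - r"
  have "b \<in> set ys \<Longrightarrow> (\<Sum>a\<leftarrow>ys. f (x + a)) \<le> real (length ys) * C - r" for ys
  proof (induction ys)
    case (Cons y ys)
    then show ?case
      using b(2) assms(2)[of "x + y"] *[of ys] by (auto simp: algebra_simps)
  qed simp
  from this[OF b(1)] show "avg xs f x \<le> C - r / length xs"
    using assms(1) by (simp add: avg_def field_simps)
qed

text \<open>\<open>A\<close> collects the oscillation bounds that averages can reach. If its infimum
  \<open>\<delta>\<close> were positive, a nearly optimal average could be averaged once more and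
  would fall below \<open>\<delta>\<close>.\<close>

lemma avg_small_oscillation:
  fixes f :: "'a::topological_ab_group_add \<Rightarrow> real"
  assumes cpt: "compact (UNIV :: 'a set)" and f: "continuous_on UNIV f" and e: "e > 0"
  obtains xs c where "xs \<noteq> []" "\<And>x. \<bar>avg xs f x - c\<bar> \<le> e"
proof -
  define A where "A = {r. \<exists>xs c. xs \<noteq> [] \<and> (\<forall>x. c \<le> avg xs f x \<and> avg xs f x \<le> c + r)}"
  have A_nonneg: "r \<ge> 0" if r: "r \<in> A" for r
  proof -
    obtain xs c where "\<forall>x. c \<le> avg xs f x \<and> avg xs f x \<le> c + r"
      using r unfolding A_def by blast
    then show ?thesis by (meson add_le_same_cancel1 le_add_same_cancel1 order_trans)
  qed
  have "bounded (range f)"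
    using compact_continuous_image[OF f cpt] by (rule compact_imp_bounded)
  then obtain C where C: "\<And>x. \<bar>f x\<bar> \<le> C"
    by (auto simp: bounded_iff)
  have avg0: "avg [0] f x = f x" for x
    by (simp add: avg_def)
  have "2 * C \<in> A"
    unfolding A_def using C
    by (auto simp: avg0 abs_le_iff minus_le_iff intro!: exI[of _ "[0]"] exI[of _ "- C"])
  then have A_ne: "A \<noteq> {}" by blast
  have bdd: "bdd_below A"
    using A_nonneg by (meson bdd_belowI)
  define \<delta> where "\<delta> = Inf A"
  have le: "\<delta> \<le> r" if "r \<in> A" for r
    unfolding \<delta>_def using that bdd by (rule cInf_lower)
  have "\<delta> \<le> 0"
  proof (rule ccontr)
    assume "\<not> \<delta> \<le> 0"
    then have \<delta>: "\<delta> > 0" by simp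
    then have "\<delta>/4 > 0" by simp
    \<comment> \<open>All averages of \<open>f\<close> inherit its modulus of continuity. Therefore
      \<open>U\<close>, \<open>D\<close> and \<open>k\<close> depend on \<open>f\<close> alone and
      can be fixed before \<open>xs\<close> is chosen within \<open>\<delta> / (8 * k)\<close> of
      the infimum, less than the later gain \<open>\<delta> / (2 * k)\<close>.\<close>
    then obtain U where U: "open U" "0 \<in> U" "\<And>x d. d \<in> U \<Longrightarrow> dist (f (x + d)) (f x) < \<delta>/4"
      by (rule uniformly_continuous_on_compact_group[OF cpt f]) blast
    obtain D where D: "D \<noteq> []" "\<And>x. \<exists>d\<in>set D. x - d \<in> U"
      by (rule finite_translate_cover[OF cpt U(1,2)]) blast
    define k where "k = real (length D)"
    have k: "k \<ge> 1"
      using D(1) by (simp add: k_def Suc_le_eq)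
    have "\<delta> < \<delta> + \<delta> / (8 * k)"
      using \<delta> k by simp
    then obtain r where r: "r \<in> A" "r < \<delta> + \<delta> / (8 * k)"
      using cInf_lessD[OF A_ne] unfolding \<delta>_def by blast
    then obtain xs c where xs: "xs \<noteq> []" "\<And>x. c \<le> avg xs f x" "\<And>x. avg xs f x \<le> c + r"
      unfolding A_def by blast
    have k8: "\<delta> / (8 * k) \<le> \<delta> / 8" "\<delta> / (8 * k) < \<delta> / (2 * k)"
      using k \<delta> by (auto simp: field_simps)
    show False
    proof (cases "\<exists>x0. avg xs f x0 \<le> c + \<delta>/4")
      \<comment> \<open>The lower bound \<open>c\<close> was not tight: raising it by
        \<open>\<delta>/4\<close> already gives an oscillation below the infimum.\<close>
      case False
      then have "xs \<noteq> [] \<and> (\<forall>x. c + \<delta>/4 \<le> avg xs f x \<and> avg xs f x \<le> c + \<delta>/4 + (r - \<delta>/4))"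
        using xs by (auto dest: less_imp_le simp: not_le)
      then have "r - \<delta>/4 \<in> A"
        unfolding A_def by blast
      from le[OF this] r(2) k8 \<delta> show False by linarith
    next
      case True
      then obtain x0 where x0: "avg xs f x0 \<le> c + \<delta>/4" by blast
      \<comment> \<open>For every \<open>x\<close>, some shift in \<open>B\<close> brings
        \<open>x\<close> into \<open>x0 + U\<close>, where the average is at most
        \<open>c + \<delta>/2\<close>, hence at least \<open>\<delta>/2\<close> below the upper
        bound \<open>c + r\<close>.\<close>
      define B where "B = map (\<lambda>d. x0 - d) D"
      have B: "B \<noteq> []" "real (length B) = k"
        using D(1) by (simp_all add: B_def k_def)
      have "avg B (avg xs f) x \<le> c + (r - \<delta> / (2 * k))" for x
      proof -
        obtain d where d: "d \<in> set D" "x - d \<in> U"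
          using D(2) by blast
        have "norm (avg xs (\<lambda>y. f (y + (x - d))) x0 - avg xs f x0) \<le> \<delta>/4"
          by (rule norm_avg_diff_le[OF xs(1)])
            (use U(3)[OF d(2)] in \<open>auto simp: dist_norm intro: less_imp_le\<close>)
        moreover have "x0 + (x - d) = x + (x0 - d)"
          by simp
        ultimately have "avg xs f (x + (x0 - d)) \<le> c + \<delta>/2"
          using x0 unfolding avg_shift real_norm_def by (simp only: abs_le_iff) linarith
        then have "avg xs f (x + (x0 - d)) \<le> (c + r) - \<delta>/2"
          using le[OF r(1)] by simp
        moreover have "x0 - d \<in> set B"
          using d(1) by (simp add: B_def)
        ultimately have "avg B (avg xs f) x \<le> (c + r) - (\<delta>/2) / real (length B)"
          using avg_mono_bounds(2)[of B "avg xs f" "c + r", OF B(1) xs(3)] by blast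
        then show ?thesis
          using B(2) by (simp add: algebra_simps)
      qed
      moreover have "c \<le> avg B (avg xs f) x" for x
        using avg_mono_bounds(1)[OF B(1), of "\<lambda>x. - avg xs f x" "- c" x] xs(2)
          avg_linear[of uminus B "avg xs f"] by (simp add: linear_uminus module_hom_uminus)
      moreover have "list_plus B xs \<noteq> []"
        using B xs by (metis length_0_conv length_list_plus mult_eq_0_iff)
      ultimately have "r - \<delta> / (2 * k) \<in> A"
        unfolding A_def avg_avg by blast
      from le[OF this] r(2) k8 \<delta> show False by linarith
    qed
  qed
  then have "Inf A < e"
    using e by (simp add: \<delta>_def)
  then obtain r where "r \<in> A" "r < e"
    using cInf_lessD[OF A_ne] by blast
  then obtain xs c where "xs \<noteq> []" "\<And>x. c \<le> avg xs f x" "\<And>x. avg xs f x \<le> c + r"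
    unfolding A_def by blast
  note xs = this
  have "\<bar>avg xs f x - c\<bar> \<le> e" for x
    using xs(2,3)[of x] \<open>r < e\<close> by linarith
  with xs(1) show ?thesis
    by (rule that)
qed

text \<open>The centres of ever flatter averages form a Cauchy sequence by \<open>avg_close\<close>,
  and its limit is the mean.\<close>

lemma ex_is_mean_real:
  fixes f :: "'a::topological_ab_group_add \<Rightarrow> real"
  assumes cpt: "compact (UNIV :: 'a set)" and f: "continuous_on UNIV f"
  shows "\<exists>c. is_mean f c"
proof -
  have "\<exists>xs c. xs \<noteq> [] \<and> (\<forall>x. norm (avg xs f x - c) \<le> 1 / Suc n)" for n
    using avg_small_oscillation[OF cpt f, of "1 / Suc n"] by (metis of_nat_0_less_iff real_norm_def zero_less_Suc zero_less_divide_1_iff)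
  then obtain xs c where xs: "\<And>n. xs n \<noteq> []" "\<And>n x. norm (avg (xs n) f x - c n) \<le> 1 / Suc n"
    by metis
  have cc: "norm (c m - c n) \<le> 1 / Suc m + 1 / Suc n" for m n
    using avg_close[OF xs(1) xs(2) xs(1) xs(2)] .
  have "Cauchy c"
  proof (rule metric_CauchyI)
    fix e :: real assume "e > 0"
    then obtain N where N: "1 / Suc N < e / 2"
      using nat_approx_posE[of "e/2"] by auto
    have "dist (c m) (c n) < e" if "m \<ge> N" "n \<ge> N" for m n
    proof -
      have "1 / Suc m \<le> 1 / Suc N" "1 / Suc n \<le> 1 / Suc N"
        using that by (auto simp: field_simps)
      then show ?thesis
        using cc[of m n] N by (simp add: dist_norm)
    qed
    then show "\<exists>M. \<forall>m\<ge>M. \<forall>n\<ge>M. dist (c m) (c n) < e" by blast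
  qed
  then obtain l where l: "c \<longlonglongrightarrow> l"
    using real_Cauchy_convergent convergent_def by blast
  have "is_mean f l"
    unfolding is_mean_def
  proof (intro allI impI)
    fix e :: real assume "e > 0"
    then obtain N where N: "1 / Suc N < e / 2"
      using nat_approx_posE[of "e/2"] by auto
    obtain N' where N': "\<And>n. n \<ge> N' \<Longrightarrow> norm (c n - l) < e/2"
      using LIMSEQ_D[OF l, of "e/2"] \<open>e > 0\<close> by auto
    define n where "n = max N N'"
    have "1 / Suc n \<le> 1 / Suc N"
      by (auto simp: n_def field_simps)
    then have "norm (avg (xs n) f x - l) \<le> e" for x
      using xs(2)[of n x] N N'[of n] by (auto simp: n_def abs_if split: if_splits)
    with xs(1) show "\<exists>xs. xs \<noteq> [] \<and> (\<forall>x. norm (avg xs f x - l) \<le> e)"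
      by blast
  qed
  then show ?thesis ..
qed

text \<open>The oscillation argument uses the order of the reals, so real and imaginary parts are
  treated separately and recombined by linearity.\<close>

lemma is_mean_mean:
  fixes f :: "'a::topological_ab_group_add \<Rightarrow> complex"
  assumes cpt: "compact (UNIV :: 'a set)" and f: "continuous_on UNIV f"
  shows "is_mean f (mean f)"
proof -
  obtain a b where a: "is_mean (\<lambda>x. Re (f x)) a" and b: "is_mean (\<lambda>x. Im (f x)) b"
    using ex_is_mean_real[OF cpt] continuous_on_Re[OF f] continuous_on_Im[OF f] by metis
  have "is_mean (\<lambda>x. complex_of_real (Re (f x)) + \<i> * complex_of_real (Im (f x))) (of_real a + \<i> * of_real b)"
    by (intro is_mean_add is_mean_linear[OF a] is_mean_linear[OF b] bounded_linear_of_real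
        bounded_linear_compose[OF bounded_linear_mult_right bounded_linear_of_real])
  then have "is_mean f (of_real a + \<i> * of_real b)"
    by (simp add: complex_eq[symmetric])
  then show ?thesis
    using mean_eqI by metis
qed

text \<open>The common core of the Cauchy-Schwarz inequality for \<open>ip\<close> and for the
  semidefinite form in the eigenvalue argument; no sign of \<open>A\<close> or \<open>C\<close> is
  presupposed.\<close>

lemma quadratic_nonneg_discriminant:
  fixes b :: complex and A C :: real
  assumes "\<And>t. 0 \<le> A + 2 * Re (t * b) + (norm t)\<^sup>2 * C"
  shows "(norm b)\<^sup>2 \<le> A * C"
proof -
  have b: "b * cnj b = complex_of_real ((norm b)\<^sup>2)"
    by (metis complex_norm_square of_real_power)
  \<comment> \<open>Choosing \<open>t = - s * cnj b\<close> with real \<open>s\<close> aligns the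
    phase and makes the linear term real and negative for positive \<open>s\<close>.\<close>
  have *: "0 \<le> A - 2 * s * (norm b)\<^sup>2 + s\<^sup>2 * (norm b)\<^sup>2 * C" for s :: real
  proof -
    have "Re ((- of_real s * cnj b) * b) = - s * (norm b)\<^sup>2"
      using b by (metis (no_types, lifting) Re_complex_of_real mult.assoc mult.commute of_real_minus of_real_mult)
    moreover have "(norm (- of_real s * cnj b))\<^sup>2 = s\<^sup>2 * (norm b)\<^sup>2"
      by (simp add: norm_mult power_mult_distrib)
    ultimately show ?thesis
      using assms[of "- of_real s * cnj b"] by simp
  qed
  show ?thesis
  proof (cases "C > 0")
    case True
    have "0 \<le> A - 2 * (1 / C) * (norm b)\<^sup>2 + (1 / C)\<^sup>2 * (norm b)\<^sup>2 * C"
      by (rule *)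
    also have "\<dots> = A - (norm b)\<^sup>2 / C"
      using True by (simp add: field_simps power2_eq_square)
    finally show ?thesis
      using True by (simp add: field_simps)
  next
    case False
    have "(norm b)\<^sup>2 = 0"
    proof (rule ccontr)
      assume nz: "(norm b)\<^sup>2 \<noteq> 0"
      then have pos: "(norm b)\<^sup>2 > 0"
        by simp
      have "0 \<le> A"
        using *[of 0] by simp
      \<comment> \<open>With this \<open>s\<close> the linear term is \<open>- 2 * (A + 1)\<close>,
        which outweighs \<open>A\<close>, while the quadratic term cannot help because
        \<open>C\<close> is not positive.\<close>
      define s where "s = (A + 1) / (norm b)\<^sup>2"
      have "s\<^sup>2 * (norm b)\<^sup>2 * C \<le> 0"
        using False by (intro mult_nonneg_nonpos) auto
      moreover have "s * (norm b)\<^sup>2 = A + 1"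
        using nz by (simp add: s_def)
      ultimately show False
        using *[of s] \<open>0 \<le> A\<close> by linarith
    qed
    moreover have "0 \<le> A * C"
    proof (rule ccontr)
      assume "\<not> 0 \<le> A * C"
      have "0 \<le> A"
        using *[of 0] by simp
      with \<open>\<not> 0 \<le> A * C\<close> have "C < 0"
        by (metis mult_nonneg_nonneg not_le)
      \<comment> \<open>Here \<open>b = 0\<close>, and \<open>s\<close> makes the quadratic term
        equal to \<open>- (A + 1)\<close>.\<close>
      define s where "s = sqrt ((A + 1) / - C)"
      have "(norm (of_real s :: complex))\<^sup>2 * C = - (A + 1)"
        using \<open>C < 0\<close> \<open>0 \<le> A\<close> by (simp add: s_def field_simps)
      moreover have "b = 0"
        using \<open>(norm b)\<^sup>2 = 0\<close> by simp
      ultimately show False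
        using assms[of "of_real s"] by simp
    qed
    ultimately show ?thesis by simp
  qed
qed

lemma bounded_range_compact_group:
  fixes f :: "'a::topological_ab_group_add \<Rightarrow> 'b::real_normed_vector"
  assumes "compact (UNIV :: 'a set)" "continuous_on UNIV f"
  obtains B where "B > 0" "\<And>x. norm (f x) \<le> B"
proof -
  have "bounded (range f)"
    using compact_continuous_image[OF assms(2,1)] by (rule compact_imp_bounded)
  then show ?thesis
    using that by (auto simp: bounded_pos)
qed

text \<open>The group itself may be inseparable. Equicontinuity supplies finite nets
  \<open>D k\<close> such that every point resembles a net point up to \<open>1 / Suc k\<close> for
  all \<open>g n\<close> simultaneously; the diagonal argument runs over the countable union of
  these nets.\<close>

lemma Arzela_Ascoli_compact_group:
  fixes g :: "nat \<Rightarrow> 'a::topological_ab_group_add \<Rightarrow> complex"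
  assumes cpt: "compact (UNIV :: 'a set)" and bound: "\<And>n x. norm (g n x) \<le> C"
    and equi: "\<And>e. e > 0 \<Longrightarrow> \<exists>U. open U \<and> 0 \<in> U \<and> (\<forall>n x. \<forall>d\<in>U. dist (g n (x + d)) (g n x) \<le> e)"
  obtains r q where "strict_mono r" "continuous_on UNIV q" "uniform_limit UNIV (\<lambda>n. g (r n)) q sequentially"
proof -
  have "\<exists>D. \<forall>x. \<exists>d\<in>set D. \<forall>n. dist (g n x) (g n d) \<le> 1 / Suc k" for k
  proof -
    obtain U where U: "open U" "0 \<in> U" "\<forall>n x. \<forall>d\<in>U. dist (g n (x + d)) (g n x) \<le> 1 / Suc k"
      using equi[of "1 / Suc k"] by auto
    obtain D where D: "\<And>x. \<exists>d\<in>set D. x - d \<in> U"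
      using finite_translate_cover[OF cpt U(1,2)] by metis
    have "\<exists>d\<in>set D. \<forall>n. dist (g n x) (g n d) \<le> 1 / Suc k" for x
    proof -
      obtain d where d: "d \<in> set D" "x - d \<in> U"
        using D by blast
      have "dist (g n (d + (x - d))) (g n d) \<le> 1 / Suc k" for n
        using U(3) d(2) by blast
      with d(1) show ?thesis by auto
    qed
    then show ?thesis by blast
  qed
  then obtain D where D: "\<And>k x. \<exists>d\<in>set (D k). \<forall>n. dist (g n x) (g n d) \<le> 1 / Suc k"
    by metis
  have "countable (\<Union>k. set (D k))"
    by (intro countable_UN) (auto intro: countable_finite)
  then obtain r where r: "strict_mono r" "\<And>x. x \<in> (\<Union>k. set (D k)) \<Longrightarrow> \<exists>l. (\<lambda>n. g (r n) x) \<longlonglongrightarrow> l"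
    using function_convergent_subsequence[of "\<Union>k. set (D k)" g C] bound by metis
  have "uniformly_Cauchy_on UNIV (\<lambda>n. g (r n))"
    unfolding uniformly_Cauchy_on_def
  proof (intro allI impI)
    fix e :: real assume "e > 0"
    then obtain k where k: "1 / Suc k < e / 3"
      using nat_approx_posE[of "e/3"] by auto
    have "\<exists>N. \<forall>m\<ge>N. \<forall>n\<ge>N. dist (g (r m) d) (g (r n) d) < e / 3" if "d \<in> set (D k)" for d
    proof -
      have "Cauchy (\<lambda>n. g (r n) d)"
        using r(2)[of d] that convergent_Cauchy by (auto simp: convergent_def)
      then show ?thesis
        using \<open>e > 0\<close> by (intro metric_CauchyD) auto
    qed
    then obtain N where N: "\<And>d m n. d \<in> set (D k) \<Longrightarrow> m \<ge> N d \<Longrightarrow> n \<ge> N d \<Longrightarrow> dist (g (r m) d) (g (r n) d) < e / 3"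
      by metis
    define M where "M = Max (N ` set (D k))"
    have M: "N d \<le> M" if "d \<in> set (D k)" for d
      using that by (auto simp: M_def)
    have "dist (g (r m) x) (g (r n) x) < e" if "m \<ge> M" "n \<ge> M" for m n x
    proof -
      obtain d where d: "d \<in> set (D k)" "\<And>n. dist (g n x) (g n d) \<le> 1 / Suc k"
        using D by blast
      have "dist (g (r m) d) (g (r n) d) < e / 3"
        using N[OF d(1)] M[OF d(1)] that by simp
      moreover have "dist (g (r m) x) (g (r n) x)
          \<le> dist (g (r m) x) (g (r m) d) + dist (g (r m) d) (g (r n) d) + dist (g (r n) x) (g (r n) d)"
        by (smt (verit) dist_commute dist_triangle)
      ultimately show ?thesis
        using d(2)[of "r m"] d(2)[of "r n"] k by linarith
    qed
    then show "\<exists>M. \<forall>x\<in>UNIV. \<forall>m\<ge>M. \<forall>n\<ge>M. dist (g (r m) x) (g (r n) x) < e"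
      by blast
  qed
  then obtain q where q: "uniform_limit UNIV (\<lambda>n. g (r n)) q sequentially"
    using Cauchy_uniformly_convergent unfolding uniformly_convergent_on_def by blast
  have cont: "continuous_on UNIV (g n)" for n
    by (rule continuous_on_if_uniform) (meson equi)
  have "continuous_on UNIV q"
    by (rule uniform_limit_theorem[OF _ q]) (simp_all add: cont)
  with r(1) q show ?thesis
    using that by blast
qed

section \<open>Mean-square inner product, convolution and autocorrelation\<close>

definition ip :: "('a::ab_group_add \<Rightarrow> complex) \<Rightarrow> ('a \<Rightarrow> complex) \<Rightarrow> complex" where
  "ip h k = mean (\<lambda>x. h x * cnj (k x))"

definition nsq :: "('a::ab_group_add \<Rightarrow> complex) \<Rightarrow> real" where
  "nsq h = Re (ip h h)"

definition conv :: "('a::ab_group_add \<Rightarrow> complex) \<Rightarrow> ('a \<Rightarrow> complex) \<Rightarrow> 'a \<Rightarrow> complex" where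
  "conv f h x = mean (\<lambda>y. f (x - y) * h y)"

text \<open>The diagonal matrix coefficient at \<open>h\<close> of the translation
  representation.\<close>

definition autocorr :: "('a::ab_group_add \<Rightarrow> complex) \<Rightarrow> 'a \<Rightarrow> complex" where
  "autocorr h x = ip (\<lambda>y. h (y + x)) h"

context
  assumes cpt: "compact (UNIV :: 'a::topological_ab_group_add set)"
begin

lemma mean_const: "mean (\<lambda>_::'a. c) = (c :: complex)"
  by (rule mean_eqI[OF is_mean_const])

lemma mean_add:
  fixes f g :: "'a \<Rightarrow> complex"
  assumes "continuous_on UNIV f" "continuous_on UNIV g"
  shows "mean (\<lambda>x. f x + g x) = mean f + mean g"
  by (rule mean_eqI[OF is_mean_add[OF is_mean_mean[OF cpt assms(1)] is_mean_mean[OF cpt assms(2)]]])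

lemma mean_linear:
  fixes f :: "'a \<Rightarrow> complex" and h :: "complex \<Rightarrow> complex"
  assumes "continuous_on UNIV f" "bounded_linear h"
  shows "mean (\<lambda>x. h (f x)) = h (mean f)"
  by (rule mean_eqI[OF is_mean_linear[OF is_mean_mean[OF cpt assms(1)] assms(2)]])

lemma mean_mult_left:
  fixes f :: "'a \<Rightarrow> complex"
  assumes "continuous_on UNIV f"
  shows "mean (\<lambda>x. c * f x) = c * mean f"
  using mean_linear[OF assms bounded_linear_mult_right] .

lemma mean_cnj:
  fixes f :: "'a \<Rightarrow> complex"
  assumes "continuous_on UNIV f"
  shows "mean (\<lambda>x. cnj (f x)) = cnj (mean f)"
  using mean_linear[OF assms bounded_linear_cnj] .

lemma mean_diff:
  fixes f g :: "'a \<Rightarrow> complex"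
  assumes "continuous_on UNIV f" "continuous_on UNIV g"
  shows "mean (\<lambda>x. f x - g x) = mean f - mean g"
proof -
  have "continuous_on UNIV (\<lambda>x. - 1 * g x)"
    by (intro continuous_intros assms)
  from mean_add[OF assms(1) this] show ?thesis
    unfolding mean_mult_left[OF assms(2)] by simp
qed

lemma mean_shift:
  fixes f :: "'a \<Rightarrow> complex"
  assumes "continuous_on UNIV f"
  shows "mean (\<lambda>x. f (x + z)) = mean f"
  by (rule mean_eqI[OF is_mean_shift[OF is_mean_mean[OF cpt assms]]])

lemma norm_mean_diff_le:
  fixes f :: "'a \<Rightarrow> complex"
  assumes "continuous_on UNIV f" "\<And>x. norm (f x - d) \<le> e"
  shows "norm (mean f - d) \<le> e"
  using norm_is_mean_le[OF is_mean_mean[OF cpt assms(1)] assms(2)] .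

lemma norm_mean_le:
  fixes f :: "'a \<Rightarrow> complex"
  assumes "continuous_on UNIV f" "\<And>x. norm (f x) \<le> e"
  shows "norm (mean f) \<le> e"
  using norm_mean_diff_le[of f 0 e] assms by simp

lemma mean_tendsto:
  fixes f :: "nat \<Rightarrow> 'a \<Rightarrow> complex"
  assumes "\<And>n. continuous_on UNIV (f n)" "continuous_on UNIV l" "uniform_limit UNIV f l sequentially"
  shows "(\<lambda>n. mean (f n)) \<longlonglongrightarrow> mean l"
proof (rule tendstoI)
  fix e :: real assume "e > 0"
  then have "\<forall>\<^sub>F n in sequentially. \<forall>x\<in>UNIV. dist (f n x) (l x) < e / 2"
    by (intro uniform_limitD[OF assms(3)]) simp
  then show "\<forall>\<^sub>F n in sequentially. dist (mean (f n)) (mean l) < e"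
  proof (rule eventually_mono)
    fix n assume *: "\<forall>x\<in>UNIV. dist (f n x) (l x) < e / 2"
    have "norm (mean (\<lambda>x. f n x - l x)) \<le> e / 2"
      by (rule norm_mean_le) (use assms * in \<open>auto intro!: continuous_intros simp: dist_norm less_imp_le\<close>)
    then show "dist (mean (f n)) (mean l) < e"
      using \<open>e > 0\<close> mean_diff[OF assms(1) assms(2)] by (simp add: dist_norm)
  qed
qed

text \<open>Strict positivity makes \<open>nsq\<close> definite on continuous functions. Finitely
  many translates of the set where \<open>g\<close> exceeds half of \<open>g x0\<close> cover the
  group, so a suitable average of \<open>g\<close> is bounded below by a positive constant.\<close>

lemma mean_nonneg:
  fixes g :: "'a \<Rightarrow> real"
  assumes g: "continuous_on UNIV g" and nonneg: "\<And>x. g x \<ge> 0"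
  shows "mean (\<lambda>x. complex_of_real (g x)) = of_real (Re (mean (\<lambda>x. complex_of_real (g x))))"
    "Re (mean (\<lambda>x. complex_of_real (g x))) \<ge> 0"
    "g x0 > 0 \<Longrightarrow> Re (mean (\<lambda>x. complex_of_real (g x))) > 0"
proof -
  let ?f = "\<lambda>x. complex_of_real (g x)"
  have f: "continuous_on UNIV ?f"
    using g by (intro continuous_intros)
  have "cnj (mean ?f) = mean ?f"
    using mean_cnj[OF f] by simp
  then show real: "mean ?f = of_real (Re (mean ?f))"
    by (metis Reals_cnj_iff of_real_Re)
  obtain B where B: "B > 0" "\<And>x. norm (g x) \<le> B"
    by (rule bounded_range_compact_group[OF cpt g]) blast
  \<comment> \<open>Bounds on complex means come as distances to a point. Nonnegativity is therefore
    encoded as membership in the disc of radius \<open>B\<close> around \<open>B\<close>; later the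
    radius shrinks to \<open>B - \<eta>\<close>.\<close>
  have fB: "norm (?f x - of_real B) \<le> B" for x
  proof -
    have "norm (?f x - of_real B) = \<bar>g x - B\<bar>"
      by (metis norm_of_real of_real_diff)
    then show ?thesis
      using B(2)[of x] nonneg[of x] by simp
  qed
  have Re: "\<bar>Re (mean ?f) - B\<bar> = norm (mean ?f - of_real B)"
  proof -
    have "Im (mean ?f) = 0"
      using real by (metis Im_complex_of_real)
    then show ?thesis
      by (simp add: cmod_eq_Re)
  qed
  show "Re (mean ?f) \<ge> 0"
    using norm_mean_diff_le[OF f fB] Re by linarith
  assume x0: "g x0 > 0"
  define U where "U = (\<lambda>z. g (x0 + z)) -` {g x0 / 2<..}"
  have "open U"
    unfolding U_def by (rule open_vimage[OF _ continuous_translation(5)[OF g]]) simp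
  moreover have "0 \<in> U"
    using x0 by (simp add: U_def)
  ultimately obtain D where D: "D \<noteq> []" "\<And>x. \<exists>d\<in>set D. x - d \<in> U"
    by (rule finite_translate_cover[OF cpt]) blast
  define E where "E = map (\<lambda>d. x0 - d) D"
  define \<eta> where "\<eta> = (g x0 / 2) / length E"
  have E: "E \<noteq> []" "\<eta> > 0"
    using D(1) x0 by (auto simp: E_def \<eta>_def)
  have gB: "- g x \<le> 0" for x
    using nonneg by simp
  have lower: "avg E g x \<ge> \<eta>" for x
  proof -
    obtain d where d: "d \<in> set D" "x - d \<in> U"
      using D(2) by blast
    have "x0 - d \<in> set E" "- g (x + (x0 - d)) \<le> 0 - g x0 / 2"
      using d by (auto simp: E_def U_def algebra_simps)
    from avg_mono_bounds(2)[of E "\<lambda>x. - g x", OF E(1) gB this]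
    show ?thesis
      using avg_linear[of uminus E g x] by (simp add: \<eta>_def linear_uminus module_hom_uminus)
  qed
  have upper: "avg E g x \<le> B" for x
    by (rule avg_mono_bounds(1)[OF E(1)]) (use B(2) abs_le_D1 in auto)
  have avg_f: "avg E ?f x = of_real (avg E g x)" for x
    using avg_linear[of complex_of_real E g x] bounded_linear.linear[OF bounded_linear_of_real] by blast
  have "norm (avg E ?f x - of_real B) \<le> B - \<eta>" for x
  proof -
    have "norm (avg E ?f x - of_real B) = \<bar>avg E g x - B\<bar>"
      unfolding avg_f by (metis norm_of_real of_real_diff)
    then show ?thesis
      using lower[of x] upper[of x] by simp
  qed
  \<comment> \<open>Averaging over \<open>E\<close> leaves the mean unchanged, so the bound for the
    averaged function passes to the mean of \<open>g\<close>.\<close>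
  moreover have "is_mean (avg E ?f) (mean ?f)"
    unfolding is_mean_def
  proof (intro allI impI)
    fix e :: real assume "e > 0"
    then obtain xs where xs: "xs \<noteq> []" "\<And>x. norm (avg xs ?f x - mean ?f) \<le> e"
      using is_mean_mean[OF cpt f] unfolding is_mean_def by blast
    have "norm (avg xs (avg E ?f) x - mean ?f) \<le> e" for x
      unfolding avg_commute[of xs E] by (rule norm_avg_const_le[OF E(1) xs(2)])
    with xs(1) show "\<exists>xs. xs \<noteq> [] \<and> (\<forall>x. norm (avg xs (avg E ?f) x - mean ?f) \<le> e)"
      by blast
  qed
  ultimately have "norm (mean ?f - of_real B) \<le> B - \<eta>"
    using norm_is_mean_le by blast
  then show "Re (mean ?f) > 0"
    using Re E(2) by simp
qed

end

lemma continuous_on_fst_snd_sections: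
  assumes "continuous_on UNIV (K :: 'a::topological_space \<times> 'b::topological_space \<Rightarrow> 'c::topological_space)"
  shows "continuous_on UNIV (\<lambda>y. K (x, y))" "continuous_on UNIV (\<lambda>x. K (x, y))"
  by (intro continuous_on_compose2[OF assms] continuous_intros; simp)+

text \<open>In an average over the product group, the inner mean absorbs all shifts of the second
  coordinate. What remains is an average over the first coordinates, hence a mean on the product is
  also the mean of the partial means.\<close>

lemma Fubini_mean_aux:
  fixes K :: "'a::topological_ab_group_add \<times> 'a \<Rightarrow> complex"
  assumes cpt: "compact (UNIV :: 'a set)" and K: "continuous_on UNIV K"
  shows "continuous_on UNIV (\<lambda>x. mean (\<lambda>y. K (x, y)))"
    "is_mean K c \<Longrightarrow> is_mean (\<lambda>x. mean (\<lambda>y. K (x, y))) c"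
proof -
  note sec = continuous_on_fst_snd_sections(1)[OF K]
  have cpt2: "compact (UNIV :: ('a \<times> 'a) set)"
    using compact_Times[OF cpt cpt] by simp
  show "continuous_on UNIV (\<lambda>x. mean (\<lambda>y. K (x, y)))"
  proof (rule continuous_on_if_uniform)
    fix e :: real assume "e > 0"
    then obtain W where W: "open W" "0 \<in> W" "\<And>p d. d \<in> W \<Longrightarrow> dist (K (p + d)) (K p) < e"
      by (rule uniformly_continuous_on_compact_group[OF cpt2 K]) blast
    have "open ((\<lambda>d. (d, 0)) -` W)"
      by (intro open_vimage[OF W(1)] continuous_intros)
    moreover have "0 \<in> (\<lambda>d. (d, 0)) -` W"
      using W(2) by (simp add: zero_prod_def)
    moreover have "dist (mean (\<lambda>y. K (x + d, y))) (mean (\<lambda>y. K (x, y))) \<le> e"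
      if "d \<in> (\<lambda>d. (d, 0)) -` W" for x d
    proof -
      have "norm (mean (\<lambda>y. K (x + d, y) - K (x, y))) \<le> e"
      proof (rule norm_mean_le[OF cpt])
        show "continuous_on UNIV (\<lambda>y. K (x + d, y) - K (x, y))"
          by (intro continuous_intros sec)
        show "norm (K (x + d, y) - K (x, y)) \<le> e" for y
          using W(3)[of "(d, 0)" "(x, y)"] that by (simp add: dist_norm less_imp_le)
      qed
      then show ?thesis
        by (simp add: mean_diff[OF cpt sec sec] dist_norm)
    qed
    ultimately show "\<exists>U. open U \<and> 0 \<in> U \<and>
        (\<forall>x. \<forall>d\<in>U. dist (mean (\<lambda>y. K (x + d, y))) (mean (\<lambda>y. K (x, y))) \<le> e)"
      by blast
  qed
  assume c: "is_mean K c"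
  show "is_mean (\<lambda>x. mean (\<lambda>y. K (x, y))) c"
    unfolding is_mean_def
  proof (intro allI impI)
    fix e :: real assume "e > 0"
    then obtain zs where zs: "zs \<noteq> []" "\<And>p. norm (avg zs K p - c) \<le> e"
      using c unfolding is_mean_def by blast
    have sum: "continuous_on UNIV (\<lambda>y. \<Sum>z\<leftarrow>ws. K ((x, y) + z)) \<and>
        (\<Sum>a\<leftarrow>map fst ws. mean (\<lambda>y. K (x + a, y))) = mean (\<lambda>y. \<Sum>z\<leftarrow>ws. K ((x, y) + z))" for x ws
    proof (induction ws)
      case Nil
      then show ?case by (simp add: mean_const[OF cpt])
    next
      case (Cons w ws)
      have c1: "continuous_on UNIV (\<lambda>y. K ((x, y) + w))"
        using continuous_translation(1)[OF sec[of "x + fst w"], of "snd w"] by (cases w) simp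
      have "mean (\<lambda>y. K (x + fst w, y)) = mean (\<lambda>y. K ((x, y) + w))"
        using mean_shift[OF cpt sec[of "x + fst w"], of "snd w"] by (cases w) simp
      with c1 Cons show ?case
        by (simp add: mean_add[OF cpt c1] continuous_on_add)
    qed
    have "norm (avg (map fst zs) (\<lambda>x. mean (\<lambda>y. K (x, y))) x - c) \<le> e" for x
    proof -
      have c2: "continuous_on UNIV (\<lambda>y. avg zs K (x, y))"
        using sum[of x zs] by (simp add: avg_def continuous_on_scaleR)
      have "avg (map fst zs) (\<lambda>x. mean (\<lambda>y. K (x, y))) x
          = mean (\<lambda>y. \<Sum>z\<leftarrow>zs. K ((x, y) + z)) /\<^sub>R real (length zs)"
        unfolding avg_def using sum[of x zs] by (simp only: length_map)
      also have "\<dots> = mean (\<lambda>y. avg zs K (x, y))"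
        unfolding avg_def by (rule mean_linear[OF cpt _ bounded_linear_scaleR_right, symmetric])
          (use sum[of x zs] in blast)
      finally show ?thesis
        using norm_mean_diff_le[OF cpt c2 zs(2)] by simp
    qed
    with zs(1) show "\<exists>xs. xs \<noteq> [] \<and> (\<forall>x. norm (avg xs (\<lambda>x. mean (\<lambda>y. K (x, y))) x - c) \<le> e)"
      by (intro exI[of _ "map fst zs"]) simp
  qed
qed

text \<open>Both iterated means are invariant on the product group, so they agree with its mean.\<close>

lemma Fubini_mean:
  fixes K :: "'a::topological_ab_group_add \<times> 'a \<Rightarrow> complex"
  assumes cpt: "compact (UNIV :: 'a set)" and K: "continuous_on UNIV K"
  shows "mean (\<lambda>x. mean (\<lambda>y. K (x, y))) = mean (\<lambda>y. mean (\<lambda>x. K (x, y)))"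
proof -
  have cpt2: "compact (UNIV :: ('a \<times> 'a) set)"
    using compact_Times[OF cpt cpt] by simp
  have K': "continuous_on UNIV (\<lambda>p. K (snd p, fst p))"
    by (intro continuous_on_compose2[OF K] continuous_intros) simp
  have m: "is_mean K (mean K)"
    by (rule is_mean_mean[OF cpt2 K])
  have "is_mean (\<lambda>p. K (snd p, fst p)) (mean K)"
    unfolding is_mean_def
  proof (intro allI impI)
    fix e :: real assume "e > 0"
    then obtain zs where zs: "zs \<noteq> []" "\<And>p. norm (avg zs K p - mean K) \<le> e"
      using m unfolding is_mean_def by blast
    have "avg (map prod.swap zs) (\<lambda>p. K (snd p, fst p)) p = avg zs K (snd p, fst p)" for p
      by (simp add: avg_def comp_def plus_prod_def)
    with zs show "\<exists>xs. xs \<noteq> [] \<and> (\<forall>x. norm (avg xs (\<lambda>p. K (snd p, fst p)) x - mean K) \<le> e)"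
      by (intro exI[of _ "map prod.swap zs"]) simp
  qed
  from Fubini_mean_aux(2)[OF cpt K' this] Fubini_mean_aux(2)[OF cpt K m] show ?thesis
    by (simp add: mean_eqI)
qed

section \<open>Eigenfunctions of convolution operators\<close>

lemma continuous_on_diff_compose:
  fixes f :: "'a::topological_ab_group_add \<Rightarrow> 'b::topological_space"
  assumes "continuous_on UNIV f"
  shows "continuous_on UNIV (\<lambda>p. f (fst p - snd p))" "continuous_on UNIV (\<lambda>p. f (snd p + fst p))"
proof -
  have "continuous_on UNIV (\<lambda>p::'a\<times>'a. fst p + - snd p)" "continuous_on UNIV (\<lambda>p::'a\<times>'a. snd p + fst p)"
    unfolding continuous_on_def by (intro ballI tendsto_intros tendsto_fst tendsto_snd)+
  from continuous_on_compose2[OF assms this(1)] continuous_on_compose2[OF assms this(2)]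
  show "continuous_on UNIV (\<lambda>p. f (fst p - snd p))" "continuous_on UNIV (\<lambda>p. f (snd p + fst p))"
    by simp_all
qed

lemma le_if_le_add_divide_Suc:
  fixes a b :: real
  assumes "\<And>n::nat. a \<le> b + c / Suc n"
  shows "a \<le> b"
proof (rule tendsto_lowerbound[OF _ always_eventually])
  have "(\<lambda>n. b + c * (1 / Suc n)) \<longlonglongrightarrow> b + c * 0"
    by (intro tendsto_intros LIMSEQ_Suc[OF lim_1_over_n])
  then show "(\<lambda>n. b + c / Suc n) \<longlonglongrightarrow> b"
    by simp
qed (use assms in auto)

lemma
  fixes h k :: "'a::topological_space \<Rightarrow> complex"
  assumes "continuous_on UNIV h" "continuous_on UNIV k"
  shows cont_ip: "continuous_on UNIV (\<lambda>x. h x * cnj (k x))"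
    and cont_lincomb: "continuous_on UNIV (\<lambda>x. h x + t * k x)"
  by (intro continuous_intros assms)+

lemma cont_scale:
  fixes k :: "'a::topological_space \<Rightarrow> complex"
  assumes "continuous_on UNIV k"
  shows "continuous_on UNIV (\<lambda>x. t * k x)"
  by (intro continuous_intros assms)

lemma cont_reflect_cnj:
  fixes f :: "'a::topological_ab_group_add \<Rightarrow> complex"
  assumes "continuous_on UNIV f"
  shows "continuous_on UNIV (\<lambda>y. cnj (f (x - y)))"
  by (intro continuous_on_cnj continuous_translation(4) assms)

lemma conv_integrand_cont:
  fixes f h :: "'a::topological_ab_group_add \<Rightarrow> complex"
  assumes "continuous_on UNIV f" "continuous_on UNIV h"
  shows "continuous_on UNIV (\<lambda>y. f (x - y) * h y)"
  by (intro continuous_on_mult continuous_translation(4) assms)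

lemma conv_eq_ip: "conv f h x = ip h (\<lambda>y. cnj (f (x - y)))"
  by (simp add: conv_def ip_def mult.commute)

context
  assumes cpt: "compact (UNIV :: 'a::topological_ab_group_add set)"
begin

abbreviation (input) "cont (f :: 'a \<Rightarrow> complex) \<equiv> continuous_on UNIV f"

lemma ip_cnj: 
  assumes "cont h" "cont k"
  shows "ip k h = cnj (ip h k)"
  using mean_cnj[OF cpt cont_ip[OF assms]] by (simp add: ip_def mult.commute)

lemma ip_add_left:
  assumes "cont h" "cont h'" "cont k"
  shows "ip (\<lambda>x. h x + t * h' x) k = ip h k + t * ip h' k"
proof -
  have "ip (\<lambda>x. h x + t * h' x) k = mean (\<lambda>x. h x * cnj (k x) + t * (h' x * cnj (k x)))"
    by (simp add: ip_def algebra_simps)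
  also have "\<dots> = ip h k + t * ip h' k"
    using mean_add[OF cpt cont_ip[OF assms(1,3)] continuous_on_mult_left[OF cont_ip[OF assms(2,3)]]]
      mean_mult_left[OF cpt cont_ip[OF assms(2,3)]] by (simp add: ip_def)
  finally show ?thesis .
qed

lemma ip_add_right:
  assumes "cont h" "cont h'" "cont k"
  shows "ip k (\<lambda>x. h x + t * h' x) = ip k h + cnj t * ip k h'"
  using ip_cnj[OF cont_lincomb[OF assms(1,2)] assms(3)] ip_add_left[OF assms]
    ip_cnj[OF assms(1,3)] ip_cnj[OF assms(2,3)] by simp

lemma ip_scale_left:
  assumes "cont h" "cont k"
  shows "ip (\<lambda>x. t * h x) k = t * ip h k"
  using mean_mult_left[OF cpt cont_ip[OF assms]] by (simp add: ip_def mult.assoc)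

lemma ip_scale_right:
  assumes "cont h" "cont k"
  shows "ip k (\<lambda>x. t * h x) = cnj t * ip k h"
  using ip_cnj[OF cont_scale[OF assms(1)] assms(2)] ip_scale_left[OF assms] ip_cnj[OF assms] by simp

lemma ip_self:
  assumes "cont h"
  shows "ip h h = of_real (nsq h)" "nsq h \<ge> 0" "nsq h = 0 \<Longrightarrow> h x = 0"
proof -
  have g: "continuous_on UNIV (\<lambda>x. (norm (h x))\<^sup>2)"
    using assms by (intro continuous_intros)
  have eq: "ip h h = mean (\<lambda>x. complex_of_real ((norm (h x))\<^sup>2))"
    by (simp add: ip_def complex_norm_square del: of_real_power)
  show "ip h h = of_real (nsq h)" "nsq h \<ge> 0"
    using mean_nonneg(1,2)[OF cpt g] by (simp_all add: nsq_def eq del: of_real_power)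
  show "nsq h = 0 \<Longrightarrow> h x = 0"
    using mean_nonneg(3)[OF cpt g, of x] by (force simp: nsq_def eq simp del: of_real_power)
qed

lemma nsq_add:
  assumes "cont h" "cont k"
  shows "nsq (\<lambda>x. h x + t * k x) = nsq h + 2 * Re (t * ip k h) + (norm t)\<^sup>2 * nsq k"
proof -
  have "ip (\<lambda>x. h x + t * k x) (\<lambda>x. h x + t * k x)
      = ip h h + cnj t * ip h k + t * (ip k h + cnj t * ip k k)"
    by (simp add: ip_add_left ip_add_right assms cont_lincomb)
  also have "\<dots> = ip h h + cnj (t * ip k h) + t * ip k h + of_real ((norm t)\<^sup>2) * ip k k"
    using ip_cnj[OF assms(2,1)] by (simp add: complex_norm_square algebra_simps del: of_real_power)
  finally show ?thesis
    by (simp add: nsq_def)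
qed

lemma nsq_scale:
  assumes "cont h"
  shows "nsq (\<lambda>x. t * h x) = (norm t)\<^sup>2 * nsq h"
proof -
  have "ip (\<lambda>x. t * h x) (\<lambda>x. t * h x) = of_real ((norm t)\<^sup>2) * ip h h"
    by (simp add: ip_scale_left ip_scale_right assms cont_scale complex_norm_square del: of_real_power)
  then show ?thesis
    by (simp add: nsq_def)
qed

lemma ip_Cauchy_Schwarz:
  assumes "cont h" "cont k"
  shows "norm (ip h k) \<le> sqrt (nsq h) * sqrt (nsq k)"
proof -
  have "0 \<le> nsq k + 2 * Re (t * ip h k) + (norm t)\<^sup>2 * nsq h" for t
    using nsq_add[OF assms(2,1), of t] ip_self(2)[OF cont_lincomb[OF assms(2,1)], of t] by simp
  then have "(norm (ip h k))\<^sup>2 \<le> nsq k * nsq h"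
    by (rule quadratic_nonneg_discriminant)
  then show ?thesis
    by (metis mult.commute real_le_rsqrt real_sqrt_mult)
qed

lemma nsq_le:
  assumes "cont h" "\<And>x. norm (h x) \<le> e"
  shows "nsq h \<le> e\<^sup>2"
proof -
  have "norm (ip h h) \<le> e\<^sup>2"
    unfolding ip_def
  proof (rule norm_mean_le[OF cpt cont_ip[OF assms(1,1)]])
    show "norm (h x * cnj (h x)) \<le> e\<^sup>2" for x
      using assms(2)[of x] by (simp add: norm_mult power2_eq_square mult_mono')
  qed
  then show ?thesis
    unfolding nsq_def by (meson abs_Re_le_cmod abs_le_D1 order_trans)
qed

lemma ip_shift:
  assumes "cont h" "cont k"
  shows "ip (\<lambda>x. h (x + z)) (\<lambda>x. k (x + z)) = ip h k"
  using mean_shift[OF cpt cont_ip[OF assms]] by (simp add: ip_def)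

lemma nsq_shift: "cont h \<Longrightarrow> nsq (\<lambda>x. h (x + z)) = nsq h"
  by (simp add: nsq_def ip_shift)

lemma ip_tendsto:
  assumes "\<And>n. cont (h n)" "cont h'" "\<And>n. cont (k n)" "cont k'"
    "uniform_limit UNIV h h' sequentially" "uniform_limit UNIV k k' sequentially"
  shows "(\<lambda>n. ip (h n) (k n)) \<longlonglongrightarrow> ip h' k'"
  unfolding ip_def
proof (rule mean_tendsto[OF cpt])
  have b: "bounded (g ` UNIV)" if "cont g" for g
    using compact_continuous_image[OF that cpt] by (rule compact_imp_bounded)
  have "uniform_limit UNIV (\<lambda>n x. cnj (k n x)) (\<lambda>x. cnj (k' x)) sequentially"
    by (rule bounded_linear.uniform_limit[OF bounded_linear_cnj assms(6)])
  then show "uniform_limit UNIV (\<lambda>n x. h n x * cnj (k n x)) (\<lambda>x. h' x * cnj (k' x)) sequentially"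
    by (rule uniform_lim_mult[OF assms(5)])
      (use b[OF assms(2)] b[of "\<lambda>x. cnj (k' x)"] assms(4) in \<open>auto intro: continuous_intros\<close>)
qed (use assms cont_ip in auto)

lemma nsq_tendsto:
  assumes "\<And>n. cont (h n)" "cont h'" "uniform_limit UNIV h h' sequentially"
  shows "(\<lambda>n. nsq (h n)) \<longlonglongrightarrow> nsq h'"
  unfolding nsq_def by (intro tendsto_Re ip_tendsto assms)

lemma cont_conv:
  assumes "cont f" "cont h"
  shows "cont (conv f h)"
proof -
  have "continuous_on UNIV (\<lambda>p. f (fst p - snd p) * h (snd p))"
    by (intro continuous_on_mult continuous_on_diff_compose[OF assms(1)]
        continuous_on_compose2[OF assms(2)] continuous_intros) simp
  from Fubini_mean_aux(1)[OF cpt this] show ?thesis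
    unfolding conv_def by simp
qed

text \<open>Mean-square norm on the right, uniform norm on the left: this gain is the source of the
  compactness of convolution.\<close>

lemma norm_conv_le:
  assumes "cont f" "cont h" "\<And>x. norm (f x) \<le> B"
  shows "norm (conv f h x) \<le> B * sqrt (nsq h)"
proof -
  have "norm (conv f h x) \<le> sqrt (nsq h) * sqrt (nsq (\<lambda>y. cnj (f (x - y))))"
    unfolding conv_eq_ip by (rule ip_Cauchy_Schwarz[OF assms(2) cont_reflect_cnj[OF assms(1)]])
  also have "\<dots> \<le> sqrt (nsq h) * sqrt (B\<^sup>2)"
    by (intro mult_left_mono real_sqrt_le_mono nsq_le cont_reflect_cnj assms) 
      (simp_all add: assms ip_self(2))
  also have "sqrt (B\<^sup>2) = B"
    using order_trans[OF norm_ge_zero assms(3)] by simp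
  finally show ?thesis
    by (simp add: mult.commute)
qed

lemma conv_lincomb:
  assumes "cont f" "cont h" "cont k"
  shows "conv f (\<lambda>x. h x + t * k x) x = conv f h x + t * conv f k x"
  unfolding conv_eq_ip by (rule ip_add_left[OF assms(2,3) cont_reflect_cnj[OF assms(1)]])

lemma conv_scale:
  assumes "cont f" "cont h"
  shows "conv f (\<lambda>x. t * h x) x = t * conv f h x"
  unfolding conv_eq_ip by (rule ip_scale_left[OF assms(2) cont_reflect_cnj[OF assms(1)]])

lemma conv_diff:
  assumes "cont f" "cont h"
  shows "conv f h (x + d) - conv f h x = conv (\<lambda>z. f (z + d) - f z) h x"
proof -
  have "conv (\<lambda>z. f (z + d) - f z) h x = mean (\<lambda>y. f ((x + d) - y) * h y - f (x - y) * h y)"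
    by (simp add: conv_def algebra_simps)
  also have "\<dots> = conv f h (x + d) - conv f h x"
    unfolding conv_def
    by (rule mean_diff[OF cpt conv_integrand_cont[OF assms] conv_integrand_cont[OF assms]])
  finally show ?thesis ..
qed

lemma conv_shift:
  assumes "cont f" "cont h"
  shows "conv f (\<lambda>y. h (y + z)) x = conv f h (x + z)"
  using mean_shift[OF cpt conv_integrand_cont[OF assms], of "x + z" z]
  by (simp add: conv_def algebra_simps)

text \<open>The neighbourhood comes from the uniform continuity of \<open>f\<close> and serves all
  \<open>h\<close> in the mean-square unit ball, because a difference of values of
  \<open>conv f h\<close> is a convolution with a small kernel.\<close>

lemma conv_equicontinuous:
  assumes f: "cont f" and e: "e > 0"
  obtains U where "open U" "0 \<in> U"
    "\<And>h x d. cont h \<Longrightarrow> nsq h \<le> 1 \<Longrightarrow> d \<in> U \<Longrightarrow> dist (conv f h (x + d)) (conv f h x) \<le> e"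
proof -
  obtain U where U: "open U" "0 \<in> U" "\<And>x d. d \<in> U \<Longrightarrow> dist (f (x + d)) (f x) < e"
    by (rule uniformly_continuous_on_compact_group[OF cpt f e]) blast
  have "dist (conv f h (x + d)) (conv f h x) \<le> e" if h: "cont h" "nsq h \<le> 1" and "d \<in> U" for h x d
  proof -
    have "norm (conv (\<lambda>z. f (z + d) - f z) h x) \<le> e * sqrt (nsq h)"
    proof (rule norm_conv_le[OF _ h(1)])
      show "cont (\<lambda>z. f (z + d) - f z)"
        by (intro continuous_on_diff continuous_translation(1) f)
      show "norm (f (z + d) - f z) \<le> e" for z
        using U(3)[OF \<open>d \<in> U\<close>, of z] by (simp add: dist_norm)
    qed
    also have "\<dots> \<le> e * 1"
      using h(2) e by (intro mult_left_mono) auto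
    finally show ?thesis
      by (simp add: dist_norm conv_diff[OF f h(1)])
  qed
  with U(1,2) show ?thesis
    using that by blast
qed

text \<open>The symmetry of \<open>f\<close> makes the kernel \<open>f (x - y)\<close> Hermitian;
  exchanging the two means does the rest.\<close>

lemma conv_selfadjoint:
  assumes f: "cont f" "\<And>x. f (- x) = cnj (f x)" and h: "cont h" and k: "cont k"
  shows "ip (conv f h) k = ip h (conv f k)"
proof -
  define K where "K = (\<lambda>p. f (fst p - snd p) * h (snd p) * cnj (k (fst p)))"
  have "continuous_on UNIV K"
    unfolding K_def
    by (intro continuous_on_mult continuous_on_diff_compose[OF f(1)]
        continuous_on_compose2[OF h] continuous_on_compose2[OF continuous_on_cnj[OF k]] continuous_intros) simp_all
  note Fub = Fubini_mean[OF cpt this]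
  have "conv f h x * cnj (k x) = mean (\<lambda>y. K (x, y))" for x
    using mean_mult_left[OF cpt conv_integrand_cont[OF f(1) h], of "cnj (k x)" x]
    by (simp add: K_def conv_def mult_ac)
  moreover have "h y * cnj (conv f k y) = mean (\<lambda>x. K (x, y))" for y
  proof -
    have "cnj (f (y - x)) = f (x - y)" for x
      using f(2)[of "y - x"] by simp
    moreover have "mean (\<lambda>x. cnj (f (y - x) * k x)) = cnj (conv f k y)"
      unfolding conv_def by (rule mean_cnj[OF cpt conv_integrand_cont[OF f(1) k]])
    moreover have "mean (\<lambda>x. h y * cnj (f (y - x) * k x)) = h y * mean (\<lambda>x. cnj (f (y - x) * k x))"
      by (rule mean_mult_left[OF cpt continuous_on_cnj[OF conv_integrand_cont[OF f(1) k]]])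
    ultimately show ?thesis
      by (simp add: K_def mult_ac)
  qed
  ultimately show ?thesis
    unfolding ip_def using Fub by simp
qed

lemma conv_Arzela_Ascoli:
  fixes h :: "nat \<Rightarrow> 'a \<Rightarrow> complex"
  assumes f: "cont f" and h: "\<And>n. cont (h n)" "\<And>n. nsq (h n) \<le> 1"
  obtains r q where "strict_mono r" "cont q" "uniform_limit UNIV (\<lambda>n. conv f (h (r n))) q sequentially"
proof -
  obtain B where B: "B > 0" "\<And>x. norm (f x) \<le> B"
    by (rule bounded_range_compact_group[OF cpt f]) blast
  have b: "norm (conv f (h n) x) \<le> B" for n x
  proof -
    have "B * sqrt (nsq (h n)) \<le> B * 1"
      using h(2) B(1) by (intro mult_left_mono) auto
    then show ?thesis
      using norm_conv_le[OF f h(1) B(2), of n x] by simp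
  qed
  have equi: "\<exists>U. open U \<and> 0 \<in> U \<and> (\<forall>n x. \<forall>d\<in>U. dist (conv f (h n) (x + d)) (conv f (h n) x) \<le> e)"
    if "e > 0" for e
    by (rule conv_equicontinuous[OF f that]) (use h in blast)
  show ?thesis
    by (rule Arzela_Ascoli_compact_group[OF cpt, of "\<lambda>n. conv f (h n)" B, OF b equi]) (use that in blast)+
qed

lemma Re_conv_form_add:
  assumes f: "cont f" "\<And>x. f (- x) = cnj (f x)" and h: "cont h" and k: "cont k"
  shows "Re (ip (conv f (\<lambda>x. h x + t * k x)) (\<lambda>x. h x + t * k x))
    = Re (ip (conv f h) h) + 2 * Re (t * ip (conv f k) h) + (norm t)\<^sup>2 * Re (ip (conv f k) k)"
proof -
  note cc = cont_conv[OF f(1)]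
  have 1: "conv f (\<lambda>x. h x + t * k x) = (\<lambda>x. conv f h x + t * conv f k x)"
    using conv_lincomb[OF f(1) h k] by blast
  have "ip (conv f h) k = cnj (ip (conv f k) h)"
    using conv_selfadjoint[OF f h k] ip_cnj[OF cc[OF k] h] by simp
  then have "ip (conv f (\<lambda>x. h x + t * k x)) (\<lambda>x. h x + t * k x)
      = ip (conv f h) h + cnj (t * ip (conv f k) h) + t * ip (conv f k) h
        + of_real ((norm t)\<^sup>2) * ip (conv f k) k"
    unfolding 1
    by (simp add: ip_add_left ip_add_right cc h k cont_lincomb complex_norm_square algebra_simps
        del: of_real_power)
  then show ?thesis
    by simp
qed

text \<open>A maximising sequence for the Rayleigh quotient: applying the Cauchy--Schwarz inequality to the
  semidefinite form \<open>l \<langle>h, k\<rangle> - \<langle>f * h, k\<rangle>\<close> shows that its image under convolution with \<open>f\<close>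
  converges to an eigenfunction.\<close>

lemma ex_eigenfunction_pos:
  assumes f: "cont f" "\<And>x. f (- x) = cnj (f x)"
    and h0: "cont h0" "Re (ip (conv f h0) h0) > 0"
  obtains l q where "l \<noteq> 0" "cont q" "nsq q \<noteq> 0" "conv f q = (\<lambda>x. l * q x)"
proof -
  define R where "R h = Re (ip (conv f h) h)" for h
  note cc = cont_conv[OF f(1)]
  obtain B where B: "B > 0" "\<And>x. norm (f x) \<le> B"
    by (rule bounded_range_compact_group[OF cpt f(1)]) blast
  have RB: "R h \<le> B * nsq h" if "cont h" for h
  proof -
    have "nsq (conv f h) \<le> (B * sqrt (nsq h))\<^sup>2"
      by (rule nsq_le[OF cc[OF that] norm_conv_le[OF f(1) that B(2)]])
    then have "sqrt (nsq (conv f h)) \<le> B * sqrt (nsq h)"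
      using B(1) ip_self(2)[OF that] by (simp add: real_le_lsqrt)
    then have "sqrt (nsq (conv f h)) * sqrt (nsq h) \<le> B * sqrt (nsq h) * sqrt (nsq h)"
      using ip_self(2)[OF that] by (intro mult_right_mono) auto
    moreover have "R h \<le> norm (ip (conv f h) h)"
      unfolding R_def by (rule complex_Re_le_cmod)
    ultimately show ?thesis
      using ip_Cauchy_Schwarz[OF cc[OF that] that] ip_self(2)[OF that] by (simp add: mult.assoc)
  qed
  have R_scale: "R (\<lambda>x. t * h x) = (norm t)\<^sup>2 * R h" if "cont h" for h t
  proof -
    have "conv f (\<lambda>x. t * h x) = (\<lambda>x. t * conv f h x)"
      using conv_scale[OF f(1) that] by blast
    then have "ip (conv f (\<lambda>x. t * h x)) (\<lambda>x. t * h x) = of_real ((norm t)\<^sup>2) * ip (conv f h) h"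
      by (simp add: ip_scale_left ip_scale_right cc that cont_scale complex_norm_square del: of_real_power)
    then show ?thesis
      by (simp add: R_def)
  qed
  have R_add: "R (\<lambda>x. h x + t * k x) = R h + 2 * Re (t * ip (conv f k) h) + (norm t)\<^sup>2 * R k"
    if "cont h" "cont k" for h k t
    unfolding R_def by (rule Re_conv_form_add[OF f that])
  define S where "S = {R h | h. cont h \<and> nsq h = 1}"
  define l where "l = Sup S"
  have bdd: "bdd_above S"
    unfolding S_def by (rule bdd_aboveI[of _ B]) (use RB in fastforce)
  have norm1: "nsq (\<lambda>x. complex_of_real (1 / sqrt (nsq h)) * h x) = 1"
    "R (\<lambda>x. complex_of_real (1 / sqrt (nsq h)) * h x) = R h / nsq h"
    if "cont h" "nsq h > 0" for h :: "'a \<Rightarrow> complex"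
    unfolding nsq_scale[OF that(1)] R_scale[OF that(1)] norm_of_real
    using that(2) by (simp_all add: power_divide)
  have RS: "R h / nsq h \<in> S" if "cont h" "nsq h > 0" for h
    unfolding S_def mem_Collect_eq using norm1[OF that] cont_scale[OF that(1)]
    by (intro exI[of _ "\<lambda>x. complex_of_real (1 / sqrt (nsq h)) * h x"]) (simp only:)
  have Rl: "R h \<le> l * nsq h" if "cont h" for h
  proof (cases "nsq h > 0")
    case True
    from RS[OF that True] have "R h / nsq h \<le> l"
      unfolding l_def using bdd by (rule cSup_upper)
    then show ?thesis
      using True by (simp add: field_simps)
  next
    case False
    then have "nsq h = 0"
      using ip_self(2)[OF that] by simp
    then show ?thesis
      using RB[OF that] by simp
  qed
  have "nsq h0 > 0"
  proof -
    have "0 < B * nsq h0"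
      using RB[OF h0(1)] h0(2) unfolding R_def by linarith
    then show ?thesis
      using B(1) by (simp add: zero_less_mult_iff)
  qed
  then have S0: "R h0 / nsq h0 \<in> S" "R h0 / nsq h0 > 0"
    using RS[OF h0(1)] h0(2) by (simp_all add: R_def)
  then have "l > 0"
    unfolding l_def using cSup_upper[OF S0(1) bdd] by linarith
  have "\<exists>h. cont h \<and> nsq h = 1 \<and> R h > l - 1 / Suc n" for n
  proof -
    have "l - 1 / Suc n < Sup S"
      unfolding l_def by simp
    then obtain s where "s \<in> S" "s > l - 1 / Suc n"
      using less_cSupD[of S] S0(1) by blast
    then show ?thesis
      unfolding S_def by blast
  qed
  then obtain h where h: "\<And>n. cont (h n)" "\<And>n. nsq (h n) = 1" "\<And>n. R (h n) > l - 1 / Suc n"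
    by metis
  have h1: "\<And>n. nsq (h n) \<le> 1"
    using h(2) by simp
  obtain r q where r: "strict_mono r" and q: "cont q"
    and lim: "uniform_limit UNIV (\<lambda>n. conv f (h (r n))) q sequentially"
    by (rule conv_Arzela_Ascoli[of f h, OF f(1) h(1) h1])
  have R_lim: "(\<lambda>n. R (h (r n))) \<longlonglongrightarrow> l"
  proof (rule LIMSEQ_subseq_LIMSEQ[OF _ r, unfolded comp_def])
    show "(\<lambda>n. R (h n)) \<longlonglongrightarrow> l"
    proof (rule tendsto_sandwich)
      show "(\<lambda>n. l - 1 / Suc n) \<longlonglongrightarrow> l"
        using tendsto_diff[OF tendsto_const[of l] LIMSEQ_Suc[OF lim_1_over_n]] by simp
      show "\<forall>\<^sub>F n in sequentially. l - 1 / Suc n \<le> R (h n)" "\<forall>\<^sub>F n in sequentially. R (h n) \<le> l"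
        using less_imp_le[OF h(3)] Rl[OF h(1)] h(2) by (auto intro!: always_eventually)
    qed simp
  qed
  \<comment> \<open>A weak form of the eigenvalue equation along the maximising sequence. The form
    is semidefinite by \<open>Rl\<close>, and its value at \<open>h (r n)\<close> is
    \<open>l - R (h (r n))\<close>, which tends to 0.\<close>
  have key: "(\<lambda>n. of_real l * ip k (h (r n)) - ip (conv f k) (h (r n))) \<longlonglongrightarrow> 0" if k: "cont k" for k
  proof -
    have "(norm (of_real l * ip k (h n) - ip (conv f k) (h n)))\<^sup>2
        \<le> (l * nsq (h n) - R (h n)) * (l * nsq k - R k)" for n
    proof (rule quadratic_nonneg_discriminant)
      fix t
      show "0 \<le> (l * nsq (h n) - R (h n)) + 2 * Re (t * (of_real l * ip k (h n) - ip (conv f k) (h n)))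
          + (norm t)\<^sup>2 * (l * nsq k - R k)"
        using Rl[OF cont_lincomb[OF h(1)[of n] k], of t] unfolding R_add[OF h(1) k] nsq_add[OF h(1) k]
        by (simp add: algebra_simps)
    qed
    then have bnd: "(norm (of_real l * ip k (h (r n)) - ip (conv f k) (h (r n))))\<^sup>2
        \<le> (l - R (h (r n))) * (l * nsq k - R k)" for n
      using h(2) by (metis mult.right_neutral)
    have "(\<lambda>n. (l - R (h (r n))) * (l * nsq k - R k)) \<longlonglongrightarrow> (l - l) * (l * nsq k - R k)"
      by (intro tendsto_intros R_lim)
    then have lim0: "(\<lambda>n. (l - R (h (r n))) * (l * nsq k - R k)) \<longlonglongrightarrow> 0" by simp
    have "(\<lambda>n. (norm (of_real l * ip k (h (r n)) - ip (conv f k) (h (r n))))\<^sup>2) \<longlonglongrightarrow> 0"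
      by (rule tendsto_sandwich[OF _ _ tendsto_const lim0]) (use bnd in \<open>auto intro!: always_eventually\<close>)
    then have "(\<lambda>n. sqrt ((norm (of_real l * ip k (h (r n)) - ip (conv f k) (h (r n))))\<^sup>2)) \<longlonglongrightarrow> sqrt 0"
      by (rule tendsto_real_sqrt)
    then show ?thesis
      by (simp add: tendsto_norm_zero_iff)
  qed
  have "conv f q x = of_real l * q x" for x
  proof -
    \<comment> \<open>Testing against this \<open>k\<close> is evaluation of the convolution at
      \<open>x\<close>, which turns the weak equation into a pointwise one for the uniform limit
      \<open>q\<close>.\<close>
    define k where "k = (\<lambda>y. cnj (f (x - y)))"
    have k: "cont k"
      unfolding k_def by (rule cont_reflect_cnj[OF f(1)])
    have "(\<lambda>n. cnj (of_real l * ip k (h (r n)) - ip (conv f k) (h (r n)))) \<longlonglongrightarrow> cnj 0"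
      by (intro tendsto_cnj key k)
    moreover have "cnj (of_real l * ip k (h (r n)) - ip (conv f k) (h (r n)))
        = of_real l * conv f (h (r n)) x - ip (conv f (h (r n))) k" for n
      using ip_cnj[OF k h(1)[of "r n"]] ip_cnj[OF cc[OF k] h(1)[of "r n"]]
        conv_selfadjoint[OF f h(1)[of "r n"] k] unfolding conv_eq_ip k_def by simp
    ultimately have "(\<lambda>n. of_real l * conv f (h (r n)) x - ip (conv f (h (r n))) k) \<longlonglongrightarrow> 0"
      by simp
    moreover have "(\<lambda>n. of_real l * conv f (h (r n)) x - ip (conv f (h (r n))) k) \<longlonglongrightarrow> of_real l * q x - ip q k"
      by (intro tendsto_intros tendsto_uniform_limitI[OF lim] ip_tendsto lim q k cc h(1) UNIV_I)
        (simp add: uniform_limit_iff)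
    ultimately have "of_real l * q x - ip q k = 0"
      using LIMSEQ_unique by blast
    then show ?thesis
      by (simp add: conv_eq_ip k_def)
  qed
  \<comment> \<open>The limit cannot vanish: \<open>R\<close> of a unit vector is at most the
    mean-square norm of its convolution, and \<open>R\<close> tends to \<open>l > 0\<close>.\<close>
  moreover have "nsq q \<noteq> 0"
  proof
    assume "nsq q = 0"
    have "(\<lambda>n. sqrt (nsq (conv f (h (r n))))) \<longlonglongrightarrow> sqrt (nsq q)"
      by (intro tendsto_real_sqrt nsq_tendsto lim q cc h(1))
    then have "(\<lambda>n. sqrt (nsq (conv f (h (r n))))) \<longlonglongrightarrow> 0"
      using \<open>nsq q = 0\<close> by simp
    moreover have "R (h (r n)) \<le> sqrt (nsq (conv f (h (r n))))" for n
      using order_trans[OF complex_Re_le_cmod ip_Cauchy_Schwarz[OF cc[OF h(1)[of "r n"]] h(1)[of "r n"]]]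
      by (simp add: R_def h(2))
    ultimately have "l \<le> 0"
      using R_lim by (meson LIMSEQ_le)
    with \<open>l > 0\<close> show False by simp
  qed
  ultimately show ?thesis
    using \<open>l > 0\<close> q by (intro that[of "of_real l" q]) auto
qed

text \<open>A negative value of the form is made positive by passing to \<open>- f\<close>. If the
  form vanishes identically, polarisation kills the operator; then \<open>conv f f 0\<close>, which
  equals \<open>nsq f\<close> by the symmetry of \<open>f\<close>, is 0 although \<open>f\<close> is
  not.\<close>

lemma ex_eigenfunction:
  assumes f: "cont f" "\<And>x. f (- x) = cnj (f x)" and nz: "f x0 \<noteq> 0"
  obtains l q where "l \<noteq> 0" "cont q" "nsq q \<noteq> 0" "conv f q = (\<lambda>x. l * q x)"
proof -
  note cc = cont_conv[OF f(1)]
  consider h where "cont h" "Re (ip (conv f h) h) > 0" | h where "cont h" "Re (ip (conv f h) h) < 0"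
    | "\<And>h. cont h \<Longrightarrow> Re (ip (conv f h) h) = 0"
    by (meson linorder_cases)
  then show ?thesis
  proof cases
    case 1
    then show ?thesis
      using ex_eigenfunction_pos[OF f] that by blast
  next
    case 2
    have neg: "conv (\<lambda>x. - f x) h = (\<lambda>x. - 1 * conv f h x)" if "cont h" for h
      using mean_mult_left[OF cpt conv_integrand_cont[OF f(1) that], of "- 1"] by (auto simp: conv_def)
    have "Re (ip (conv (\<lambda>x. - f x) h) h) > 0"
      unfolding neg[OF 2(1)] ip_scale_left[OF cc[OF 2(1)] 2(1)] using 2(2) by simp
    moreover have "cont (\<lambda>x. - f x)" "- f (- x) = cnj (- f x)" for x
      using f by (auto intro: continuous_intros)
    ultimately obtain l q where "l \<noteq> 0" "cont q" "nsq q \<noteq> 0" "conv (\<lambda>x. - f x) q = (\<lambda>x. l * q x)"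
      using ex_eigenfunction_pos[of "\<lambda>x. - f x" h] 2(1) by metis
    moreover from this have "conv f q = (\<lambda>x. (- l) * q x)"
      using neg[OF \<open>cont q\<close>] by (simp add: fun_eq_iff) (metis minus_minus)
    ultimately show ?thesis
      by (intro that[of "- l" q]) auto
  next
    case 3
    have "ip (conv f k) h = 0" if h: "cont h" and k: "cont k" for h k
    proof -
      have "Re (t * ip (conv f k) h) = 0" for t
        using Re_conv_form_add[OF f h k, of t] 3[OF h] 3[OF k] 3[OF cont_lincomb[OF h k], of t] by simp
      from this[of 1] this[of \<i>] show ?thesis
        by (simp add: complex_eq_iff)
    qed
    from this[OF cc[OF f(1)] f(1)] have "nsq (conv f f) = 0"
      by (simp add: nsq_def)
    then have "conv f f 0 = 0"
      by (rule ip_self(3)[OF cc[OF f(1)]])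
    then have "nsq f = 0"
      by (simp add: conv_def nsq_def ip_def f(2) mult.commute)
    then show ?thesis
      using nz ip_self(3)[OF f(1)] by blast
  qed
qed

section \<open>Autocorrelations of eigenfunctions and their multiplicativity\<close>

lemma autocorr_0: "cont h \<Longrightarrow> autocorr h 0 = of_real (nsq h)"
  using ip_self(1)[of h] by (simp add: autocorr_def)

lemma norm_autocorr_le: "cont h \<Longrightarrow> norm (autocorr h x) \<le> nsq h"
  using ip_Cauchy_Schwarz[OF continuous_translation(1)[of h x], of h] ip_self(2)[of h]
  by (simp add: autocorr_def nsq_shift)

lemma cont_autocorr:
  assumes "cont h"
  shows "cont (autocorr h)"
proof -
  have "continuous_on UNIV (\<lambda>p. h (snd p + fst p) * cnj (h (snd p)))"
    by (intro continuous_on_mult continuous_on_diff_compose[OF assms] continuous_on_cnj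
        continuous_on_compose2[OF assms] continuous_intros) simp
  from Fubini_mean_aux(1)[OF cpt this] show ?thesis
    unfolding autocorr_def ip_def by simp
qed

lemma autocorr_scale:
  assumes "cont h"
  shows "autocorr (\<lambda>y. t * h y) x = of_real ((norm t)\<^sup>2) * autocorr h x"
  unfolding autocorr_def
  by (simp add: ip_scale_left ip_scale_right assms cont_scale continuous_translation(1)
      complex_norm_square del: of_real_power)

lemma ip_shift_shift:
  assumes "cont h"
  shows "ip (\<lambda>y. h (y + x)) (\<lambda>y. h (y + z)) = autocorr h (x - z)"
  using ip_shift[OF continuous_translation(1)[OF assms, of "x - z"] assms, of z]
  by (simp add: autocorr_def algebra_simps)

lemma autocorr_add_shift:
  assumes h: "cont h" and c: "norm c = 1"
  shows "autocorr (\<lambda>y. h y + c * h (y + z)) x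
    = 2 * autocorr h x + c * autocorr h (x + z) + cnj c * autocorr h (x - z)"
proof -
  note s = continuous_translation(1)[OF h]
  have "c * cnj c = 1"
    using c by (simp add: complex_norm_square[symmetric])
  have "autocorr (\<lambda>y. h y + c * h (y + z)) x
      = ip (\<lambda>y. h (y + x) + c * h (y + (x + z))) (\<lambda>y. h y + c * h (y + z))"
    by (simp add: autocorr_def add.assoc)
  also have "\<dots> = ip (\<lambda>y. h (y + x)) h + cnj c * ip (\<lambda>y. h (y + x)) (\<lambda>y. h (y + z))
      + c * (ip (\<lambda>y. h (y + (x + z))) h + cnj c * ip (\<lambda>y. h (y + (x + z))) (\<lambda>y. h (y + z)))"
    by (simp only: ip_add_left[OF s s cont_lincomb[OF h s]] ip_add_right[OF h s s])
  also have "\<dots> = autocorr h x + cnj c * autocorr h (x - z)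
      + (c * autocorr h (x + z) + (c * cnj c) * autocorr h x)"
    unfolding ip_shift_shift[OF h] by (simp add: autocorr_def algebra_simps)
  finally show ?thesis
    using \<open>c * cnj c = 1\<close> by simp
qed

text \<open>Both slots are perturbed by the same small \<open>d\<close>, and Cauchy-Schwarz bounds
  the change uniformly in \<open>x\<close> because shifts preserve \<open>nsq\<close>.\<close>

lemma autocorr_uniform_limit:
  assumes h: "\<And>n::nat. cont (h n)" "\<And>n. nsq (h n) \<le> 1" and q: "cont q" "nsq q \<le> 1"
    and lim: "uniform_limit UNIV h q sequentially"
  shows "uniform_limit UNIV (\<lambda>n. autocorr (h n)) (autocorr q) sequentially"
proof (rule uniform_limitI)
  fix e :: real assume "e > 0"
  then have "\<forall>\<^sub>F n in sequentially. \<forall>x\<in>UNIV. dist (h n x) (q x) < e / 3"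
    by (intro uniform_limitD[OF lim]) simp
  then show "\<forall>\<^sub>F n in sequentially. \<forall>x\<in>UNIV. dist (autocorr (h n) x) (autocorr q x) < e"
  proof (rule eventually_mono, intro ballI)
    fix n x assume *: "\<forall>x\<in>UNIV. dist (h n x) (q x) < e / 3"
    define d where "d = (\<lambda>y. h n y - q y)"
    have d: "cont d"
      unfolding d_def by (intro continuous_intros h q)
    note s = continuous_translation(1)
    have "nsq d \<le> (e / 3)\<^sup>2"
      by (rule nsq_le[OF d]) (use * in \<open>auto simp: d_def dist_norm less_imp_le\<close>)
    then have sd: "sqrt (nsq d) \<le> e / 3"
      using \<open>e > 0\<close> by (intro real_le_lsqrt) auto
    have one: "sqrt (nsq (h n)) \<le> 1" "sqrt (nsq q) \<le> 1"
      using h(2) q(2) by auto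
    have hn: "h n = (\<lambda>y. q y + 1 * d y)"
      by (simp add: d_def)
    have "autocorr (h n) x = ip (\<lambda>y. q (y + x) + 1 * d (y + x)) (h n)"
      unfolding autocorr_def by (simp add: d_def)
    also have "\<dots> = ip (\<lambda>y. q (y + x)) (h n) + ip (\<lambda>y. d (y + x)) (h n)"
      by (subst ip_add_left[OF s[OF q(1)] s[OF d] h(1)]) simp
    also have "ip (\<lambda>y. q (y + x)) (h n) = autocorr q x + ip (\<lambda>y. q (y + x)) d"
      unfolding autocorr_def by (subst hn, subst ip_add_right[OF q(1) d s[OF q(1)]]) simp
    finally have "dist (autocorr (h n) x) (autocorr q x)
        \<le> norm (ip (\<lambda>y. q (y + x)) d) + norm (ip (\<lambda>y. d (y + x)) (h n))"
      by (simp add: dist_norm norm_triangle_ineq)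
    also have "\<dots> \<le> sqrt (nsq q) * sqrt (nsq d) + sqrt (nsq d) * sqrt (nsq (h n))"
      using ip_Cauchy_Schwarz[OF s[OF q(1), of x] d] ip_Cauchy_Schwarz[OF s[OF d, of x] h(1)[of n]]
      by (simp add: nsq_shift q d)
    also have "\<dots> \<le> 1 * (e / 3) + (e / 3) * 1"
      using sd one \<open>e > 0\<close> ip_self(2)[OF d] ip_self(2)[OF q(1)] ip_self(2)[OF h(1)]
      by (intro add_mono mult_mono) auto
    also have "\<dots> < e"
      using \<open>e > 0\<close> by simp
    finally show "dist (autocorr (h n) x) (autocorr q x) < e" .
  qed
qed

text \<open>The set of autocorrelations of unit eigenfunctions \<open>h\<close> is compact, and the autocorrelation of
  \<open>h\<close> is a convex combination of those of \<open>h \<plusminus> c h(\<sqdot> + z)\<close>. By strict convexity of the norm all three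
  are proportional if \<open>h\<close> maximises the norm, which forces multiplicativity.\<close>

lemma ex_multiplicative_autocorr:
  assumes f: "cont f" and l: "l \<noteq> 0" and h0: "cont h0" "nsq h0 \<noteq> 0" "conv f h0 = (\<lambda>x. l * h0 x)"
  obtains h where "cont h" "nsq h = 1" "conv f h = (\<lambda>x. l * h x)"
    "\<And>x z. autocorr h (x + z) = autocorr h x * autocorr h z"
proof -
  define E where "E = {h. cont h \<and> conv f h = (\<lambda>x. l * h x)}"
  have E_lincomb: "(\<lambda>x. h x + t * k x) \<in> E" if "h \<in> E" "k \<in> E" for h k t
    using that conv_lincomb[OF f, of h k t] cont_lincomb[of h k t]
    by (auto simp: E_def fun_eq_iff algebra_simps)
  have E_scale: "(\<lambda>x. t * h x) \<in> E" if "h \<in> E" for h t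
    using that conv_scale[OF f, of h t] cont_scale[of h t] by (auto simp: E_def fun_eq_iff)
  have E_shift: "(\<lambda>x. h (x + z)) \<in> E" if "h \<in> E" for h z
    using that conv_shift[OF f, of h z] continuous_translation(1)[of h z] by (auto simp: E_def fun_eq_iff)
  \<comment> \<open>\<open>N\<close> is homogeneous of degree 4 in \<open>h\<close>, which explains
    the factor \<open>(nsq h)\<^sup>2\<close> in all comparisons below.\<close>
  define N where "N h = nsq (autocorr h)" for h :: "'a \<Rightarrow> complex"
  have cE: "cont h" if "h \<in> E" for h
    using that by (simp add: E_def)
  have unit: "(\<lambda>x. complex_of_real (1 / sqrt (nsq h)) * h x) \<in> E"
    "nsq (\<lambda>x. complex_of_real (1 / sqrt (nsq h)) * h x) = 1"
    "N (\<lambda>x. complex_of_real (1 / sqrt (nsq h)) * h x) = N h / (nsq h)\<^sup>2" if "h \<in> E" "nsq h > 0" for h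
  proof -
    show "(\<lambda>x. complex_of_real (1 / sqrt (nsq h)) * h x) \<in> E"
      by (rule E_scale[OF that(1)])
    show "nsq (\<lambda>x. complex_of_real (1 / sqrt (nsq h)) * h x) = 1"
      unfolding nsq_scale[OF cE[OF that(1)]] norm_of_real using that(2) by (simp add: power_divide)
    have "autocorr (\<lambda>x. complex_of_real (1 / sqrt (nsq h)) * h x) = (\<lambda>x. of_real (1 / nsq h) * autocorr h x)"
      unfolding autocorr_scale[OF cE[OF that(1)]] norm_of_real using that(2)
      by (simp add: power_divide fun_eq_iff autocorr_scale[OF cE[OF that(1)]])
    then show "N (\<lambda>x. complex_of_real (1 / sqrt (nsq h)) * h x) = N h / (nsq h)\<^sup>2"
      unfolding N_def
      by (simp only: nsq_scale[OF cont_autocorr[OF cE[OF that(1)]]] norm_of_real) (simp add: power_divide)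
  qed
  define S where "S = {N h | h. h \<in> E \<and> nsq h = 1}"
  have N_le: "N h \<le> (nsq h)\<^sup>2" if "h \<in> E" for h
    unfolding N_def by (rule nsq_le[OF cont_autocorr[OF cE[OF that]] norm_autocorr_le[OF cE[OF that]]])
  have bdd: "bdd_above S"
    unfolding S_def by (rule bdd_aboveI[of _ 1]) (use N_le in fastforce)
  have h0E: "h0 \<in> E" "nsq h0 > 0"
    using h0 ip_self(2)[OF h0(1)] by (auto simp: E_def)
  have "S \<noteq> {}"
    unfolding S_def using unit(1,2)[OF h0E] by blast
  have "\<exists>h. h \<in> E \<and> nsq h = 1 \<and> N h > Sup S - 1 / Suc n" for n
  proof -
    have "Sup S - 1 / Suc n < Sup S"
      by simp
    then obtain s where "s \<in> S" "s > Sup S - 1 / Suc n"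
      using less_cSupD[OF \<open>S \<noteq> {}\<close>] by blast
    then show ?thesis
      unfolding S_def by blast
  qed
  then obtain g where g: "\<And>n. g n \<in> E" "\<And>n. nsq (g n) = 1" "\<And>n. N (g n) > Sup S - 1 / Suc n"
    by metis
  note gc = cE[OF g(1)]
  have g1: "\<And>n. nsq (g n) \<le> 1"
    using g(2) by simp
  obtain r q where r: "strict_mono r" and q: "cont q"
    and lim: "uniform_limit UNIV (\<lambda>n. conv f (g (r n))) q sequentially"
    by (rule conv_Arzela_Ascoli[OF f gc g1])
  \<comment> \<open>On eigenfunctions convolution is multiplication by \<open>l\<close>, so uniform
    convergence of the convolutions gives uniform convergence of \<open>g (r n)\<close>
    itself.\<close>
  define h where "h x = q x / l" for x
  have h: "cont h"
    unfolding h_def using l by (intro continuous_intros q) auto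
  have lim_h: "uniform_limit UNIV (\<lambda>n. g (r n)) h sequentially"
  proof -
    have "uniform_limit UNIV (\<lambda>n x. (1 / l) * conv f (g (r n)) x) (\<lambda>x. (1 / l) * q x) sequentially"
      by (rule bounded_linear.uniform_limit[OF bounded_linear_mult_right lim])
    moreover have "(1 / l) * conv f (g (r n)) x = g (r n) x" for n x
      using g(1)[of "r n"] l by (simp add: E_def)
    ultimately show ?thesis
      by (simp add: h_def[abs_def])
  qed
  have "(\<lambda>n. nsq (g (r n))) \<longlonglongrightarrow> nsq h"
    by (rule nsq_tendsto[OF gc h lim_h])
  then have nsq_h: "nsq h = 1"
    using LIMSEQ_unique[OF _ tendsto_const[of 1]] by (simp add: g(2))
  have "conv f h x = l * h x" for x
  proof -
    have c: "cont (\<lambda>y. cnj (f (x - y)))"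
      by (rule cont_reflect_cnj[OF f])
    have "(\<lambda>n. conv f (g (r n)) x) \<longlonglongrightarrow> conv f h x"
      unfolding conv_eq_ip
      by (rule ip_tendsto[OF gc h c c lim_h]) (simp add: uniform_limit_iff)
    moreover have "(\<lambda>n. conv f (g (r n)) x) \<longlonglongrightarrow> q x"
      by (rule tendsto_uniform_limitI[OF lim]) simp
    ultimately show ?thesis
      using LIMSEQ_unique l by (simp add: h_def) blast
  qed
  then have hE: "h \<in> E"
    using h by (auto simp: E_def)
  have lim_N: "(\<lambda>n. N (g (r n))) \<longlonglongrightarrow> N h"
    unfolding N_def
    by (rule nsq_tendsto[OF cont_autocorr[OF gc] cont_autocorr[OF h]
          autocorr_uniform_limit[OF gc g1 h _ lim_h]]) (simp add: nsq_h)
  have "(\<lambda>n. Sup S - 1 / Suc (r n)) \<longlonglongrightarrow> Sup S - 0"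
    by (intro tendsto_intros LIMSEQ_subseq_LIMSEQ[OF LIMSEQ_Suc[OF lim_1_over_n] r, unfolded comp_def])
  from LIMSEQ_le[OF this lim_N] have "Sup S \<le> N h"
    using less_imp_le[OF g(3)] by auto
  have max: "N k \<le> (nsq k)\<^sup>2 * N h" if "k \<in> E" for k
  proof (cases "nsq k > 0")
    case True
    have "N k / (nsq k)\<^sup>2 \<in> S"
      unfolding S_def mem_Collect_eq using unit[OF that True]
      by (intro exI[of _ "\<lambda>x. complex_of_real (1 / sqrt (nsq k)) * k x"]) (simp only:)
    then have "N k / (nsq k)\<^sup>2 \<le> N h"
      using cSup_upper[OF _ bdd] \<open>Sup S \<le> N h\<close> by (meson order_trans)
    then show ?thesis
      using True by (simp add: field_simps)
  next
    case False
    then have "nsq k = 0"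
      using ip_self(2)[OF cE[OF that]] by simp
    then show ?thesis
      using N_le[OF that] by simp
  qed
  let ?p = "autocorr h"
  have p0: "?p 0 = 1"
    by (simp add: autocorr_0[OF h] nsq_h)
  have key: "c * ?p (x + z) + cnj c * ?p (x - z) = (c * ?p z + cnj c * ?p (- z)) * ?p x"
    if c: "norm c = 1" for c x z
  proof -
    define a where "a = (\<lambda>y. h y + c * h (y + z))"
    define b where "b = (\<lambda>y. h y + (- c) * h (y + z))"
    have aE: "a \<in> E" "b \<in> E"
      unfolding a_def b_def by (intro E_lincomb E_shift hE)+
    define u v where "u = autocorr a" and "v = autocorr b"
    have uv: "cont u" "cont v"
      unfolding u_def v_def by (intro cont_autocorr cE aE)+
    have u: "u x = 2 * ?p x + c * ?p (x + z) + cnj c * ?p (x - z)" for x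
      unfolding u_def a_def by (rule autocorr_add_shift[OF h c])
    have v: "v x = 2 * ?p x + (- c) * ?p (x + z) + cnj (- c) * ?p (x - z)" for x
      unfolding v_def b_def by (rule autocorr_add_shift[OF h]) (use c in simp)
    \<comment> \<open>The cross terms of \<open>a\<close> and \<open>b\<close> have opposite signs
      and cancel. The factor 1 gives the sum the shape of \<open>nsq_add\<close>.\<close>
    have sum: "u x + 1 * v x = 4 * ?p x" for x
      by (simp add: u v)
    define s t where "s = nsq a" and "t = nsq b"
    have s: "u 0 = of_real s" and t: "v 0 = of_real t"
      unfolding u_def v_def s_def t_def by (intro autocorr_0 cE aE)+
    have "complex_of_real (s + t) = 4"
      using sum[of 0] by (simp add: s t p0)
    then have st: "s + t = 4"
      by (metis of_real_eq_iff of_real_numeral)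
    have s0: "s \<ge> 0" "t \<ge> 0"
      unfolding s_def t_def by (intro ip_self(2) cE aE)+
    have "nsq u \<le> s\<^sup>2 * N h" "nsq v \<le> t\<^sup>2 * N h"
      using max aE by (simp_all add: u_def v_def s_def t_def N_def)
    note le = this
    have "16 * N h = nsq (\<lambda>x. 4 * ?p x)"
      by (subst nsq_scale[OF cont_autocorr[OF h]]) (simp add: N_def)
    also have "\<dots> = nsq u + 2 * Re (ip v u) + nsq v"
      unfolding sum[symmetric] by (subst nsq_add[OF uv]) simp
    finally have eq16: "16 * N h = nsq u + 2 * Re (ip v u) + nsq v" .
    have sq: "s\<^sup>2 + t\<^sup>2 + 2 * (s * t) = 16"
    proof -
      have "(s + t)\<^sup>2 = 16"
        by (simp add: st)
      then show ?thesis
        by (simp add: power2_sum)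
    qed
    \<comment> \<open>Maximality bounds \<open>nsq u\<close> and \<open>nsq v\<close>, while their
      sum with the cross term must reach \<open>(s + t)\<^sup>2 * N h\<close>; the cross term is
      thus as large as possible.\<close>
    have Re: "Re (ip v u) \<ge> s * t * N h"
    proof -
      have "(s\<^sup>2 + t\<^sup>2 + 2 * (s * t)) * N h = nsq u + 2 * Re (ip v u) + nsq v"
        using eq16 by (simp only: sq)
      then show ?thesis
        using le by (simp add: algebra_simps)
    qed
    \<comment> \<open>The equality case of the triangle inequality: \<open>u\<close> and
      \<open>v\<close> are proportional with ratio \<open>s : t\<close>, so \<open>u\<close> is a
      multiple of the autocorrelation of \<open>h\<close>.\<close>
    have "nsq (\<lambda>x. of_real t * u x + (- of_real s) * v x)
        = t\<^sup>2 * nsq u - 2 * (s * t) * Re (ip v u) + s\<^sup>2 * nsq v"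
      unfolding nsq_add[OF cont_scale[OF uv(1)] uv(2)] nsq_scale[OF uv(1)]
        ip_scale_right[OF uv] by simp
    also have "\<dots> \<le> t\<^sup>2 * (s\<^sup>2 * N h) - 2 * (s * t) * (s * t * N h) + s\<^sup>2 * (t\<^sup>2 * N h)"
      using le Re s0 by (intro add_mono diff_mono mult_left_mono) auto
    also have "\<dots> = 0"
      by (simp add: power2_eq_square algebra_simps)
    finally have "nsq (\<lambda>x. of_real t * u x + (- of_real s) * v x) = 0"
      using ip_self(2)[OF cont_lincomb[OF cont_scale[OF uv(1)] uv(2)]] by (meson antisym)
    then have "of_real t * u x + (- of_real s) * v x = 0"
      using ip_self(3)[OF cont_lincomb[OF cont_scale[OF uv(1)] uv(2)]] by blast
    moreover have "v x = 4 * ?p x - u x"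
      using sum[of x] by (simp add: algebra_simps)
    ultimately have "of_real (s + t) * u x = 4 * of_real s * ?p x"
      by (simp add: algebra_simps)
    then have "u x = u 0 * ?p x"
      unfolding st s by simp
    then show ?thesis
      unfolding u[of x] u[of 0] by (simp add: p0 algebra_simps)
  qed
  have "?p (x + z) = ?p x * ?p z" for x z
  proof -
    \<comment> \<open>The phases 1 and \<open>\<i>\<close> give the sum and the difference of the
      values at \<open>x + z\<close> and \<open>x - z\<close>; adding the two equations isolates the
      value at \<open>x + z\<close>.\<close>
    have 1: "?p (x + z) + ?p (x - z) = (?p z + ?p (- z)) * ?p x"
      using key[of 1 x z] by simp
    have "\<i> * (?p (x + z) - ?p (x - z)) = \<i> * ((?p z - ?p (- z)) * ?p x)"
      using key[of \<i> x z] by (simp add: algebra_simps)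
    then have 2: "?p (x + z) - ?p (x - z) = (?p z - ?p (- z)) * ?p x"
      by simp
    have "2 * ?p (x + z) = (?p (x + z) + ?p (x - z)) + (?p (x + z) - ?p (x - z))"
      by simp
    also have "\<dots> = 2 * (?p x * ?p z)"
      unfolding 1 2 by (simp add: algebra_simps)
    finally show ?thesis by simp
  qed
  then show ?thesis
    using that[of h] h nsq_h hE by (simp add: E_def)
qed

end

section \<open>Characters\<close>

text \<open>The standard isomorphism of the circle group with the complex unit circle; it supplies
  the norm in which smallness of characters is measured.\<close>

lift_definition circle_exp :: "circle \<Rightarrow> complex" is "\<lambda>x. cis (2 * pi * x)"
proof -
  fix x y :: real
  assume "x - y \<in> \<int>"
  then have "cis (2 * pi * (x - y)) = 1"
    by (rule cis_multiple_2pi)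
  then have "cis (2 * pi * y) = cis (2 * pi * y) * cis (2 * pi * (x - y))"
    by simp
  also have "\<dots> = cis (2 * pi * x)"
    by (simp add: cis_mult algebra_simps)
  finally show "cis (2 * pi * x) = cis (2 * pi * y)" ..
qed

lemma circle_exp_to_circle: "circle_exp (to_circle x) = cis (2 * pi * x)"
  by (rule circle_exp.abs_eq)

lemma circle_exp_add: "circle_exp (a + b) = circle_exp a * circle_exp b"
  by transfer (simp add: cis_mult algebra_simps)

lemma circle_exp_0: "circle_exp 0 = 1"
  by transfer simp

lemma norm_circle_exp: "norm (circle_exp a) = 1"
  by transfer simp

lemma circle_exp_eq_1_iff: "circle_exp a = 1 \<longleftrightarrow> a = 0"
proof
  assume "circle_exp a = 1"
  obtain x where x: "a = to_circle x"
    by (rule to_circle_cases)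
  with \<open>circle_exp a = 1\<close> obtain n where "2 * pi * x = of_int n * (2 * pi)"
    by (auto simp: circle_exp_to_circle cis_eq_1_iff)
  then have "x = of_int n"
    by simp
  then have "to_circle x = to_circle 0"
    by (simp add: to_circle_eq_iff)
  then show "a = 0"
    by (simp add: x zero_circle_def)
qed (simp add: circle_exp_0)

lemma circle_exp_inject: "circle_exp a = circle_exp b \<longleftrightarrow> a = b"
proof
  assume *: "circle_exp a = circle_exp b"
  have "circle_exp (a - b) * circle_exp b = circle_exp a"
    by (metis circle_exp_add diff_add_cancel)
  then have "circle_exp (a - b) = 1"
    using * norm_circle_exp[of b] by (metis mult_cancel_right1 norm_zero zero_neq_one)
  then show "a = b"
    by (simp add: circle_exp_eq_1_iff)
qed simp

lemma circle_exp_surj: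
  assumes "norm z = 1"
  obtains a where "circle_exp a = z"
proof -
  have "z \<noteq> 0"
    using assms by auto
  then have "cis (2 * pi * (Arg z / (2 * pi))) = z"
    using assms by (simp add: cis_Arg sgn_div_norm)
  with that show ?thesis
    using circle_exp_to_circle by metis
qed

lemma continuous_circle_exp: "continuous_on UNIV circle_exp"
proof -
  have "continuous_on UNIV (\<lambda>x. cis (2 * pi * x))"
    by (intro continuous_intros)
  then have "open (to_circle -` circle_exp -` U)" if "open U" for U
    using open_vimage[OF that] by (simp add: vimage_def circle_exp_to_circle)
  then show ?thesis
    by (simp add: continuous_on_open_vimage open_circle_def)
qed

lemma compact_circle: "compact (UNIV :: circle set)"
proof -
  have "compact (to_circle ` {0..1})"
    by (rule compact_continuous_image[OF continuous_on_subset[OF continuous_to_circle]]) auto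
  moreover have "a \<in> to_circle ` {0..1}" for a
  proof -
    obtain x where "a = to_circle x"
      by (rule to_circle_cases)
    moreover have "to_circle x = to_circle (frac x)"
      by (simp add: to_circle_eq_iff frac_def)
    moreover have "frac x \<in> {0..1}"
      using frac_lt_1[of x] by (simp add: less_imp_le)
    ultimately show ?thesis
      by blast
  qed
  ultimately show ?thesis
    by (metis UNIV_eq_I)
qed

text \<open>A continuous map from a compact to a Hausdorff space is closed, and this gives
  continuity of the inverse of \<open>circle_exp\<close>.\<close>

lemma closed_circle_exp_image:
  assumes "closed C"
  shows "closed (circle_exp ` C)"
proof -
  have "compact C"
    using compact_Int_closed[OF compact_circle assms] by simp
  then show ?thesis
    by (intro compact_imp_closed compact_continuous_image continuous_on_subset[OF continuous_circle_exp]) auto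
qed

lemma nhd_0_circle:
  assumes "open U" "0 \<in> U"
  obtains e where "e > 0" "\<And>a. norm (circle_exp a - 1) < e \<Longrightarrow> a \<in> U"
proof -
  have "closed (circle_exp ` (- U))"
    by (rule closed_circle_exp_image) (simp add: assms(1) closed_Compl)
  moreover have "1 \<notin> circle_exp ` (- U)"
    using assms(2) circle_exp_eq_1_iff by (metis ComplD imageE)
  ultimately obtain e where "e > 0" "ball 1 e \<subseteq> - circle_exp ` (- U)"
    by (metis ComplI open_Compl open_contains_ball)
  then show ?thesis
    by (intro that[of e]) (auto simp: dist_norm norm_minus_commute subset_iff)
qed

lemma tendsto_circle_exp_iff: "(a \<longlongrightarrow> 0) F \<longleftrightarrow> ((\<lambda>n. circle_exp (a n)) \<longlongrightarrow> 1) F"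
proof
  assume "(a \<longlongrightarrow> 0) F"
  then show "((\<lambda>n. circle_exp (a n)) \<longlongrightarrow> 1) F"
    using continuous_on_tendsto_compose[OF continuous_circle_exp] circle_exp_0 by (metis UNIV_I always_eventually)
next
  assume lim: "((\<lambda>n. circle_exp (a n)) \<longlongrightarrow> 1) F"
  show "(a \<longlongrightarrow> 0) F"
  proof (rule topological_tendstoI)
    fix U :: "circle set" assume "open U" "0 \<in> U"
    then obtain e where e: "e > 0" "\<And>a. norm (circle_exp a - 1) < e \<Longrightarrow> a \<in> U"
      by (rule nhd_0_circle) blast
    show "\<forall>\<^sub>F n in F. a n \<in> U"
      using tendstoD[OF lim e(1)] by (rule eventually_mono) (use e(2) in \<open>simp add: dist_norm\<close>)
  qed
qed

lemma character_continuous: "\<phi> \<in> characters \<Longrightarrow> continuous_on UNIV \<phi>"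
  by (simp add: characters_def)

lemma character_add: "\<phi> \<in> characters \<Longrightarrow> \<phi> (x + y) = \<phi> x + \<phi> y"
  by (simp add: characters_def)

lemma character_0: "\<phi> \<in> characters \<Longrightarrow> \<phi> 0 = 0"
  using character_add[of \<phi> 0 0] by simp

lemma character_minus: "\<phi> \<in> characters \<Longrightarrow> \<phi> (- x) = - \<phi> x"
  using character_add[of \<phi> x "- x"] character_0[of \<phi>] by (simp add: eq_neg_iff_add_eq_0 add.commute)

lemma zero_character: "(\<lambda>x. 0) \<in> characters"
  by (simp add: characters_def)

lemma add_characters: "\<phi> \<in> characters \<Longrightarrow> \<psi> \<in> characters \<Longrightarrow> (\<lambda>x. \<phi> x + \<psi> x) \<in> characters"
  by (auto simp: characters_def intro: continuous_on_add)

lemma continuous_circle_exp_character: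
  "\<phi> \<in> characters \<Longrightarrow> continuous_on UNIV (\<lambda>x. circle_exp (\<phi> x))"
  by (rule continuous_on_compose2[OF continuous_circle_exp character_continuous]) auto

lemma character_from_complex:
  fixes \<xi> :: "'a::topological_ab_group_add \<Rightarrow> complex"
  assumes cont: "continuous_on UNIV \<xi>" and mult: "\<And>x y. \<xi> (x + y) = \<xi> x * \<xi> y" and norm: "\<And>x. norm (\<xi> x) = 1"
  obtains \<phi> where "\<phi> \<in> characters" "\<And>x. circle_exp (\<phi> x) = \<xi> x"
proof -
  have "\<exists>a. circle_exp a = \<xi> x" for x
    using circle_exp_surj[OF norm] by metis
  then obtain \<phi> where \<phi>: "\<And>x. circle_exp (\<phi> x) = \<xi> x"
    by metis
  have "closed (\<phi> -` C)" if "closed C" for C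
  proof -
    have "\<phi> -` C = \<xi> -` (circle_exp ` C)"
      by (auto simp: \<phi>[symmetric] circle_exp_inject)
    then show ?thesis
      using closed_vimage[OF closed_circle_exp_image[OF that] cont] by simp
  qed
  then have "continuous_on UNIV \<phi>"
    by (simp add: continuous_on_closed_vimage)
  moreover have "\<phi> (x + y) = \<phi> x + \<phi> y" for x y
    by (metis \<phi> mult circle_exp_add circle_exp_inject)
  ultimately show ?thesis
    using \<phi> by (intro that[of \<phi>]) (simp_all add: characters_def)
qed

lemma add_subgroupD:
  assumes "add_subgroup K"
  shows "0 \<in> K" "x \<in> K \<Longrightarrow> y \<in> K \<Longrightarrow> x + y \<in> K" "x \<in> K \<Longrightarrow> - x \<in> K" "x \<in> K \<Longrightarrow> y \<in> K \<Longrightarrow> x - y \<in> K"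
  using assms unfolding add_subgroup_def by (blast, blast, blast, metis diff_conv_add_uminus)

section \<open>Characters separating points from closed subgroups\<close>

lemma Hausdorff_space_euclidean_t2: "Hausdorff_space (euclidean :: 'a::t2_space topology)"
  unfolding Hausdorff_space_def by (metis hausdorff disjnt_def open_openin)

lemma compact_t2_separation:
  fixes C :: "'a::t2_space set"
  assumes cpt: "compact (UNIV :: 'a set)" and C: "closed C" "x0 \<notin> C"
  obtains g :: "'a \<Rightarrow> real" where "continuous_on UNIV g" "\<And>x. x \<in> C \<Longrightarrow> g x = 0" "g x0 = 1"
    "\<And>x. 0 \<le> g x" "\<And>x. g x \<le> 1"
proof -
  have "compact_space (euclidean :: 'a topology)"
    using cpt by (simp add: compact_space_def)
  then have "normal_space (euclidean :: 'a topology)"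
    using compact_Hausdorff_or_regular_imp_normal_space Hausdorff_space_euclidean_t2 by blast
  then obtain g where g: "continuous_map euclidean (top_of_set {0..1::real}) g" "g ` C \<subseteq> {0}" "g ` {x0} \<subseteq> {1}"
    using Urysohn_lemma[of euclidean C "{x0}" "0::real" 1] C by (auto simp: disjnt_def)
  have "continuous_map euclidean euclideanreal g" "g ` UNIV \<subseteq> {0..1}"
    using g(1) unfolding continuous_map_in_subtopology by auto
  then show ?thesis
    using g(2,3) by (intro that[of g]) (auto simp: image_subset_iff)
qed

text \<open>A Urysohn function is made invariant by taking suprema over cosets of \<open>F\<close>,
  for which uniform continuity suffices and no mean on \<open>F\<close> is required. It vanishes on
  \<open>F\<close> and is 1 at \<open>x0\<close>, so the supremum still separates \<open>x0\<close>
  from 0; adding the reflection makes it even.\<close>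

lemma ex_invariant_function:
  fixes F :: "'a::{topological_ab_group_add, t2_space} set"
  assumes cpt: "compact (UNIV :: 'a set)" and F: "add_subgroup F" "closed F" and x0: "x0 \<notin> F"
  obtains f :: "'a \<Rightarrow> real" where "continuous_on UNIV f" "\<And>x t. t \<in> F \<Longrightarrow> f (x + t) = f x"
    "\<And>x. f (- x) = f x" "f x0 \<noteq> f 0"
proof -
  obtain g :: "'a \<Rightarrow> real" where g: "continuous_on UNIV g" "\<And>x. x \<in> F \<Longrightarrow> g x = 0" "g x0 = 1"
    "\<And>x. 0 \<le> g x" "\<And>x. g x \<le> 1"
    using compact_t2_separation[OF cpt F(2) x0] by metis
  note F = F add_subgroupD[OF F(1)]
  define s where "s x = (SUP t\<in>F. g (x + t))" for x
  have bdd: "bdd_above ((\<lambda>t. g (x + t)) ` F)" for x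
    using g(5) by (intro bdd_aboveI[of _ 1]) auto
  have s_ge: "g (x + t) \<le> s x" if "t \<in> F" for x t
    unfolding s_def by (rule cSUP_upper[OF that bdd])
  have s_le: "s x \<le> c" if "\<And>t. t \<in> F \<Longrightarrow> g (x + t) \<le> c" for x c
    unfolding s_def using F(3) that by (intro cSUP_least) auto
  have s_inv: "s (x + t) = s x" if t: "t \<in> F" for x t
  proof (rule antisym)
    show "s (x + t) \<le> s x"
      by (rule s_le) (use s_ge[of _ x] F(4)[OF t] in \<open>simp add: add.assoc\<close>)
    show "s x \<le> s (x + t)"
    proof (rule s_le)
      fix r assume "r \<in> F"
      then show "g (x + r) \<le> s (x + t)"
        using s_ge[of "r - t" "x + t"] F(6)[of r t] t by (simp add: add.assoc)
    qed
  qed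
  have s_cont: "continuous_on UNIV s"
  proof (rule continuous_on_if_uniform)
    fix e :: real assume "e > 0"
    then obtain U where U: "open U" "0 \<in> U" "\<And>x d. d \<in> U \<Longrightarrow> dist (g (x + d)) (g x) < e"
      by (rule uniformly_continuous_on_compact_group[OF cpt g(1)]) blast
    have "dist (s (x + d)) (s x) \<le> e" if d: "d \<in> U" for x d
    proof -
      have *: "\<bar>g (x + d + t) - g (x + t)\<bar> \<le> e" for t
        using U(3)[OF d, of "x + t"] by (simp add: dist_real_def algebra_simps)
      have "s (x + d) \<le> s x + e"
        by (rule s_le) (use * s_ge in \<open>smt (verit)\<close>)
      moreover have "s x \<le> s (x + d) + e"
        by (rule s_le) (use * s_ge in \<open>smt (verit)\<close>)
      ultimately show ?thesis
        by (simp add: dist_real_def abs_le_iff algebra_simps)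
    qed
    with U show "\<exists>U. open U \<and> 0 \<in> U \<and> (\<forall>x. \<forall>d\<in>U. dist (s (x + d)) (s x) \<le> e)"
      by blast
  qed
  have s0: "s 0 = 0"
    using s_le[of 0 0] s_ge[of 0 0] g(2) F(3) by fastforce
  have s_nonneg: "0 \<le> s x" for x
    using s_ge[of 0 x] g(4)[of x] F(3) by simp
  have s_x0: "1 \<le> s x0"
    using s_ge[of 0 x0] g(3) F(3) by simp
  show ?thesis
  proof (rule that[of "\<lambda>x. s x + s (- x)"])
    show "continuous_on UNIV (\<lambda>x. s x + s (- x))"
      by (intro continuous_on_add s_cont continuous_translation(3))
    show "s (x + t) + s (- (x + t)) = s x + s (- x)" if "t \<in> F" for x t
      using s_inv[OF that, of x] s_inv[OF F(5)[OF that], of "- x"] by simp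
    show "s x0 + s (- x0) \<noteq> s 0 + s (- 0)"
      using s0 s_x0 s_nonneg[of "- x0"] by simp
  qed simp
qed

text \<open>The second difference of \<open>f\<^sub>0\<close> in direction \<open>x\<^sub>0\<close> kills every character that is trivial
  at \<open>x\<^sub>0\<close>, so a character in its spectrum separates \<open>x\<^sub>0\<close> from \<open>0\<close>.\<close>

theorem separating_character:
  fixes F :: "'a::{topological_ab_group_add, t2_space} set"
  assumes cpt: "compact (UNIV :: 'a set)" and F: "add_subgroup F" "closed F" and x0: "x0 \<notin> F"
  obtains \<phi> where "\<phi> \<in> characters" "\<And>x. x \<in> F \<Longrightarrow> \<phi> x = 0" "\<phi> x0 \<noteq> 0"
proof -
  obtain f0 :: "'a \<Rightarrow> real" where f0: "continuous_on UNIV f0" "\<And>x t. t \<in> F \<Longrightarrow> f0 (x + t) = f0 x"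
    "\<And>x. f0 (- x) = f0 x" "f0 x0 \<noteq> f0 0"
    using ex_invariant_function[OF cpt F x0] by metis
  define k where "k x = complex_of_real (f0 x)" for x
  have k: "continuous_on UNIV k"
    unfolding k_def by (intro continuous_intros f0)
  define f where "f x = 2 * k x - k (x + x0) - k (x - x0)" for x
  have f: "continuous_on UNIV f"
    unfolding f_def by (intro continuous_on_diff continuous_on_mult continuous_on_const k continuous_translation)
  have f0': "f0 (x0 - x) = f0 (x - x0)" "f0 (- x - x0) = f0 (x + x0)" for x
  proof -
    have "x0 - x = - (x - x0)" "- x - x0 = - (x + x0)"
      by (simp_all add: algebra_simps)
    then show "f0 (x0 - x) = f0 (x - x0)" "f0 (- x - x0) = f0 (x + x0)"
      using f0(3)[of "x - x0"] f0(3)[of "x + x0"] by metis+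
  qed
  have f_sym: "f (- x) = cnj (f x)" for x
    by (simp add: f_def k_def f0(3) f0')
  have f_inv: "f (x + t) = f x" if "t \<in> F" for x t
    using f0(2)[OF that, of x] f0(2)[OF that, of "x + x0"] f0(2)[OF that, of "x - x0"]
    by (simp add: f_def k_def algebra_simps)
  have "f 0 = complex_of_real (2 * (f0 0 - f0 x0))"
    using f0(3)[of x0] by (simp add: f_def k_def)
  then have "f 0 \<noteq> 0"
    using f0(4) by (simp del: of_real_mult)
  then obtain l q where l: "l \<noteq> 0" and q: "continuous_on UNIV q" "nsq q \<noteq> 0" "conv f q = (\<lambda>x. l * q x)"
    by (rule ex_eigenfunction[OF cpt f f_sym])
  obtain h where h: "continuous_on UNIV h" "nsq h = 1" "conv f h = (\<lambda>x. l * h x)"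
    "\<And>x z. autocorr h (x + z) = autocorr h x * autocorr h z"
    using ex_multiplicative_autocorr[OF cpt f l q] by blast
  let ?\<xi> = "autocorr h"
  have chi0: "?\<xi> 0 = 1"
    by (simp add: autocorr_0[OF cpt h(1)] h(2))
  have le1: "norm (?\<xi> x) \<le> 1" for x
    using norm_autocorr_le[OF cpt h(1)] h(2) by simp
  have "norm (?\<xi> x) = 1" for x
  proof (rule antisym[OF le1])
    have "norm (?\<xi> x) * norm (?\<xi> (- x)) = 1"
      using h(4)[of x "- x"] chi0 by (metis norm_mult norm_one add.right_inverse)
    moreover have "norm (?\<xi> x) * norm (?\<xi> (- x)) \<le> norm (?\<xi> x) * 1"
      by (intro mult_left_mono le1) simp
    ultimately show "1 \<le> norm (?\<xi> x)"
      by simp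
  qed
  then obtain \<phi> where \<phi>: "\<phi> \<in> characters" "\<And>x. circle_exp (\<phi> x) = ?\<xi> x"
    using character_from_complex[OF cont_autocorr[OF cpt h(1)] h(4)] by blast
  have "\<phi> t = 0" if t: "t \<in> F" for t
  proof -
    \<comment> \<open>Invariance passes from \<open>f\<close> to every convolution with
      \<open>f\<close>, and from there to the eigenfunction \<open>h\<close> because
      \<open>l\<close> is nonzero.\<close>
    have "conv f h (x + t) = conv f h x" for x
    proof -
      have "f (x + t - y) = f (x - y)" for y
        using f_inv[OF t, of "x - y"] by (simp add: algebra_simps)
      then show ?thesis
        by (simp add: conv_def)
    qed
    then have "h (x + t) = h x" for x
      using l by (simp add: h(3))
    then have "?\<xi> t = ?\<xi> 0"
      by (simp add: autocorr_def)
    then show ?thesis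
      using \<phi>(2)[of t] chi0 by (simp add: circle_exp_eq_1_iff)
  qed
  \<comment> \<open>If \<open>\<phi> x0\<close> were 0, the autocorrelation at \<open>x0\<close>
    would be 1, the equality case of Cauchy-Schwarz, and \<open>h\<close> would have period
    \<open>x0\<close>. Then \<open>conv k h\<close> has period \<open>x0\<close> too, its second
    difference \<open>conv f h\<close> vanishes, and so does \<open>h\<close>.\<close>
  moreover have "\<phi> x0 \<noteq> 0"
  proof
    assume "\<phi> x0 = 0"
    then have "?\<xi> x0 = 1"
      using \<phi>(2)[of x0] by (simp add: circle_exp_0)
    note s = continuous_translation(1)[OF h(1), of x0]
    have "ip h (\<lambda>y. h (y + x0)) = 1"
      using ip_cnj[OF cpt s h(1)] \<open>?\<xi> x0 = 1\<close> by (simp add: autocorr_def)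
    then have "nsq (\<lambda>y. h (y + x0) + (- 1) * h y) = 0"
      using h(2) by (subst nsq_add[OF cpt s h(1)]) (simp add: nsq_shift[OF cpt h(1)])
    then have "h (y + x0) + (- 1) * h y = 0" for y
      by (rule ip_self(3)[OF cpt cont_lincomb[OF s h(1)]])
    then have per: "h (y + x0) = h y" for y
      by (simp add: add_eq_0_iff2)
    have ck: "continuous_on UNIV (\<lambda>y. k (x - y) * h y)" for x
      by (rule conv_integrand_cont[OF k h(1)])
    have conv_k: "conv k h (x + x0) = conv k h x" for x
      using conv_shift[OF cpt k h(1), of x0 x] per by simp
    have "conv f h x = 0" for x
    proof -
      have "conv f h x = mean (\<lambda>y. (2 * (k (x - y) * h y) - k ((x + x0) - y) * h y) - k ((x - x0) - y) * h y)"
        by (simp add: conv_def f_def algebra_simps)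
      also have "\<dots> = 2 * conv k h x - conv k h (x + x0) - conv k h (x - x0)"
        using ck[of x] ck[of "x + x0"] ck[of "x - x0"] unfolding conv_def
        by (simp only: mean_diff[OF cpt] mean_mult_left[OF cpt] cont_scale continuous_on_diff)
      also have "\<dots> = 0"
        using conv_k[of x] conv_k[of "x - x0"] by simp
      finally show ?thesis .
    qed
    then have "h x = 0" for x
      using l h(3) by (metis mult_eq_0_iff)
    then have "nsq h = 0"
      by (simp add: nsq_def ip_def mean_const[OF cpt])
    with h(2) show False by simp
  qed
  ultimately show ?thesis
    using \<phi>(1) that by blast
qed

section \<open>Chains of closed subgroups\<close>

lemma Baire_compact_t2:
  fixes C :: "'a::t2_space set" and A :: "nat \<Rightarrow> 'a set"
  assumes cpt: "compact (UNIV :: 'a set)" and C: "closed C" "C \<noteq> {}"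
    and A: "\<And>n. closed (A n)" "C \<subseteq> (\<Union>n. A n)"
  obtains n U where "open U" "U \<inter> C \<noteq> {}" "U \<inter> C \<subseteq> A n"
proof -
  let ?X = "top_of_set C"
  have "compact C"
    using compact_Int_closed[OF cpt C(1)] by simp
  then have "compact_space ?X"
    by (simp add: compact_space_subtopology)
  moreover have "Hausdorff_space ?X"
    by (rule Hausdorff_space_subtopology[OF Hausdorff_space_euclidean_t2])
  ultimately have X: "locally_compact_space ?X" "regular_space ?X"
    by (auto intro: compact_imp_locally_compact_space compact_Hausdorff_imp_regular_space)
  have "\<exists>n. ?X interior_of (C \<inter> A n) \<noteq> {}"
  proof (rule ccontr)
    assume "\<not> ?thesis"
    then have "?X interior_of \<Union>(range (\<lambda>n. C \<inter> A n)) = {}"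
      using X A(1) by (intro Baire_category_alt) (auto intro: closedin_closed_Int)
    moreover have "\<Union>(range (\<lambda>n. C \<inter> A n)) = topspace ?X"
      using A(2) by auto
    ultimately show False
      using C(2) by (metis interior_of_topspace topspace_euclidean_subtopology)
  qed
  then obtain n x where "x \<in> ?X interior_of (C \<inter> A n)"
    by blast
  then obtain T where "openin ?X T" "x \<in> T" "T \<subseteq> C \<inter> A n"
    by (auto simp: interior_of_def)
  moreover from this obtain U where "open U" "T = C \<inter> U"
    unfolding openin_open by blast
  ultimately show ?thesis
    by (intro that[of U n]) auto
qed

text \<open>Baire yields a nonempty relatively open piece of \<open>C\<close> inside one
  \<open>F n\<close>; subtracting one of its points moves it to 0 without leaving that
  subgroup.\<close>

lemma subgroup_chain_nbhd:
  fixes F :: "nat \<Rightarrow> 'a::{topological_ab_group_add, t2_space} set"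
  assumes cpt: "compact (UNIV :: 'a set)" and F: "\<And>n. add_subgroup (F n)" "\<And>n. closed (F n)"
    and C: "add_subgroup C" "closed C" "C \<subseteq> (\<Union>n. F n)"
  obtains n U where "open U" "0 \<in> U" "U \<inter> C \<subseteq> F n"
proof -
  have "C \<noteq> {}"
    using add_subgroupD(1)[OF C(1)] by blast
  then obtain n V where V: "open V" "V \<inter> C \<noteq> {}" "V \<inter> C \<subseteq> F n"
    by (rule Baire_compact_t2[OF cpt C(2) _ F(2) C(3)])
  then obtain c where c: "c \<in> V" "c \<in> C" by blast
  have "open ((+) (- c) ` V)"
    by (rule open_translate[OF V(1)])
  moreover have "0 \<in> (+) (- c) ` V"
    using c by force
  moreover have "(+) (- c) ` V \<inter> C \<subseteq> F n"
  proof clarify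
    fix v assume v: "v \<in> V" "- c + v \<in> C"
    then have "c + (- c + v) \<in> C"
      using c add_subgroupD(2)[OF C(1)] by blast
    then have "v \<in> F n" "c \<in> F n"
      using V(3) v c by auto
    then show "- c + v \<in> F n"
      using add_subgroupD(4)[OF F(1)] by simp
  qed
  ultimately show ?thesis
    using that by blast
qed

text \<open>Some \<open>F n\<close> contains a neighbourhood of 0 in \<open>C\<close>. Finitely many
  translates of it by points of the chain cover \<open>C\<close>, and the largest index involved
  works.\<close>

lemma closed_subgroup_subset_chain:
  fixes F :: "nat \<Rightarrow> 'a::{topological_ab_group_add, t2_space} set"
  assumes cpt: "compact (UNIV :: 'a set)" and F: "\<And>n. add_subgroup (F n)" "\<And>n. closed (F n)"
    and mono: "mono F" and C: "add_subgroup C" "closed C" "C \<subseteq> (\<Union>n. F n)"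
  obtains n where "C \<subseteq> F n"
proof -
  obtain n U where U: "open U" "0 \<in> U" "U \<inter> C \<subseteq> F n"
    by (rule subgroup_chain_nbhd[OF cpt F C])
  \<comment> \<open>Centres are taken in \<open>C\<close> as well, so that the remainder
    \<open>u = x - y\<close> lies in \<open>C\<close> and hence in \<open>F n\<close>.\<close>
  define V where "V k = (\<Union>y\<in>F k \<inter> C. (+) y ` U)" for k
  have "compact C"
    using compact_Int_closed[OF cpt C(2)] by simp
  moreover have "open (V k)" for k
    unfolding V_def using open_translate[OF U(1)] by blast
  moreover have "C \<subseteq> (\<Union>k\<in>{n..}. V k)"
  proof
    fix x assume x: "x \<in> C"
    then obtain j where "x \<in> F j"
      using C(3) by blast
    then have "x \<in> F (max n j)"
      using monoD[OF mono, of j "max n j"] by auto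
    then have "x \<in> V (max n j)"
      unfolding V_def using x U(2) by (force intro!: image_eqI[of _ _ 0])
    then show "x \<in> (\<Union>k\<in>{n..}. V k)"
      by auto
  qed
  ultimately obtain D where D: "D \<subseteq> {n..}" "finite D" "C \<subseteq> (\<Union>k\<in>D. V k)"
    using compactE_image[of C "{n..}" V] by metis
  have "C \<subseteq> F (Max D)"
  proof
    fix x assume x: "x \<in> C"
    then obtain k y u where k: "k \<in> D" "y \<in> F k" "y \<in> C" "u \<in> U" "x = y + u"
      using D(3) unfolding V_def by blast
    have "u \<in> C"
      using add_subgroupD(4)[OF C(1) x k(3)] k(5) by simp
    then have "u \<in> F n"
      using U(3) k(4) by blast
    moreover have "n \<le> k" "k \<le> Max D"
      using D k(1) by auto
    from monoD[OF mono this(1)] monoD[OF mono this(2)] have "F n \<subseteq> F k" "F k \<subseteq> F (Max D)" .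
    ultimately show "x \<in> F (Max D)"
      using k add_subgroupD(2)[OF F(1)] by blast
  qed
  then show ?thesis
    using that by blast
qed

lemma coset_eq_iff:
  assumes "add_subgroup K"
  shows "coset K x = coset K y \<longleftrightarrow> x - y \<in> K"
proof
  assume "coset K x = coset K y"
  then have "x + 0 \<in> coset K y"
    using add_subgroupD(1)[OF assms] by (auto simp: coset_def)
  then show "x - y \<in> K"
    by (auto simp: coset_def)
next
  have *: "coset K x \<subseteq> coset K y" if "x - y \<in> K" for x y
  proof
    fix z assume "z \<in> coset K x"
    then obtain k where "k \<in> K" "z = x + k"
      by (auto simp: coset_def)
    then show "z \<in> coset K y"
      using add_subgroupD(2)[OF assms that, of k] by (auto simp: coset_def intro!: image_eqI[of _ _ "x - y + k"])
  qed
  assume "x - y \<in> K"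
  then show "coset K x = coset K y"
    using *[of x y] *[of y x] add_subgroupD(3)[OF assms, of "x - y"] by auto
qed

lemma mem_coset_iff: "y \<in> coset K x \<longleftrightarrow> y - x \<in> K"
  by (force simp: coset_def image_iff)

lemma finite_index_if_nbhd:
  fixes G :: "'a::{topological_ab_group_add, t2_space} set"
  assumes cpt: "compact (UNIV :: 'a set)" and G: "add_subgroup G" "closed G" and K: "add_subgroup K"
    and U: "open U" "0 \<in> U" "U \<inter> G \<subseteq> K"
  shows "finite_index G K"
proof -
  have "compact G"
    using compact_Int_closed[OF cpt G(2)] by simp
  moreover have "G \<subseteq> (\<Union>x\<in>G. (+) x ` U)"
    using U(2) by (force intro!: image_eqI[of _ _ 0])
  ultimately obtain D where D: "D \<subseteq> G" "finite D" "G \<subseteq> (\<Union>x\<in>D. (+) x ` U)"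
    using compactE_image[of G G "\<lambda>x. (+) x ` U"] open_translate[OF U(1)] by metis
  have "coset K y \<in> coset K ` D" if y: "y \<in> G" for y
  proof -
    obtain x u where x: "x \<in> D" "u \<in> U" "y = x + u"
      using D(3) y by blast
    then have "y - x \<in> G"
      using add_subgroupD(4)[OF G(1) y] D(1) by blast
    then have "y - x \<in> K"
      using U(3) x by auto
    then show ?thesis
      using x(1) coset_eq_iff[OF K] by blast
  qed
  then show ?thesis
    unfolding finite_index_def using D(2) by (meson finite_imageI finite_subset image_subsetI)
qed

text \<open>The complement of the finitely many other cosets of \<open>K\<close> that meet
  \<open>G\<close> is open, because each coset is closed.\<close>

lemma nbhd_if_finite_index:
  fixes G :: "'a::{topological_ab_group_add, t2_space} set"
  assumes K: "add_subgroup K" "closed K" and fin: "finite_index G K"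
  obtains U where "open U" "0 \<in> U" "U \<inter> G \<subseteq> K"
proof -
  let ?B = "\<Union>(coset K ` G - {K})"
  have K0: "coset K 0 = K"
    by (simp add: coset_def)
  have cl: "closed (coset K x)" for x
  proof -
    have "closed ((\<lambda>y. y - x) -` K)"
      by (rule closed_vimage[OF K(2) continuous_translation(2)[OF continuous_on_id]])
    then show ?thesis
      by (simp add: vimage_def mem_coset_iff[symmetric])
  qed
  show ?thesis
  proof (rule that[of "- ?B"])
    show "open (- ?B)"
      using fin cl by (intro open_Compl closed_Union) (auto simp: finite_index_def)
    have "0 \<notin> coset K x" if "coset K x \<noteq> K" for x
    proof
      assume "0 \<in> coset K x"
      then have "coset K 0 = coset K x"
        by (simp add: coset_eq_iff[OF K(1)] mem_coset_iff)
      with that K0 show False by simp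
    qed
    then show "0 \<in> - ?B"
      by auto
    show "- ?B \<inter> G \<subseteq> K"
    proof clarify
      fix x assume x: "x \<notin> ?B" "x \<in> G"
      have "x \<in> coset K x"
        using add_subgroupD(1)[OF K(1)] by (simp add: mem_coset_iff)
      with x have "coset K x = K"
        by blast
      with \<open>x \<in> coset K x\<close> show "x \<in> K" by simp
    qed
  qed
qed

lemma compact_nested_Int_nonempty:
  fixes A :: "nat \<Rightarrow> 'a::topological_space set"
  assumes "compact (UNIV :: 'a set)" "\<And>n. closed (A n)" "\<And>n. A n \<noteq> {}" "\<And>n. A (Suc n) \<subseteq> A n"
  shows "(\<Inter>n. A n) \<noteq> {}"
proof -
  have "UNIV \<inter> \<Inter>(range A) \<noteq> {}"
  proof (rule compact_imp_fip[OF assms(1)])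
    fix B assume B: "finite B" "B \<subseteq> range A"
    then obtain I where I: "finite I" "B = A ` I"
      by (meson finite_subset_image)
    have "A (Max (insert 0 I)) \<subseteq> A i" if "i \<in> I" for i
      using I(1) that by (intro lift_Suc_antimono_le[of A, OF assms(4)]) auto
    then show "UNIV \<inter> \<Inter>B \<noteq> {}"
      using assms(3)[of "Max (insert 0 I)"] I(2) by blast
  qed (use assms(2) in auto)
  then show ?thesis by simp
qed

text \<open>\<open>\<rho>\<close> is a continuous length function; the distance of two cosets is the
  infimum of \<open>\<rho>\<close> over differences of their points. The quotient is compact and the
  metric topology Hausdorff, so continuity of the identity in one direction already makes it a
  homeomorphism.\<close>

lemma metrizable_quotient_space:
  fixes L :: "'a::{topological_ab_group_add, t2_space} set" and \<rho> :: "'a \<Rightarrow> real"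
  assumes cpt: "compact (UNIV :: 'a set)" and L: "add_subgroup L" "closed L"
    and \<rho>: "continuous_on UNIV \<rho>" "\<And>x. \<rho> x \<ge> 0" "\<And>x y. \<rho> (x + y) \<le> \<rho> x + \<rho> y" "\<And>x. \<rho> (- x) = \<rho> x"
      "\<rho> 0 = 0" "\<And>x. \<rho> x = 0 \<Longrightarrow> x \<in> L"
  shows "metrizable_space (quotient_space L)"
proof -
  note L' = add_subgroupD[OF L(1)]
  \<comment> \<open>The axioms of \<open>Metric_space\<close> demand nonnegativity and symmetry for
    arbitrary arguments, not only for cosets. The value 0 handles the empty set, where
    \<open>Inf\<close> says nothing.\<close>
  define d where "d A B = (if A \<times> B = {} then 0 else Inf ((\<lambda>p. \<rho> (fst p - snd p)) ` (A \<times> B)))" for A B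
  have img: "(\<lambda>p. \<rho> (fst p - snd p)) ` (coset L x \<times> coset L y) = (\<lambda>t. \<rho> (x - y + t)) ` L" for x y
  proof (intro equalityI subsetI)
    fix r assume "r \<in> (\<lambda>p. \<rho> (fst p - snd p)) ` (coset L x \<times> coset L y)"
    then obtain s t where "s \<in> L" "t \<in> L" "r = \<rho> (x + s - (y + t))"
      by (auto simp: coset_def)
    moreover from this have "x + s - (y + t) = x - y + (s - t)" "s - t \<in> L"
      using L'(4) by (auto simp: algebra_simps)
    ultimately show "r \<in> (\<lambda>t. \<rho> (x - y + t)) ` L"
      by (metis imageI)
  next
    fix r assume "r \<in> (\<lambda>t. \<rho> (x - y + t)) ` L"
    then obtain t where t: "t \<in> L" "r = \<rho> (x - y + t)" by blast
    then have "(x + t, y) \<in> coset L x \<times> coset L y" "r = \<rho> (fst (x + t, y) - snd (x + t, y))"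
      using L'(1) by (auto simp: mem_coset_iff algebra_simps)
    then show "r \<in> (\<lambda>p. \<rho> (fst p - snd p)) ` (coset L x \<times> coset L y)"
      by (intro image_eqI[where x = "(x + t, y)"])
  qed
  have d_coset: "d (coset L x) (coset L y) = Inf ((\<lambda>t. \<rho> (x - y + t)) ` L)" for x y
    unfolding d_def img using L'(1) by (auto simp: coset_def)
  have bdd: "bdd_below ((\<lambda>t. \<rho> (x - y + t)) ` L)" for x y
    by (rule bdd_belowI[of _ 0]) (use \<rho>(2) in auto)
  have d_le: "d (coset L x) (coset L y) \<le> \<rho> (x - y + t)" if "t \<in> L" for x y t
    unfolding d_coset by (rule cInf_lower[OF _ bdd]) (use that in blast)
  \<comment> \<open>Attainment, by compactness of \<open>L\<close>, gives the triangle inequality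
    without approximations and turns distance 0 into a zero of \<open>\<rho>\<close>.\<close>
  have d_att: "\<exists>t\<in>L. d (coset L x) (coset L y) = \<rho> (x - y + t)" for x y
  proof -
    have "compact L"
      using compact_Int_closed[OF cpt L(2)] by simp
    moreover have "continuous_on L (\<lambda>t. \<rho> (x - y + t))"
      by (rule continuous_on_subset[OF continuous_translation(5)[OF \<rho>(1)]]) simp
    ultimately obtain t where t: "t \<in> L" "\<And>s. s \<in> L \<Longrightarrow> \<rho> (x - y + t) \<le> \<rho> (x - y + s)"
      using continuous_attains_inf[of L "\<lambda>t. \<rho> (x - y + t)"] L'(1) by blast
    then have "d (coset L x) (coset L y) = \<rho> (x - y + t)"
      unfolding d_coset by (intro cInf_eq_minimum) auto
    with t(1) show ?thesis by blast
  qed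
  interpret M: Metric_space "range (coset L)" d
  proof
    have nonneg: "0 \<le> d (coset L x) (coset L y)" for x y
      using d_att \<rho>(2) by metis
    show "0 \<le> d A B" for A B
      unfolding d_def using \<rho>(2) by (auto intro!: cInf_greatest)
    show "d A B = d B A" for A B
    proof -
      have "(\<lambda>p. \<rho> (fst p - snd p)) ` (A \<times> B) = (\<lambda>p. \<rho> (fst p - snd p)) ` (B \<times> A)"
        using \<rho>(4) by (auto simp: image_iff) (metis minus_diff_eq)+
      then show ?thesis
        by (auto simp add: d_def)
    qed
    show "d A B = 0 \<longleftrightarrow> A = B" if AB: "A \<in> range (coset L)" "B \<in> range (coset L)" for A B
    proof -
      obtain x y where xy: "A = coset L x" "B = coset L y"
        using AB by blast
      show ?thesis
      proof
        assume "d A B = 0"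
        then obtain t where "t \<in> L" "\<rho> (x - y + t) = 0"
          using d_att[of x y] xy by auto
        then have "x - y + t - t \<in> L"
          using \<rho>(6) L'(4) by blast
        then show "A = B"
          by (simp add: xy coset_eq_iff[OF L(1)])
      next
        assume "A = B"
        then have "x - y \<in> L"
          by (simp add: xy coset_eq_iff[OF L(1)])
        then have "d A B \<le> \<rho> (x - y + - (x - y))"
          unfolding xy by (intro d_le L'(3))
        then show "d A B = 0"
          using nonneg[of x y] \<rho>(5) by (simp add: xy)
      qed
    qed
    show "d A C \<le> d A B + d B C"
      if ABC: "A \<in> range (coset L)" "B \<in> range (coset L)" "C \<in> range (coset L)" for A B C
    proof -
      obtain x y z where xyz: "A = coset L x" "B = coset L y" "C = coset L z"
        using ABC by blast
      obtain s t where st: "s \<in> L" "t \<in> L" "d A B = \<rho> (x - y + s)" "d B C = \<rho> (y - z + t)"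
        using d_att xyz by metis
      have "d A C \<le> \<rho> (x - z + (s + t))"
        unfolding xyz by (rule d_le[OF L'(2)[OF st(1,2)]])
      also have "x - z + (s + t) = (x - y + s) + (y - z + t)"
        by simp
      also have "\<rho> \<dots> \<le> d A B + d B C"
        unfolding st by (rule \<rho>(3))
      finally show ?thesis .
    qed
  qed
  have "continuous_map euclidean M.mtopology (coset L)"
    unfolding M.continuous_map_to_metric
  proof (intro ballI allI impI)
    fix x :: 'a and e :: real assume "e > 0"
    have "open ((\<lambda>y. \<rho> (x - y)) -` {..<e})"
      by (rule open_vimage[OF _ continuous_translation(4)[OF \<rho>(1)]]) simp
    moreover have "coset L y \<in> M.mball (coset L x) e" if "\<rho> (x - y) < e" for y
      using d_le[OF L'(1), of x y] that by auto
    ultimately show "\<exists>U. openin euclidean U \<and> x \<in> U \<and> (\<forall>y\<in>U. coset L y \<in> M.mball (coset L x) e)"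
      using \<rho>(5) \<open>e > 0\<close> by (intro exI[of _ "(\<lambda>y. \<rho> (x - y)) -` {..<e}"]) auto
  qed
  then have cont: "continuous_map (quotient_space L) M.mtopology id"
    using continuous_compose_quotient_map[OF quotient_map_coset, of M.mtopology id L] by simp
  have "compactin (quotient_space L) (coset L ` UNIV)"
    by (rule image_compactin[OF _ quotient_imp_continuous_map[OF quotient_map_coset]]) (simp add: cpt)
  then have "compact_space (quotient_space L)"
    by (simp add: compact_space_def topspace_quotient_space)
  then have "homeomorphic_map (quotient_space L) M.mtopology id"
    by (rule continuous_imp_homeomorphic_map[OF cont _ M.Hausdorff_space_mtopology])
      (simp_all add: topspace_quotient_space)
  then have "quotient_space L homeomorphic_space M.mtopology"
    by (rule homeomorphic_map_imp_homeomorphic_space)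
  then show ?thesis
    using homeomorphic_metrizable_space M.metrizable_space_mtopology by blast
qed

text \<open>Evaluation at all \<open>u n\<close> maps into a countable product of circles, which is
  metrizable. Its metric is invariant under coordinatewise rotation, so the distance to the image of
  0 is a length function on the group.\<close>

lemma metrizable_quotient_by_characters:
  fixes L :: "'a::{topological_ab_group_add, t2_space} set"
  assumes cpt: "compact (UNIV :: 'a set)" and L: "add_subgroup L" "closed L"
    and u: "\<And>n::nat. u n \<in> characters" and ker: "{x. \<forall>n. u n x = 0} \<subseteq> L"
  shows "metrizable_space (quotient_space L)"
proof -
  define e where "e x = (\<lambda>n. circle_exp (u n x))" for x
  have e: "continuous_on UNIV e"
    unfolding e_def by (intro continuous_on_coordinatewise_then_product continuous_circle_exp_character u)
  have inv: "dist (e (x + z)) (e (y + z)) = dist (e x) (e y)" for x y z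
  proof -
    have "dist (e (x + z) n) (e (y + z) n) = dist (e x n) (e y n)" for n
    proof -
      have "e (x + z) n - e (y + z) n = (e x n - e y n) * circle_exp (u n z)"
        by (simp add: e_def character_add[OF u] circle_exp_add algebra_simps)
      then show ?thesis
        by (simp add: dist_norm norm_mult norm_circle_exp)
    qed
    then show ?thesis
      by (simp add: dist_fun_def)
  qed
  show ?thesis
  proof (rule metrizable_quotient_space[OF cpt L, of "\<lambda>x. dist (e x) (e 0)"])
    show "continuous_on UNIV (\<lambda>x. dist (e x) (e 0))"
      by (intro continuous_on_dist e continuous_on_const)
    show "dist (e (x + y)) (e 0) \<le> dist (e x) (e 0) + dist (e y) (e 0)" for x y
      using dist_triangle[of "e (x + y)" "e 0" "e y"] inv[of x y 0] by simp
    show "dist (e (- x)) (e 0) = dist (e x) (e 0)" for x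
      using inv[of "- x" x 0] by (simp add: dist_commute)
    show "x \<in> L" if "dist (e x) (e 0) = 0" for x
    proof -
      have "circle_exp (u n x) = circle_exp (u n 0)" for n
        using that by (simp add: e_def fun_eq_iff)
      then have "u n x = 0" for n
        by (simp add: circle_exp_inject character_0[OF u])
      then show ?thesis
        using ker by blast
    qed
  qed simp_all
qed

section \<open>Sets of convergence\<close>

lemma tendsto_iff_finite:
  fixes a :: "nat \<Rightarrow> 'b::topological_space"
  shows "a \<longlonglongrightarrow> l \<longleftrightarrow> (\<forall>U. open U \<and> l \<in> U \<longrightarrow> finite {n. a n \<notin> U})"
  by (simp add: tendsto_def cofinite_eq_sequentially[symmetric] eventually_cofinite imp_conjL)

lemma char_conv_set_range:
  assumes "inj v"
  shows "char_conv_set (range v) = char_seq_set v"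
proof -
  have "{\<phi> \<in> range v. \<phi> x \<notin> U} = v ` {n. v n x \<notin> U}" for x U
    by auto
  then have "finite {\<phi> \<in> range v. \<phi> x \<notin> U} \<longleftrightarrow> finite {n. v n x \<notin> U}" for x U
    using finite_image_iff[OF inj_on_subset[OF assms]] by simp
  then show ?thesis
    by (simp add: char_conv_set_def char_seq_set_def tendsto_iff_finite)
qed

lemma char_conv_set_Un: "char_conv_set (B \<union> C) = char_conv_set B \<inter> char_conv_set C"
proof -
  have "{\<phi> \<in> B \<union> C. \<phi> x \<notin> U} = {\<phi> \<in> B. \<phi> x \<notin> U} \<union> {\<phi> \<in> C. \<phi> x \<notin> U}" for x U
    by blast
  then show ?thesis
    by (auto simp: char_conv_set_def)
qed

lemma inj_choice_from_infinite:
  fixes A :: "nat \<Rightarrow> 'b set"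
  assumes "\<And>n. infinite (A n)"
  obtains f where "\<And>n. f n \<in> A n" "inj f"
proof -
  have "\<exists>f. \<forall>n. f n \<in> A n \<and> f n \<notin> f ` {..<n}"
  proof (rule dependent_wellorder_choice)
    fix n :: nat and f :: "nat \<Rightarrow> 'b"
    have "infinite (A n - f ` {..<n})"
      using assms by (intro Diff_infinite_finite) auto
    then show "\<exists>r. r \<in> A n \<and> r \<notin> f ` {..<n}"
      by (metis Diff_iff finite.emptyI ex_in_conv)
  qed auto
  then obtain f where f: "\<And>n. f n \<in> A n" "\<And>n. f n \<notin> f ` {..<n}"
    by blast
  have "inj f"
  proof (rule linorder_injI)
    fix m n :: nat assume "m < n"
    then show "f m \<noteq> f n"
      using f(2)[of n] by (metis image_eqI lessThan_iff)
  qed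
  with f(1) show ?thesis
    using that by blast
qed

text \<open>Adding to each \<open>u\<^sub>n\<close> a far enough term of an injective subsequence removes all repetitions
  without changing the set of convergence.\<close>

lemma char_conv_set_if_infinite_range:
  assumes u: "\<And>n. u n \<in> characters" and inf: "infinite (range u)"
  obtains B where "B \<subseteq> characters" "countable B" "infinite B" "char_conv_set B = char_seq_set u"
proof -
  have tail: "infinite (u ` {n..})" for n
  proof
    assume "finite (u ` {n..})"
    moreover have "range u = u ` {..<n} \<union> u ` {n..}"
      unfolding image_Un[symmetric] by (rule arg_cong[where f = "image u"]) auto
    ultimately show False
      using inf by simp
  qed
  obtain w where w: "\<And>n. w n \<in> u ` {n..}" "inj w"
    by (rule inj_choice_from_infinite[of "\<lambda>n. u ` {n..}", OF tail]) blast
  define A where "A n = (\<lambda>\<psi> x. u n x + \<psi> x) ` w ` {n..}" for n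
  have "infinite (A n)" for n
  proof -
    have "inj_on (\<lambda>\<psi> x. u n x + \<psi> x) (w ` {n..})"
      by (auto simp: inj_on_def fun_eq_iff)
    moreover have "infinite (w ` {n..})"
      using finite_imageD[OF _ inj_on_subset[OF w(2)]] infinite_Ici by blast
    ultimately show ?thesis
      unfolding A_def using finite_imageD by blast
  qed
  then obtain y where y: "\<And>n. y n \<in> A n" "inj y"
    by (rule inj_choice_from_infinite[of A]) blast
  have "\<exists>k\<ge>n. w n = u k" for n
    using w(1)[of n] by auto
  then obtain r where r: "\<And>n. r n \<ge> n" "\<And>n. w n = u (r n)"
    by metis
  have "\<exists>k\<ge>n. y n = (\<lambda>x. u n x + w k x)" for n
    using y(1)[of n] by (auto simp: A_def)
  then obtain g where g: "\<And>n. g n \<ge> n" "\<And>n. y n = (\<lambda>x. u n x + w (g n) x)"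
    by metis
  have top: "filterlim k at_top sequentially" if "\<And>n. k n \<ge> n" for k :: "nat \<Rightarrow> nat"
    by (rule filterlim_at_top_mono[OF filterlim_ident]) (use that in simp)
  \<comment> \<open>The ranges of \<open>w\<close> and \<open>y\<close> may overlap; this is
    harmless since convergence along a union of sets is convergence along both.\<close>
  have "char_conv_set (range w \<union> range y) = char_seq_set w \<inter> char_seq_set y"
    by (simp add: char_conv_set_Un char_conv_set_range w(2) y(2))
  also have "\<dots> = char_seq_set u"
  proof (intro equalityI subsetI)
    fix x assume "x \<in> char_seq_set w \<inter> char_seq_set y"
    then have lim: "(\<lambda>n. w n x) \<longlonglongrightarrow> 0" "(\<lambda>n. y n x) \<longlonglongrightarrow> 0"
      by (simp_all add: char_seq_set_def)
    have "(\<lambda>n. y n x + - w (g n) x) \<longlonglongrightarrow> 0 + - 0"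
      by (intro tendsto_add tendsto_minus lim filterlim_compose[OF lim(1) top[OF g(1)]])
    then show "x \<in> char_seq_set u"
      by (simp add: g(2) char_seq_set_def)
  next
    fix x assume "x \<in> char_seq_set u"
    then have lim: "(\<lambda>n. u n x) \<longlonglongrightarrow> 0"
      by (simp add: char_seq_set_def)
    have lim_w: "(\<lambda>n. w n x) \<longlonglongrightarrow> 0"
      unfolding r(2) by (rule filterlim_compose[OF lim top[OF r(1)]])
    have "(\<lambda>n. y n x) \<longlonglongrightarrow> 0 + 0"
      unfolding g(2) by (intro tendsto_add lim filterlim_compose[OF lim_w top[OF g(1)]])
    with lim_w show "x \<in> char_seq_set w \<inter> char_seq_set y"
      by (simp add: char_seq_set_def)
  qed
  finally have eq: "char_conv_set (range w \<union> range y) = char_seq_set u" .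
  have "range w \<subseteq> characters"
    using r(2) u by auto
  moreover have "range y \<subseteq> characters"
    using g(2) \<open>range w \<subseteq> characters\<close> u by (auto intro!: add_characters)
  moreover have "infinite (range w)"
    using w(2) finite_imageD by blast
  ultimately show ?thesis
    using eq by (intro that[of "range w \<union> range y"]) auto
qed

text \<open>Only characters that occur infinitely often matter, and convergence at \<open>x\<close>
  forces each of them to vanish there. The set is thus an intersection of kernels.\<close>

lemma char_seq_set_if_finite_range:
  fixes u :: "nat \<Rightarrow> 'a::topological_ab_group_add \<Rightarrow> circle"
  assumes u: "\<And>n. u n \<in> characters" and fin: "finite (range u)"
  shows "closed (char_seq_set u)"
proof -
  define J where "J = {\<phi> \<in> range u. infinite (u -` {\<phi>})}"
  have "char_seq_set u = (\<Inter>\<phi>\<in>J. \<phi> -` {0})"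
  proof (intro equalityI subsetI INT_I)
    fix x \<phi> assume x: "x \<in> char_seq_set u" and "\<phi> \<in> J"
    show "x \<in> \<phi> -` {0}"
    proof (rule ccontr)
      assume "x \<notin> \<phi> -` {0}"
      then have "open (- {\<phi> x}) \<and> 0 \<in> - {\<phi> x}"
        by (simp add: open_Compl)
      then have "finite {n. u n x \<notin> - {\<phi> x}}"
        using x unfolding char_seq_set_def mem_Collect_eq tendsto_iff_finite by blast
      moreover have "u -` {\<phi>} \<subseteq> {n. u n x \<notin> - {\<phi> x}}"
        by auto
      ultimately show False
        using \<open>\<phi> \<in> J\<close> finite_subset by (auto simp: J_def)
    qed
  next
    fix x assume x: "x \<in> (\<Inter>\<phi>\<in>J. \<phi> -` {0})"
    have "finite {n. u n x \<noteq> 0}"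
    proof -
      have "{n. u n x \<noteq> 0} \<subseteq> (\<Union>\<phi>\<in>range u - J. u -` {\<phi>})"
        using x by auto
      moreover have "finite (\<Union>\<phi>\<in>range u - J. u -` {\<phi>})"
        using fin by (intro finite_UN_I) (auto simp: J_def)
      ultimately show ?thesis
        using finite_subset by blast
    qed
    then have "finite {n. u n x \<notin> U}" if "0 \<in> U" for U
      using that by (auto elim: finite_subset[rotated])
    then show "x \<in> char_seq_set u"
      by (simp add: char_seq_set_def tendsto_iff_finite)
  qed
  moreover have "closed (\<phi> -` {0})" if "\<phi> \<in> J" for \<phi>
    using that u by (intro closed_vimage character_continuous) (auto simp: J_def)
  ultimately show ?thesis
    by auto
qed

lemma add_subgroup_char_seq_set:
  assumes u: "\<And>n. u n \<in> characters"
  shows "add_subgroup (char_seq_set u)"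
  unfolding add_subgroup_def char_seq_set_def
  using tendsto_add[of _ 0 sequentially _ 0] tendsto_minus[of _ 0 sequentially]
  by (auto simp: character_0[OF u] character_add[OF u] character_minus[OF u])

section \<open>From sequences to the index condition\<close>

text \<open>This is the Baire category theorem for the metric of uniform convergence of
  \<open>\<langle>u\<^sub>n(x) : n \<in> \<omega>\<rangle>\<close> on \<open>H\<close>, with completeness replaced by compactness of \<open>X\<close>.\<close>

lemma uniform_nbhd_in_chain:
  fixes F :: "nat \<Rightarrow> 'a::{topological_ab_group_add, t2_space} set"
  assumes cpt: "compact (UNIV :: 'a set)" and F: "\<And>n. add_subgroup (F n)" "\<And>n. closed (F n)"
    and mono: "mono F" and u: "\<And>n. u n \<in> characters" and H: "char_seq_set u = (\<Union>n. F n)"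
    and ker: "{x. \<forall>n. u n x = 0} \<subseteq> F n0"
  obtains m e where "m \<ge> n0" "e > 0"
    "\<And>x. x \<in> char_seq_set u \<Longrightarrow> (\<And>n. norm (circle_exp (u n x) - 1) \<le> e) \<Longrightarrow> x \<in> F m"
proof (rule ccontr)
  \<comment> \<open>The closed ball of radius \<open>e\<close> around 0 in the metric of uniform
    convergence, which is also closed in the group topology and hence compact.\<close>
  define A where "A e = {x. \<forall>n. norm (circle_exp (u n x) - 1) \<le> e}" for e
  define H where "H = char_seq_set u"
  note found = that
  assume "\<not> thesis"
  have ex: "\<exists>x. x \<in> H \<and> x \<in> A e \<and> x \<notin> F m" if "m \<ge> n0" "e > 0" for m e
  proof (rule ccontr)
    assume "\<nexists>x. x \<in> H \<and> x \<in> A e \<and> x \<notin> F m"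
    then have thesis
      by (intro found[OF that]) (auto simp: A_def H_def)
    with \<open>\<not> thesis\<close> show False ..
  qed
  have H_sub: "add_subgroup H"
    unfolding H_def by (rule add_subgroup_char_seq_set[OF u])
  have A_closed: "closed (A e)" for e
    unfolding A_def
    by (intro closed_Collect_all closed_Collect_le continuous_on_norm continuous_on_diff
        continuous_circle_exp_character[OF u] continuous_on_const)
  have A0: "0 \<in> A e" if "e \<ge> 0" for e
    using that by (simp add: A_def character_0[OF u] circle_exp_0)
  have A_add: "x + y \<in> A (e + e')" if "x \<in> A e" "y \<in> A e'" for x y e e'
  proof -
    have "norm (circle_exp (u n (x + y)) - 1) \<le> e + e'" for n
    proof -
      have "circle_exp (u n (x + y)) - 1
          = (circle_exp (u n x) - 1) * circle_exp (u n y) + (circle_exp (u n y) - 1)"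
        by (simp add: character_add[OF u] circle_exp_add algebra_simps)
      also have "norm \<dots> \<le> norm (circle_exp (u n x) - 1) * 1 + norm (circle_exp (u n y) - 1)"
        by (metis norm_circle_exp norm_mult norm_triangle_ineq)
      also have "\<dots> \<le> e + e'"
        using that by (auto simp: A_def intro: add_mono)
      finally show ?thesis .
    qed
    then show ?thesis by (simp add: A_def)
  qed
  have A_mono: "A e \<subseteq> A e'" if "e \<le> e'" for e e'
    using that by (auto simp: A_def intro: order_trans)
  \<comment> \<open>If every small ball around \<open>y\<close> met \<open>F m\<close>, compactness
    would give \<open>a\<close> with all \<open>u n a = 0\<close> and \<open>y + a\<close> in
    \<open>F m\<close>. The common kernel lies in \<open>F n0\<close> and so in \<open>F m\<close>,
    which would put \<open>y\<close> there too.\<close>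
  have avoid: "\<exists>e>0. e \<le> b \<and> (\<forall>a\<in>A e. y + a \<notin> F m)" if y: "y \<notin> F m" and m: "m \<ge> n0" and b: "b > 0" for y m b
  proof (rule ccontr)
    assume neg: "\<not> ?thesis"
    define C where "C i = A (b / Suc i) \<inter> {a. y + a \<in> F m}" for i :: nat
    have "(\<Inter>i. C i) \<noteq> {}"
    proof (rule compact_nested_Int_nonempty[OF cpt])
      have "closed ((\<lambda>a. y + a) -` F m)"
        by (rule closed_vimage[OF F(2) continuous_translation(5)[OF continuous_on_id]])
      then show "closed (C i)" for i
        unfolding C_def by (intro closed_Int A_closed) (simp add: vimage_def)
      have "b / Suc i > 0" "b / Suc i \<le> b" for i
        using b by (auto simp: field_simps)
      then show "C i \<noteq> {}" for i
        using neg unfolding C_def by blast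
      have "b / Suc (Suc i) \<le> b / Suc i" for i
        using b by (simp add: field_simps)
      then show "C (Suc i) \<subseteq> C i" for i
        unfolding C_def using A_mono by blast
    qed
    then obtain a where a: "\<And>i. a \<in> C i" by blast
    have "u n a = 0" for n
    proof -
      have "norm (circle_exp (u n a) - 1) \<le> 0 + b / Suc i" for i
        using a[of i] by (simp add: C_def A_def)
      then have "norm (circle_exp (u n a) - 1) \<le> 0"
        by (rule le_if_le_add_divide_Suc)
      then show ?thesis
        using circle_exp_eq_1_iff by simp
    qed
    then have "a \<in> F m"
      using ker monoD[OF mono m] by blast
    moreover have "y + a \<in> F m"
      using a[of 0] by (simp add: C_def)
    ultimately have "y + a - a \<in> F m"
      using add_subgroupD(4)[OF F(1)] by blast
    with y show False by simp
  qed
  \<comment> \<open>A pair is the centre and radius of a ball that misses \<open>F (n0 + j)\<close>.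
    Since the chain increases, avoiding all these avoids the whole chain.\<close>
  define P where "P j p \<longleftrightarrow> fst p \<in> H \<and> 0 < snd p \<and> snd p \<le> 1 / Suc j \<and>
      (\<forall>a\<in>A (snd p). fst p + a \<notin> F (n0 + j))" for j :: nat and p :: "'a \<times> real"
  have "\<exists>s. \<forall>j. P j (s j) \<and> (+) (fst (s (Suc j))) ` A (snd (s (Suc j))) \<subseteq> (+) (fst (s j)) ` A (snd (s j))"
  proof (rule dependent_nat_choice)
    obtain y where y: "y \<in> H" "y \<notin> F n0"
      using ex[of n0 1] by auto
    obtain e where "e > 0" "e \<le> 1" "\<forall>a\<in>A e. y + a \<notin> F n0"
      using avoid[OF y(2) order_refl zero_less_one] by blast
    then show "\<exists>p. P 0 p"
      using y(1) by (intro exI[of _ "(y, e)"]) (simp add: P_def)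
  next
    fix p j assume p: "P j p"
    obtain y e where ye: "p = (y, e)" by fastforce
    have y: "y \<in> H" "e > 0"
      using p by (auto simp: P_def ye)
    \<comment> \<open>The new centre must leave \<open>F (n0 + Suc j)\<close> while staying within
      half the old radius. If \<open>y\<close> lies in that subgroup, adding a small element outside
      it does so; otherwise \<open>y\<close> can be kept.\<close>
    obtain y' where y': "y' \<in> H" "y' - y \<in> A (e/2)" "y' \<notin> F (n0 + Suc j)"
    proof (cases "y \<in> F (n0 + Suc j)")
      case True
      obtain z where z: "z \<in> H" "z \<in> A (e/2)" "z \<notin> F (n0 + Suc j)"
        using ex[of "n0 + Suc j" "e/2"] y(2) by auto
      have "y + z \<in> H"
        by (rule add_subgroupD(2)[OF H_sub y(1) z(1)])
      moreover have "y + z \<notin> F (n0 + Suc j)"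
        using add_subgroupD(4)[OF F(1) _ True, of "y + z"] z(3) by auto
      ultimately show ?thesis
        using z(2) by (intro that[of "y + z"]) auto
    next
      case False
      then show ?thesis
        using y A0[of "e/2"] by (intro that[of y]) auto
    qed
    have "min (e/2) (1 / Suc (Suc j)) > 0"
      using y(2) by simp
    from avoid[OF y'(3) _ this] obtain e' where e': "e' > 0" "e' \<le> min (e/2) (1 / Suc (Suc j))"
      "\<forall>a\<in>A e'. y' + a \<notin> F (n0 + Suc j)"
      by auto
    have "y' + a \<in> (+) y ` A e" if "a \<in> A e'" for a
    proof -
      have "a \<in> A (e/2)"
        using A_mono[of e' "e/2"] e'(2) that by auto
      then have "(y' - y) + a \<in> A e"
        using A_add[OF y'(2), of a "e/2"] by simp
      then show ?thesis
        by (intro image_eqI[of _ _ "(y' - y) + a"]) auto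
    qed
    then show "\<exists>q. P (Suc j) q \<and> (+) (fst q) ` A (snd q) \<subseteq> (+) (fst p) ` A (snd p)"
      using e' y'(1) by (intro exI[of _ "(y', e')"]) (auto simp: P_def ye)
  qed
  then obtain s where s: "\<And>j. P j (s j)"
    "\<And>j. (+) (fst (s (Suc j))) ` A (snd (s (Suc j))) \<subseteq> (+) (fst (s j)) ` A (snd (s j))"
    by blast
  have "(\<Inter>j. (+) (fst (s j)) ` A (snd (s j))) \<noteq> {}"
  proof (rule compact_nested_Int_nonempty[OF cpt])
    show "closed ((+) (fst (s j)) ` A (snd (s j)))" for j
    proof -
      have "(+) (fst (s j)) ` A (snd (s j)) = (\<lambda>x. x - fst (s j)) -` A (snd (s j))"
        by (force simp: image_iff algebra_simps)
      then show ?thesis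
        using closed_vimage[OF A_closed continuous_translation(2)[OF continuous_on_id]] by simp
    qed
    show "(+) (fst (s j)) ` A (snd (s j)) \<noteq> {}" for j
      using A0[of "snd (s j)"] s(1)[of j] by (auto simp: P_def)
  qed (rule s(2))
  then obtain x where x: "\<And>j. x \<in> (+) (fst (s j)) ` A (snd (s j))" by blast
  have "x \<notin> F (n0 + j)" for j
    using x[of j] s(1)[of j] by (auto simp: P_def)
  moreover have "x \<in> F i \<Longrightarrow> x \<in> F (n0 + i)" for i
    using monoD[OF mono, of i "n0 + i"] by auto
  ultimately have "x \<notin> H"
    using assms(6) by (auto simp: H_def)
  \<comment> \<open>The centres lie in \<open>H\<close> and approximate \<open>x\<close> uniformly
    in \<open>n\<close>, and a uniform limit of null sequences is a null sequence.\<close>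
  moreover have "x \<in> H"
    unfolding H_def char_seq_set_def mem_Collect_eq tendsto_circle_exp_iff
  proof (rule tendstoI)
    fix e :: real assume "e > 0"
    then obtain j where j: "1 / Suc j < e / 2"
      using nat_approx_posE[of "e/2"] by auto
    obtain a where a: "a \<in> A (snd (s j))" "x = fst (s j) + a"
      using x[of j] by blast
    have "(\<lambda>n. circle_exp (u n (fst (s j)))) \<longlonglongrightarrow> 1"
      using s(1)[of j] by (simp add: P_def H_def char_seq_set_def tendsto_circle_exp_iff)
    then have "\<forall>\<^sub>F n in sequentially. dist (circle_exp (u n (fst (s j)))) 1 < e / 2"
      by (rule tendstoD) (use \<open>e > 0\<close> in simp)
    then show "\<forall>\<^sub>F n in sequentially. dist (circle_exp (u n x)) 1 < e"
    proof (rule eventually_mono)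
      fix n assume n: "dist (circle_exp (u n (fst (s j)))) 1 < e / 2"
      have "snd (s j) < e / 2"
        using s(1)[of j] j by (simp add: P_def)
      moreover have "norm (circle_exp (u n a) - 1) \<le> snd (s j)"
        using a(1) by (simp add: A_def)
      ultimately have an: "norm (circle_exp (u n a) - 1) < e / 2"
        by linarith
      have "circle_exp (u n x) - 1
          = (circle_exp (u n (fst (s j))) - 1) * circle_exp (u n a) + (circle_exp (u n a) - 1)"
        by (simp add: a(2) character_add[OF u] circle_exp_add algebra_simps)
      also have "norm \<dots> \<le> norm (circle_exp (u n (fst (s j))) - 1) * 1 + norm (circle_exp (u n a) - 1)"
        by (metis norm_circle_exp norm_mult norm_triangle_ineq)
      finally show "dist (circle_exp (u n x)) 1 < e"
        using n an by (simp add: dist_norm)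
    qed
  qed
  ultimately show False by blast
qed

lemma index_condition_if_char_seq_set:
  fixes F :: "nat \<Rightarrow> 'a::{topological_ab_group_add, t2_space} set"
  assumes cpt: "compact (UNIV :: 'a set)" and F: "\<And>n. add_subgroup (F n)" "\<And>n. closed (F n)"
    and mono: "mono F" and u: "\<And>n. u n \<in> characters" and H: "char_seq_set u = (\<Union>n. F n)"
  shows "\<exists>m. metrizable_space (quotient_space (F m)) \<and> (\<forall>n\<ge>m. finite_index (F (Suc n)) (F n))"
proof -
  define K where "K = {x. \<forall>n. u n x = 0}"
  have "add_subgroup K"
    by (simp add: K_def add_subgroup_def character_0[OF u] character_add[OF u] character_minus[OF u])
  moreover have "closed K"
  proof -
    have "K = (\<Inter>n. u n -` {0})"
      by (auto simp: K_def)
    then show ?thesis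
      by (auto intro!: closed_vimage character_continuous u)
  qed
  \<comment> \<open>The common kernel consists of trivial points of convergence; being closed, it
    fits into one member of the chain.\<close>
  moreover have "K \<subseteq> (\<Union>n. F n)"
    unfolding H[symmetric] K_def by (auto simp: char_seq_set_def)
  ultimately obtain n0 where n0: "K \<subseteq> F n0"
    by (rule closed_subgroup_subset_chain[OF cpt F mono])
  obtain m e where me: "m \<ge> n0" "e > 0"
    "\<And>x. x \<in> char_seq_set u \<Longrightarrow> (\<And>n. norm (circle_exp (u n x) - 1) \<le> e) \<Longrightarrow> x \<in> F m"
    by (rule uniform_nbhd_in_chain[OF cpt F mono u H n0[unfolded K_def]]) blast
  have "K \<subseteq> F m"
    using n0 monoD[OF mono me(1)] by blast
  then have "metrizable_space (quotient_space (F m))"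
    by (intro metrizable_quotient_by_characters[OF cpt F(1) F(2) u]) (simp add: K_def)
  moreover have "finite_index (F (Suc n)) (F n)" if n: "n \<ge> m" for n
  proof -
    let ?G = "F (Suc n)"
    note cu = continuous_circle_exp_character[OF u]
    \<comment> \<open>Half of \<open>e\<close>, because a difference of two points of
      \<open>A N\<close> will be used.\<close>
    define A where "A N = {x. \<forall>k\<ge>N. norm (circle_exp (u k x) - 1) \<le> e/2}" for N
    have A_closed: "closed (A N)" for N
    proof -
      have "A N = (\<Inter>k\<in>{N..}. {x. norm (circle_exp (u k x) - 1) \<le> e/2})"
        by (auto simp: A_def)
      moreover have "closed {x. norm (circle_exp (u k x) - 1) \<le> e/2}" for k
        by (intro closed_Collect_le continuous_on_norm continuous_on_diff cu continuous_on_const)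
      ultimately show ?thesis by auto
    qed
    have GH: "?G \<subseteq> char_seq_set u"
      using H by blast
    have A_cover: "?G \<subseteq> (\<Union>N. A N)"
    proof
      fix x assume "x \<in> ?G"
      then have "(\<lambda>n. circle_exp (u n x)) \<longlonglongrightarrow> 1"
        using GH by (auto simp: char_seq_set_def tendsto_circle_exp_iff)
      then have "\<forall>\<^sub>F n in sequentially. dist (circle_exp (u n x)) 1 < e/2"
        by (rule tendstoD) (use me(2) in simp)
      then obtain N where "\<And>n. n \<ge> N \<Longrightarrow> dist (circle_exp (u n x)) 1 < e/2"
        unfolding eventually_sequentially by blast
      then have "x \<in> A N"
        by (auto simp: A_def dist_norm intro: less_imp_le)
      then show "x \<in> (\<Union>N. A N)"
        by blast
    qed
    have "?G \<noteq> {}"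
      using add_subgroupD(1)[OF F(1)] by blast
    then obtain N V where V: "open V" "V \<inter> ?G \<noteq> {}" "V \<inter> ?G \<subseteq> A N"
      by (rule Baire_compact_t2[OF cpt F(2) _ A_closed A_cover])
    then obtain c where c: "c \<in> V" "c \<in> ?G" by blast
    \<comment> \<open>The indices below \<open>N\<close> are controlled by continuity, the others by
      writing \<open>x\<close> as a difference of two points of \<open>A N\<close>.\<close>
    define U where "U = (+) (- c) ` V \<inter> (\<Inter>k<N. (\<lambda>x. circle_exp (u k x)) -` ball 1 e)"
    have "open U"
      unfolding U_def by (intro open_Int open_translate V(1) open_INT finite_lessThan ballI open_vimage cu) auto
    moreover have "0 \<in> U"
      using c(1) me(2) by (force simp: U_def character_0[OF u] circle_exp_0)
    moreover have "U \<inter> ?G \<subseteq> F n"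
    proof clarify
      fix x assume x: "x \<in> U" "x \<in> ?G"
      obtain v where v: "v \<in> V" "x = - c + v"
        using x(1) by (auto simp: U_def)
      have "v = c + x"
        using v(2) by simp
      then have "v \<in> ?G"
        using add_subgroupD(2)[OF F(1) c(2) x(2)] by simp
      then have vA: "v \<in> A N" "c \<in> A N"
        using V(3) v(1) c by auto
      have "norm (circle_exp (u k x) - 1) \<le> e" for k
      proof (cases "k < N")
        case True
        then show ?thesis
          using x(1) by (auto simp: U_def dist_norm norm_minus_commute less_imp_le)
      next
        case False
        have "circle_exp (u k v) - circle_exp (u k c) = (circle_exp (u k x) - 1) * circle_exp (u k c)"
          by (simp add: \<open>v = c + x\<close> character_add[OF u] circle_exp_add algebra_simps)
        then have "norm (circle_exp (u k x) - 1) = norm ((circle_exp (u k v) - 1) - (circle_exp (u k c) - 1))"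
          by (simp add: norm_mult norm_circle_exp)
        also have "\<dots> \<le> e/2 + e/2"
          using vA False by (intro order_trans[OF norm_triangle_ineq4 add_mono]) (auto simp: A_def)
        finally show ?thesis by simp
      qed
      then have "x \<in> F m"
        using me(3) GH x(2) by blast
      then show "x \<in> F n"
        using monoD[OF mono n] by blast
    qed
    ultimately show ?thesis
      by (rule finite_index_if_nbhd[OF cpt F(1) F(2) F(1)])
  qed
  ultimately show ?thesis by blast
qed

section \<open>From the index condition to sequences\<close>

text \<open>While a unit number \<open>w\<close> satisfies \<open>norm (w - 1) \<le> 1\<close>, the
  parallelogram law gives \<open>norm (w + 1)\<close> at least the square root of 3. Since
  \<open>w\<^sup>2 - 1\<close> factors, squaring multiplies the distance to 1 by at least 3/2, which
  cannot go on forever.\<close>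

lemma unit_powers_near_1:
  fixes z :: complex
  assumes "norm z = 1" "\<And>k. norm (z ^ k - 1) \<le> 1"
  shows "z = 1"
proof (rule ccontr)
  assume "z \<noteq> 1"
  have "(3/2) ^ j * norm (z - 1) \<le> norm (z ^ (2 ^ j) - 1)" for j
  proof (induction j)
    case (Suc j)
    define w where "w = z ^ (2 ^ j)"
    have w: "norm w = 1" "norm (w - 1) \<le> 1"
      using assms by (simp_all add: w_def norm_power)
    have "(norm (w + 1))\<^sup>2 + (norm (w - 1))\<^sup>2 = 2 * (norm w)\<^sup>2 + 2"
      unfolding cmod_power2 by (simp add: power2_eq_square algebra_simps)
    moreover have "(norm (w - 1))\<^sup>2 \<le> 1"
      using w(2) by (simp add: power_le_one)
    ultimately have "(norm (w + 1))\<^sup>2 \<ge> 3"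
      using w(1) by simp
    then have "(3/2)\<^sup>2 \<le> (norm (w + 1))\<^sup>2"
      by (simp add: power2_eq_square)
    then have "3/2 \<le> norm (w + 1)"
      by (rule power2_le_imp_le) simp
    then have "(3/2) * ((3/2) ^ j * norm (z - 1)) \<le> norm (w + 1) * norm (w - 1)"
      using Suc by (intro mult_mono) (auto simp: w_def)
    also have "\<dots> = norm (w\<^sup>2 - 1)"
      by (simp add: norm_mult[symmetric] power2_eq_square algebra_simps)
    also have "w\<^sup>2 = z ^ (2 ^ Suc j)"
      by (simp add: w_def power_mult[symmetric] mult.commute)
    finally show ?case by simp
  qed simp
  then have "(3/2) ^ j * norm (z - 1) \<le> 1" for j
    using assms(2) order_trans by blast
  moreover obtain j where "(3/2) ^ j > 1 / norm (z - 1)"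
    using real_arch_pow[of "3/2"] by auto
  ultimately show False
    using \<open>z \<noteq> 1\<close> by (metis divide_less_eq not_le right_minus_eq zero_less_norm_iff)
qed

text \<open>Outside \<open>G + U\<close> a separating character exists at each point, and one of its
  multiples exceeds distance 1 there; compactness leaves finitely many. Taking multiples is what
  frees the threshold from any dependence on \<open>G\<close> and \<open>U\<close>.\<close>

lemma finite_separating_characters:
  fixes G :: "'a::{topological_ab_group_add, t2_space} set"
  assumes cpt: "compact (UNIV :: 'a set)" and G: "add_subgroup G" "closed G" and U: "open U" "0 \<in> U"
  shows "\<exists>S. finite S \<and> S \<noteq> {} \<and> S \<subseteq> characters \<and> (\<forall>\<phi>\<in>S. \<forall>x\<in>G. \<phi> x = 0) \<and>
    (\<forall>x. (\<forall>\<phi>\<in>S. norm (circle_exp (\<phi> x) - 1) \<le> 1) \<longrightarrow> (\<exists>g\<in>G. x - g \<in> U))"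
proof -
  define A where "A = {\<phi> \<in> characters. \<forall>x\<in>G. \<phi> x = 0}"
  define C where "C = - (\<Union>g\<in>G. (+) g ` U)"
  have "closed C"
    unfolding C_def using open_translate[OF U(1)] by (intro closed_Compl open_UN) auto
  then have "compact C"
    using compact_Int_closed[OF cpt] by (metis inf_top_left)
  define V where "V \<phi> = {x. 1 < norm (circle_exp (\<phi> x) - 1)}" for \<phi> :: "'a \<Rightarrow> circle"
  have "open (V \<phi>)" if "\<phi> \<in> A" for \<phi>
    unfolding V_def using that
    by (intro open_Collect_less continuous_on_norm continuous_on_diff continuous_circle_exp_character
        continuous_on_const) (auto simp: A_def)
  moreover have "C \<subseteq> (\<Union>\<phi>\<in>A. V \<phi>)"
  proof
    fix x assume "x \<in> C"
    then have "x \<notin> G"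
      using U(2) by (force simp: C_def)
    then obtain \<phi> where \<phi>: "\<phi> \<in> characters" "\<And>x. x \<in> G \<Longrightarrow> \<phi> x = 0" "\<phi> x \<noteq> 0"
      by (rule separating_character[OF cpt G]) blast
    have "circle_exp (\<phi> x) \<noteq> 1"
      using \<phi>(3) circle_exp_eq_1_iff by blast
    then obtain k where k: "\<not> norm (circle_exp (\<phi> x) ^ k - 1) \<le> 1"
      using unit_powers_near_1[OF norm_circle_exp] by blast
    define \<psi> where "\<psi> = ((\<lambda>\<psi> x. \<phi> x + \<psi> x) ^^ k) (\<lambda>x. 0)"
    have "\<psi> \<in> A \<and> circle_exp (\<psi> x) = circle_exp (\<phi> x) ^ k"
      unfolding \<psi>_def
      by (induction k) (simp_all add: A_def zero_character add_characters \<phi>(1,2) circle_exp_0 circle_exp_add)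
    with k show "x \<in> (\<Union>\<phi>\<in>A. V \<phi>)"
      by (auto simp: V_def not_le intro!: bexI[of _ \<psi>])
  qed
  ultimately obtain D where D: "D \<subseteq> A" "finite D" "C \<subseteq> (\<Union>\<phi>\<in>D. V \<phi>)"
    using compactE_image[OF \<open>compact C\<close>, of A V] by metis
  have "\<exists>g\<in>G. x - g \<in> U" if "\<forall>\<phi>\<in>insert (\<lambda>x. 0) D. norm (circle_exp (\<phi> x) - 1) \<le> 1" for x
  proof -
    have "x \<notin> C"
      using D(3) that by (force simp: V_def)
    then obtain g v where "g \<in> G" "v \<in> U" "x = g + v"
      by (auto simp: C_def)
    then show ?thesis
      by (intro bexI[of _ g]) auto
  qed
  \<comment> \<open>The zero character is inserted only to make the set nonempty, which later
    ensures that infinitely many terms are enumerated.\<close>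
  then show ?thesis
    using D(1,2) by (intro exI[of _ "insert (\<lambda>x. 0) D"] conjI) (auto simp: A_def zero_character)
qed

text \<open>Preimages of the balls around the zero coset. Being unions of cosets, they tolerate
  errors in \<open>L\<close>.\<close>

lemma G_delta_if_metrizable_quotient:
  fixes L :: "'a::topological_ab_group_add set"
  assumes L: "add_subgroup L" and met: "metrizable_space (quotient_space L)"
  obtains W :: "nat \<Rightarrow> 'a set" where "\<And>n. open (W n)" "\<And>n. 0 \<in> W n"
    "\<And>n x t. x \<in> W n \<Longrightarrow> t \<in> L \<Longrightarrow> x + t \<in> W n" "(\<Inter>n. W n) = L"
proof -
  obtain M d where M: "Metric_space M d" "quotient_space L = Metric_space.mtopology M d"
    using met unfolding metrizable_space_def by blast
  interpret Metric_space M d by (rule M(1))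
  have M_eq: "M = range (coset L)"
    using topspace_quotient_space[of L] unfolding M(2) by simp
  have cM: "coset L x \<in> M" for x
    by (simp add: M_eq)
  define W where "W n = coset L -` mball (coset L 0) (1 / Suc n)" for n
  show ?thesis
  proof (rule that[of W])
    show "open (W n)" for n
    proof -
      have "openin (quotient_space L) (mball (coset L 0) (1 / Suc n))"
        unfolding M(2) by simp
      then show ?thesis
        unfolding openin_quotient_space W_def by blast
    qed
    show "0 \<in> W n" for n
      by (simp add: W_def cM)
    show "x + t \<in> W n" if "x \<in> W n" "t \<in> L" for n x t
    proof -
      have "coset L (x + t) = coset L x"
        using that(2) by (simp add: coset_eq_iff[OF L])
      with that(1) show ?thesis
        by (simp add: W_def)
    qed
    show "(\<Inter>n. W n) = L"
    proof (intro equalityI subsetI)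
      fix x assume "x \<in> (\<Inter>n. W n)"
      then have "d (coset L 0) (coset L x) \<le> 0 + 1 / Suc n" for n
        by (auto simp: W_def less_imp_le)
      then have "d (coset L 0) (coset L x) \<le> 0"
        by (rule le_if_le_add_divide_Suc)
      then have "coset L 0 = coset L x"
        using zero[of "coset L 0" "coset L x"] nonneg[of "coset L 0" "coset L x"] by (simp add: cM)
      then have "- x \<in> L"
        by (simp add: coset_eq_iff[OF L])
      then show "x \<in> L"
        using add_subgroupD(3)[OF L, of "- x"] by simp
    next
      fix x assume "x \<in> L"
      then have "coset L x = coset L 0"
        by (simp add: coset_eq_iff[OF L])
      then show "x \<in> (\<Inter>n. W n)"
        by (simp add: W_def cM)
    qed
  qed
qed

lemma char_seq_set_if_index_condition:
  fixes F :: "nat \<Rightarrow> 'a::{topological_ab_group_add, t2_space} set"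
  assumes cpt: "compact (UNIV :: 'a set)" and F: "\<And>n. add_subgroup (F n)" "\<And>n. closed (F n)"
    and mono: "mono F" and met: "metrizable_space (quotient_space (F m))"
    and fin: "\<And>n. n \<ge> m \<Longrightarrow> finite_index (F (Suc n)) (F n)"
  shows "\<exists>u. (\<forall>n. u n \<in> characters) \<and> (\<Union>n. F n) = char_seq_set u"
proof -
  let ?L = "F m"
  have le: "F i \<subseteq> F j" if "i \<le> j" for i j
    using monoD[OF mono that] .
  obtain W :: "nat \<Rightarrow> 'a set" where W: "\<And>n. open (W n)" "\<And>n. 0 \<in> W n"
    "\<And>n x t. x \<in> W n \<Longrightarrow> t \<in> ?L \<Longrightarrow> x + t \<in> W n" "(\<Inter>n. W n) = ?L"
    by (rule G_delta_if_metrizable_quotient[OF F(1) met]) blast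
  \<comment> \<open>Each finite-index step makes \<open>F n\<close> relatively open in
    \<open>F (Suc n)\<close>; by induction \<open>F m\<close> is relatively open in every later
    group.\<close>
  have "\<exists>V. open V \<and> 0 \<in> V \<and> V \<inter> F n \<subseteq> ?L" if "n \<ge> m" for n
    using that
  proof (induction n rule: dec_induct)
    case base
    show ?case by (rule exI[of _ UNIV]) simp
  next
    case (step n)
    then obtain V where V: "open V" "0 \<in> V" "V \<inter> F n \<subseteq> ?L" by blast
    obtain U where "open U" "0 \<in> U" "U \<inter> F (Suc n) \<subseteq> F n"
      by (rule nbhd_if_finite_index[OF F(1) F(2) fin[OF step(1)]])
    with V show ?case
      by (intro exI[of _ "U \<inter> V"]) auto
  qed
  note nbhd = this
  \<comment> \<open>The index \<open>Suc n\<close> is essential: the approximants \<open>g n\<close>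
    and \<open>g (Suc n)\<close> will be compared, and their difference lies only in
    \<open>F (Suc n)\<close>.\<close>
  have "\<forall>n. \<exists>N. open N \<and> 0 \<in> N \<and> (n \<ge> m \<longrightarrow> (\<forall>x\<in>N. \<forall>y\<in>N. x - y \<in> F (Suc n) \<longrightarrow> x - y \<in> ?L))"
  proof
    fix n
    show "\<exists>N. open N \<and> 0 \<in> N \<and> (n \<ge> m \<longrightarrow> (\<forall>x\<in>N. \<forall>y\<in>N. x - y \<in> F (Suc n) \<longrightarrow> x - y \<in> ?L))"
    proof (cases "n \<ge> m")
      case True
      then obtain V where V: "open V" "0 \<in> V" "V \<inter> F (Suc n) \<subseteq> ?L"
        using nbhd[of "Suc n"] by auto
      obtain N where "open N" "0 \<in> N" "\<And>x y. x \<in> N \<Longrightarrow> y \<in> N \<Longrightarrow> x - y \<in> V"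
        by (rule nbhd_add[OF V(1,2)]) blast
      with V(3) show ?thesis by blast
    qed (auto intro: exI[of _ UNIV])
  qed
  from choice[OF this] obtain N where
    N: "\<forall>n. open (N n) \<and> 0 \<in> N n \<and> (n \<ge> m \<longrightarrow> (\<forall>x\<in>N n. \<forall>y\<in>N n. x - y \<in> F (Suc n) \<longrightarrow> x - y \<in> ?L))" ..
  have N_open: "open (N n)" and N_0: "0 \<in> N n" for n
    using N by simp_all
  have N_diff: "x - y \<in> ?L" if "n \<ge> m" "x \<in> N n" "y \<in> N n" "x - y \<in> F (Suc n)" for n x y
    using N that by simp
  \<comment> \<open>Intersecting over all \<open>k \<le> n\<close> makes the sets decrease, so that
    \<open>x - g (Suc n)\<close> also lies in \<open>N n\<close> and every fixed \<open>W k\<close>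
    is eventually reached.\<close>
  define U where "U n = (\<Inter>k\<le>n. N k \<inter> W k)" for n
  have U: "open (U n)" "0 \<in> U n" for n
    unfolding U_def using N_0 W(2) by (auto intro!: open_INT open_Int N_open W(1))
  have "\<forall>n. \<exists>S. finite S \<and> S \<noteq> {} \<and> S \<subseteq> characters \<and> (\<forall>\<phi>\<in>S. \<forall>x\<in>F n. \<phi> x = 0) \<and>
      (\<forall>x. (\<forall>\<phi>\<in>S. norm (circle_exp (\<phi> x) - 1) \<le> 1) \<longrightarrow> (\<exists>g\<in>F n. x - g \<in> U n))"
    by (intro allI finite_separating_characters cpt F U)
  from choice[OF this] obtain S where S': "\<forall>n. finite (S n) \<and> S n \<noteq> {} \<and> S n \<subseteq> characters \<and>
      (\<forall>\<phi>\<in>S n. \<forall>x\<in>F n. \<phi> x = 0) \<and>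
      (\<forall>x. (\<forall>\<phi>\<in>S n. norm (circle_exp (\<phi> x) - 1) \<le> 1) \<longrightarrow> (\<exists>g\<in>F n. x - g \<in> U n))" ..
  have S: "finite (S n)" "S n \<noteq> {}" "S n \<subseteq> characters" "\<phi> \<in> S n \<Longrightarrow> x \<in> F n \<Longrightarrow> \<phi> x = 0" for n \<phi> x
    using S' by simp_all
  have S_nbhd: "\<exists>g\<in>F n. x - g \<in> U n"
    if "\<And>\<phi>. \<phi> \<in> S n \<Longrightarrow> norm (circle_exp (\<phi> x) - 1) \<le> 1" for n x
    using S' that by simp
  \<comment> \<open>Characters are tagged with their index, since one character may belong to
    several \<open>S n\<close> and must then be counted each time.\<close>
  define P where "P = Sigma UNIV S"
  have "countable P"
    unfolding P_def using S(1) by (intro countable_SIGMA) (auto intro: countable_finite)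
  moreover have "infinite P"
  proof
    assume "finite P"
    then have "finite (fst ` P)" by simp
    moreover have "fst ` P = UNIV"
      unfolding P_def using S(2) by force
    ultimately show False by simp
  qed
  ultimately have "bij_betw (from_nat_into P) UNIV P"
    by (rule bij_betw_from_nat_into)
  moreover define e where "e = from_nat_into P"
  ultimately have e: "inj e" "P = range e"
    by (auto simp: bij_betw_def)
  define u where "u k = snd (e k)" for k :: nat
  have u: "u k \<in> characters" for k
  proof -
    have "e k \<in> P"
      by (simp add: e(2))
    then show ?thesis
      using S(3)[of "fst (e k)"] by (auto simp: u_def P_def)
  qed
  \<comment> \<open>Convergence to 0 depends only on finiteness of exceptional sets, so the order of
    the enumeration is irrelevant.\<close>
  have fin_iff: "finite {k. u k x \<notin> V} \<longleftrightarrow> finite {p \<in> P. snd p x \<notin> V}" for x V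
  proof -
    have "{p \<in> P. snd p x \<notin> V} = e ` {k. u k x \<notin> V}"
      unfolding u_def e(2) by auto
    then show ?thesis
      using finite_image_iff[OF inj_on_subset[OF e(1)]] by simp
  qed
  have "(\<Union>n. F n) = char_seq_set u"
  proof (intro equalityI subsetI)
    fix x assume "x \<in> (\<Union>n. F n)"
    then obtain n where n: "x \<in> F n" by blast
    have "finite {p \<in> P. snd p x \<notin> V}" if "0 \<in> V" for V
    proof (rule finite_subset)
      show "{p \<in> P. snd p x \<notin> V} \<subseteq> Sigma {..<n} S"
      proof clarify
        fix k \<phi> assume p: "(k, \<phi>) \<in> P" "snd (k, \<phi>) x \<notin> V"
        then have "\<phi> x \<noteq> 0" "\<phi> \<in> S k"
          using that by (auto simp: P_def)
        then have "x \<notin> F k"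
          using S(4) by blast
        then show "k \<in> {..<n} \<and> \<phi> \<in> S k"
          using le[of n k] n \<open>\<phi> \<in> S k\<close> by (auto simp: not_le[symmetric])
      qed
    qed (use S(1) in auto)
    then show "x \<in> char_seq_set u"
      by (simp add: char_seq_set_def tendsto_iff_finite fin_iff)
  next
    fix x assume x: "x \<in> char_seq_set u"
    define V where "V = circle_exp -` ball 1 1"
    have "open V \<and> 0 \<in> V"
      unfolding V_def by (auto intro: open_vimage continuous_circle_exp simp: circle_exp_0)
    then have "finite {p \<in> P. snd p x \<notin> V}"
      using x unfolding char_seq_set_def mem_Collect_eq tendsto_iff_finite fin_iff by blast
    then have "finite (fst ` {p \<in> P. snd p x \<notin> V})" by simp
    from finite_nat_bounded[OF this] obtain n1 where n1: "fst ` {p \<in> P. snd p x \<notin> V} \<subseteq> {..<n1}" ..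
    \<comment> \<open>The maximum with \<open>m\<close> makes \<open>N_diff\<close> applicable and
      puts \<open>F m\<close> inside \<open>F n2\<close>.\<close>
    define n2 where "n2 = max n1 m"
    have "\<exists>g\<in>F n. x - g \<in> U n" if "n \<ge> n2" for n
    proof (rule S_nbhd)
      fix \<phi> assume "\<phi> \<in> S n"
      then have "(n, \<phi>) \<in> P"
        by (simp add: P_def)
      moreover have "n \<notin> {..<n1}"
        using that by (simp add: n2_def)
      ultimately have "\<phi> x \<in> V"
        using n1 by force
      then show "norm (circle_exp (\<phi> x) - 1) \<le> 1"
        by (simp add: V_def dist_norm norm_minus_commute)
    qed
    then obtain g where g: "\<And>n. n \<ge> n2 \<Longrightarrow> g n \<in> F n" "\<And>n. n \<ge> n2 \<Longrightarrow> x - g n \<in> U n"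
      by metis
    have step: "g (Suc n) - g n \<in> ?L" if "n \<ge> n2" for n
    proof -
      have "x - g n \<in> N n" "x - g (Suc n) \<in> N n"
        using g(2)[OF that] g(2)[of "Suc n"] that by (auto simp: U_def)
      moreover have "(x - g n) - (x - g (Suc n)) \<in> F (Suc n)"
        using add_subgroupD(4)[OF F(1), of "g (Suc n)" "Suc n" "g n"] g(1)[of "Suc n"] g(1)[of n] that
          le[of n "Suc n"] by auto
      ultimately have "(x - g n) - (x - g (Suc n)) \<in> ?L"
        using that by (intro N_diff[of n]) (auto simp: n2_def)
      then show ?thesis by simp
    qed
    have diff: "g n - g n2 \<in> ?L" if "n \<ge> n2" for n
      using that
    proof (induction n rule: dec_induct)
      case base
      then show ?case
        using add_subgroupD(1)[OF F(1)] by simp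
    next
      case (step n)
      have "(g (Suc n) - g n) + (g n - g n2) \<in> ?L"
        using \<open>\<And>n. n \<ge> n2 \<Longrightarrow> g (Suc n) - g n \<in> ?L\<close>[OF step(1)] step(3)
        by (rule add_subgroupD(2)[OF F(1)])
      then show ?case by simp
    qed
    \<comment> \<open>The fixed \<open>g n2\<close> replaces the varying \<open>g n\<close> at the
      cost of an element of \<open>F m\<close>, which \<open>W k\<close> absorbs.\<close>
    have "x - g n2 \<in> W k" for k
    proof -
      define n where "n = max k n2"
      have "x - g n \<in> W k"
        using g(2)[of n] by (auto simp: U_def n_def)
      moreover have "g n - g n2 \<in> ?L"
        by (rule diff) (simp add: n_def)
      ultimately have "(x - g n) + (g n - g n2) \<in> W k"
        by (rule W(3))
      then show ?thesis by simp
    qed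
    then have "x - g n2 \<in> ?L"
      using W(4) by blast
    then have "x - g n2 \<in> F n2"
      using le[of m n2] by (auto simp: n2_def)
    then have "(x - g n2) + g n2 \<in> F n2"
      using g(1)[of n2] by (intro add_subgroupD(2)[OF F(1)]) auto
    then show "x \<in> (\<Union>n. F n)"
      by auto
  qed
  with u show ?thesis by blast
qed

theorem theorem1p5:
  fixes F :: "nat \<Rightarrow> 'a::{topological_ab_group_add, t2_space} set"
    and H :: "'a set"
  assumes compact_X: "compact (UNIV :: 'a set)"
    and subgroup_F: "\<And>n. add_subgroup (F n)"
    and closed_F: "\<And>n. closed (F n)"
    and strict_F: "\<And>n. F n \<subset> F (Suc n)"
    and H_eq: "H = (\<Union>n. F n)"
  shows "((\<exists>B. B \<subseteq> characters \<and> countable B \<and> infinite B \<and> H = char_conv_set B)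
            \<longleftrightarrow> (\<exists>u. (\<forall>n. u n \<in> characters) \<and> H = char_seq_set u))
       \<and> ((\<exists>u. (\<forall>n. u n \<in> characters) \<and> H = char_seq_set u)
            \<longleftrightarrow> (\<exists>m. metrizable_space (quotient_space (F m))
                     \<and> (\<forall>n\<ge>m. finite_index (F (Suc n)) (F n))))"
proof (intro conjI iffI)
  have mono: "mono F"
    unfolding mono_iff_le_Suc using psubset_imp_subset[OF strict_F] by blast
  show "\<exists>u. (\<forall>n. u n \<in> characters) \<and> H = char_seq_set u"
    if ex: "\<exists>B. B \<subseteq> characters \<and> countable B \<and> infinite B \<and> H = char_conv_set B"
  proof -
    obtain B where B: "B \<subseteq> characters" "countable B" "infinite B" "H = char_conv_set B"
      using ex by blast
    \<comment> \<open>An enumeration without repetitions, so that exceptional characters and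
      exceptional indices correspond one to one.\<close>
    then have bij: "bij_betw (from_nat_into B) UNIV B"
      by (intro bij_betw_from_nat_into)
    then have "inj (from_nat_into B)" "range (from_nat_into B) = B"
      by (auto simp: bij_betw_def)
    then show ?thesis
      using char_conv_set_range[of "from_nat_into B"] B by (intro exI[of _ "from_nat_into B"]) auto
  qed
  show "\<exists>B. B \<subseteq> characters \<and> countable B \<and> infinite B \<and> H = char_conv_set B"
    if ex: "\<exists>u. (\<forall>n. u n \<in> characters) \<and> H = char_seq_set u"
  proof -
    obtain u where u: "\<And>n. u n \<in> characters" "H = char_seq_set u"
      using ex by blast
    have "infinite (range u)"
    proof
      assume "finite (range u)"
      then have "add_subgroup H" "closed H" "H \<subseteq> (\<Union>n. F n)"
        unfolding u(2) using char_seq_set_if_finite_range[OF u(1)] add_subgroup_char_seq_set[OF u(1)] u(2) H_eq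
        by auto
      then obtain n where "H \<subseteq> F n"
        by (rule closed_subgroup_subset_chain[OF compact_X subgroup_F closed_F mono])
      with strict_F[of n] H_eq show False by blast
    qed
    then obtain B where "B \<subseteq> characters" "countable B" "infinite B" "char_conv_set B = char_seq_set u"
      by (rule char_conv_set_if_infinite_range[OF u(1)])
    then show ?thesis
      unfolding u(2) by blast
  qed
  show "\<exists>m. metrizable_space (quotient_space (F m)) \<and> (\<forall>n\<ge>m. finite_index (F (Suc n)) (F n))"
    if ex: "\<exists>u. (\<forall>n. u n \<in> characters) \<and> H = char_seq_set u"
  proof -
    obtain u where "\<And>n. u n \<in> characters" "char_seq_set u = (\<Union>n. F n)"
      using ex H_eq by blast
    then show ?thesis
      by (rule index_condition_if_char_seq_set[OF compact_X subgroup_F closed_F mono])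
  qed
  show "\<exists>u. (\<forall>n. u n \<in> characters) \<and> H = char_seq_set u"
    if ex: "\<exists>m. metrizable_space (quotient_space (F m)) \<and> (\<forall>n\<ge>m. finite_index (F (Suc n)) (F n))"
  proof -
    obtain m where "metrizable_space (quotient_space (F m))" "\<And>n. n \<ge> m \<Longrightarrow> finite_index (F (Suc n)) (F n)"
      using ex by blast
    then show ?thesis
      unfolding H_eq by (rule char_seq_set_if_index_condition[OF compact_X subgroup_F closed_F mono])
  qed
qed

end
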